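(* For each $\xi>0$ and each $\zeta>0$, it holds with probability tending to $1$ as $\varepsilon\to0$ that every simple lattice path $P$ in $\mathbb S^\varepsilon$ with $L_h^{\xi,\varepsilon}(P)\le\varepsilon^{\lambda(\xi)-\zeta}$ satisfies $$\#P\le\varepsilon^{\lambda(\xi)-\xi\left(\sqrt{2+2\lambda(\xi)+\xi^2}-\xi\right)-1-\zeta}.$$ In particular, $$g(\xi)\le1-\lambda(\xi)+\xi\left(\sqrt{2+2\lambda(\xi)+\xi^2}-\xi\right).$$
   Context: Let $h$ be a whole-plane Gaussian free field, normalized so that its circle average over the unit circle $\partial\mathbb D$ is zero. For $\varepsilon>0$ and $z\in\mathbb C$, $h_\varepsilon(z)$ denotes the average of $h$ over the circle of radius $\varepsilon$ centered at $z$. Let $\mathbb S=[0,1]^2$ and $\mathbb S^\varepsilon=(\varepsilon\mathbb Z^2)\cap\mathbb S$, with its nearest-neighbor graph structure. For $\xi\ge0$, $\varepsilon>0$ and a lattice path $P:\{0,1,\dots,N\}\to\mathbb S^\varepsilon$ (consecutive vertices are nearest neighbors), define the $\varepsilon$-LFPP (Liouville first passage percolation) length $L_h^{\xi,\varepsilon}(P)=\sum_{j=0}^N\varepsilon e^{\xi h_\varepsilon(P(j))}$, and let $\#P$ be the number of vertices in $P$. A path is simple if it does not visit any vertex more than once. For $z,w\in\mathbb S^\varepsilon$ let $D_h^{\xi,\varepsilon}(z,w)=\inf_P L_h^{\xi,\varepsilon}(P)$, the infimum being over all lattice paths in $\mathbb S^\varepsilon$ from $z$ to $w$; the distance between two sets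 is the infimum of the distances between their points. Let $\partial_{\mathrm L}\mathbb S^\varepsilon$ (resp. $\partial_{\mathrm R}\mathbb S^\varepsilon$) be the set of vertices of $\mathbb S^\varepsilon$ whose nearest neighbor to the left (resp. right) in $\varepsilon\mathbb Z^2$ is not in $\mathbb S^\varepsilon$. For $\xi\ge0$ define the $\xi$-LFPP distance exponent $$\lambda(\xi)=\sup\left\{\alpha\in\mathbb R:\liminf_{\varepsilon\to0}\mathbb P\left[D_h^{\xi,\varepsilon}(\partial_{\mathrm L}\mathbb S^\varepsilon,\partial_{\mathrm R}\mathbb S^\varepsilon)\le\varepsilon^\alpha\right]=1\right\}.$$ For $\xi>0$, let $P_h^{\xi,\varepsilon}$ be the a.s. unique lattice path in $\mathbb S^\varepsilon$ connecting $\partial_{\mathrm L}\mathbb S^\varepsilon$ and $\partial_{\mathrm R}\mathbb S^\varepsilon$ with minimal $L_h^{\xi,\varepsilon}$-length, and define the LFPP geodesic dimension $$g(\xi)=\inf\left\{\alpha>0:\liminf_{\varepsilon\to0}\mathbb P\left[\#P_h^{\xi,\varepsilon}\le\varepsilon^{-\alpha}\right]=1\right\}.$$ *)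

theory Defs
  imports "HOL-Probability.Probability"
begin

section \<open>The whole-plane Gaussian free field\<close>

text \<open>
  The field is a Gaussian process indexed by the compactly supported finite Borel measures on the
  plane of finite logarithmic energy; \<open>h \<mu> \<omega>\<close> is the pairing of \<open>h(\<omega>)\<close> with \<open>\<mu>\<close>. Nonnegative test
  functions (as densities) and uniform measures on circles are of this kind, and signed
  test objects are obtained as linear combinations. The kernel is \<open>\<infinity>\<close> on the diagonal: since
  \<open>ln 0 = 0\<close> in the library, this has to be said explicitly, and it excludes atoms.
\<close>

definition gff_test_measures :: "complex measure set" where
  "gff_test_measures = {\<mu>. sets \<mu> = sets borel \<and> finite_measure \<mu> \<and>
     (\<exists>K. compact K \<and> emeasure \<mu> (- K) = 0) \<and>
     (\<integral>\<^sup>+ p. (if fst p = snd p then \<top> else ennreal (- ln (dist (fst p) (snd p)))) \<partial>(\<mu> \<Otimes>\<^sub>M \<mu>)) < \<top>}"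

definition mutual_log_energy :: "complex measure \<Rightarrow> complex measure \<Rightarrow> real" where
  "mutual_log_energy \<mu> \<nu> = (\<integral>p. - ln (dist (fst p) (snd p)) \<partial>(\<mu> \<Otimes>\<^sub>M \<nu>))"

definition uniform_circle :: "complex \<Rightarrow> real \<Rightarrow> complex measure" where
  "uniform_circle z \<epsilon> =
     distr (uniform_measure lborel {0..1}) borel (\<lambda>t. z + of_real \<epsilon> * cis (2 * pi * t))"

definition centered_gaussian :: "'a measure \<Rightarrow> ('a \<Rightarrow> real) \<Rightarrow> real \<Rightarrow> bool" where
  "centered_gaussian M X v \<longleftrightarrow> X \<in> borel_measurable M \<and>
     (v = 0 \<and> (AE \<omega> in M. X \<omega> = 0) \<or>
      v > 0 \<and> distributed M lborel X (normal_density 0 (sqrt v)))"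

text \<open>
  The whole-plane GFF is canonically defined only modulo a global additive constant, that is, on
  test objects \<open>\<Sum>\<mu>\<in>F. a \<mu> \<cdot> \<mu>\<close> of total mass zero, where it is centred Gaussian with covariance
  kernel \<open>- ln |x - y|\<close>. The additive constant is then fixed by the vanishing of the average over the
  unit circle. Gaussianity of all linear combinations yields joint Gaussianity and, taking
  combinations of variance zero, almost sure linearity of the field.
\<close>

locale whole_plane_gff = prob_space M
  for M :: "'a measure" and h :: "complex measure \<Rightarrow> 'a \<Rightarrow> real" +
  assumes measurable_pairing: "\<And>\<mu>. \<mu> \<in> gff_test_measures \<Longrightarrow> h \<mu> \<in> borel_measurable M"
    and gaussian_modulo_constant:
      "\<And>(F :: complex measure set) (a :: complex measure \<Rightarrow> real).
         finite F \<Longrightarrow> F \<subseteq> gff_test_measures \<Longrightarrow> (\<Sum>\<mu>\<in>F. a \<mu> * measure \<mu> UNIV) = 0 \<Longrightarrow>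
         centered_gaussian M (\<lambda>\<omega>. \<Sum>\<mu>\<in>F. a \<mu> * h \<mu> \<omega>)
           (\<Sum>\<mu>\<in>F. \<Sum>\<nu>\<in>F. a \<mu> * a \<nu> * mutual_log_energy \<mu> \<nu>)"
    and normalized: "AE \<omega> in M. h (uniform_circle 0 1) \<omega> = 0"

definition circle_average ::
  "(complex measure \<Rightarrow> 'a \<Rightarrow> real) \<Rightarrow> real \<Rightarrow> complex \<Rightarrow> 'a \<Rightarrow> real" where
  "circle_average h \<epsilon> z \<omega> = h (uniform_circle z \<epsilon>) \<omega>"

section \<open>Lattice paths in the unit square\<close>

definition square_lattice :: "real \<Rightarrow> complex set" where
  "square_lattice \<epsilon> = {Complex (\<epsilon> * of_int m) (\<epsilon> * of_int n) |m n. True}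
     \<inter> {z. Re z \<in> {0..1} \<and> Im z \<in> {0..1}}"

definition left_boundary :: "real \<Rightarrow> complex set" where
  "left_boundary \<epsilon> = {z \<in> square_lattice \<epsilon>. z - of_real \<epsilon> \<notin> square_lattice \<epsilon>}"

definition right_boundary :: "real \<Rightarrow> complex set" where
  "right_boundary \<epsilon> = {z \<in> square_lattice \<epsilon>. z + of_real \<epsilon> \<notin> square_lattice \<epsilon>}"

text \<open>
  A path \<open>P : {0,\<dots>,N} \<rightarrow> square_lattice \<epsilon>\<close> is the list of its \<open>N + 1\<close> vertices; two points of the
  lattice are nearest neighbours iff their distance is \<open>\<epsilon>\<close>.
\<close>

definition lattice_path :: "real \<Rightarrow> complex list \<Rightarrow> bool" where
  "lattice_path \<epsilon> P \<longleftrightarrow>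
     P \<noteq> [] \<and> set P \<subseteq> square_lattice \<epsilon> \<and> successively (\<lambda>z w. dist z w = \<epsilon>) P"

definition simple_lattice_path :: "real \<Rightarrow> complex list \<Rightarrow> bool" where
  "simple_lattice_path \<epsilon> P \<longleftrightarrow> lattice_path \<epsilon> P \<and> distinct P"

section \<open>Liouville first passage percolation\<close>

definition lfpp_length ::
  "(complex measure \<Rightarrow> 'a \<Rightarrow> real) \<Rightarrow> real \<Rightarrow> real \<Rightarrow> 'a \<Rightarrow> complex list \<Rightarrow> real" where
  "lfpp_length h \<xi> \<epsilon> \<omega> P = (\<Sum>z\<leftarrow>P. \<epsilon> * exp (\<xi> * circle_average h \<epsilon> z \<omega>))"

definition lfpp_dist ::
  "(complex measure \<Rightarrow> 'a \<Rightarrow> real) \<Rightarrow> real \<Rightarrow> real \<Rightarrow> 'a \<Rightarrow> complex \<Rightarrow> complex \<Rightarrow> real" where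
  "lfpp_dist h \<xi> \<epsilon> \<omega> z w =
     Inf {lfpp_length h \<xi> \<epsilon> \<omega> P |P. lattice_path \<epsilon> P \<and> hd P = z \<and> last P = w}"

definition lfpp_set_dist ::
  "(complex measure \<Rightarrow> 'a \<Rightarrow> real) \<Rightarrow> real \<Rightarrow> real \<Rightarrow> 'a \<Rightarrow> complex set \<Rightarrow> complex set \<Rightarrow> real" where
  "lfpp_set_dist h \<xi> \<epsilon> \<omega> A B = Inf {lfpp_dist h \<xi> \<epsilon> \<omega> z w |z w. z \<in> A \<and> w \<in> B}"

definition lfpp_distance_exponent ::
  "'a measure \<Rightarrow> (complex measure \<Rightarrow> 'a \<Rightarrow> real) \<Rightarrow> real \<Rightarrow> real" where
  "lfpp_distance_exponent M h \<xi> =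
     Sup {\<alpha> :: real. Liminf (at_right 0) (\<lambda>\<epsilon>. ereal (measure M {\<omega> \<in> space M.
       lfpp_set_dist h \<xi> \<epsilon> \<omega> (left_boundary \<epsilon>) (right_boundary \<epsilon>) \<le> \<epsilon> powr \<alpha>})) = 1}"

definition crossing :: "real \<Rightarrow> complex list \<Rightarrow> bool" where
  "crossing \<epsilon> P \<longleftrightarrow> lattice_path \<epsilon> P \<and> hd P \<in> left_boundary \<epsilon> \<and> last P \<in> right_boundary \<epsilon>"

text \<open>The minimizer is almost surely unique, so the choice matters only on a null event.\<close>

definition lfpp_geodesic ::
  "(complex measure \<Rightarrow> 'a \<Rightarrow> real) \<Rightarrow> real \<Rightarrow> real \<Rightarrow> 'a \<Rightarrow> complex list" where
  "lfpp_geodesic h \<xi> \<epsilon> \<omega> = (SOME P. crossing \<epsilon> P \<and>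
     (\<forall>Q. crossing \<epsilon> Q \<longrightarrow> lfpp_length h \<xi> \<epsilon> \<omega> P \<le> lfpp_length h \<xi> \<epsilon> \<omega> Q))"

definition lfpp_geodesic_dimension ::
  "'a measure \<Rightarrow> (complex measure \<Rightarrow> 'a \<Rightarrow> real) \<Rightarrow> real \<Rightarrow> real" where
  "lfpp_geodesic_dimension M h \<xi> =
     Inf {\<alpha> :: real. \<alpha> > 0 \<and> Liminf (at_right 0) (\<lambda>\<epsilon>. ereal (measure M {\<omega> \<in> space M.
       real (length (lfpp_geodesic h \<xi> \<epsilon> \<omega>)) \<le> \<epsilon> powr (- \<alpha>)})) = 1}"

end

theory Submission
  imports Defs "HOL-Real_Asymp.Real_Asymp"
begin

text \<open>
  The first claim is a first moment bound. Put \<open>a = sqrt (2 + 2\<lambda> + \<xi>\<^sup>2) - \<xi>\<close>. By convexity a simple path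
  with \<open>n\<close> vertices forces \<open>\<Sum>\<^sub>z exp (- a h\<^sub>\<epsilon>(z)) \<ge> n m powr (- a/\<xi>)\<close>, where \<open>m\<close> is the mean of
  \<open>exp (\<xi> h\<^sub>\<epsilon>)\<close> along the path, whereas the sum over the whole lattice has expectation of order
  \<open>\<epsilon> powr (- 2 - a\<^sup>2/2)\<close>. This needs \<open>a \<ge> 0\<close>, that is, \<open>\<lambda> \<ge> - 1\<close>, which is the main difficulty: for every
  \<open>\<delta> > 0\<close> there is with high probability a left-right crossing along which \<open>h\<^sub>\<epsilon> \<le> \<delta> ln (1/\<epsilon>)\<close>. The
  symmetry of the field under negation and rotation by 90 degrees, together with planar duality (the Hex
  theorem), gives a crossing with nonpositive values with probability at least \<open>1/2\<close>, up to an additive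
  constant of the field. Dimension-free Gaussian concentration, obtained from the Prekopa-Leindler
  inequality, raises this to probability close to \<open>1\<close> at the cost of \<open>\<delta> ln (1/\<epsilon>)\<close>, since the variances are
  only of order \<open>ln (1/\<epsilon>)\<close>. Diagonal steps of the crossing are removed because neighbouring circle
  averages differ by a Gaussian of bounded variance.
\<close>

section \<open>Gaussian concentration\<close>

text \<open>The number \<open>a\<close> is the nonnegative root of a^2 + 2 \<xi> a = 2 + 2
  \<lambda>: a path longer than the claimed bound has mean weight \<open>m\<close> at most
  \<epsilon>^(\<xi> a), and for this root Markov's inequality leaves exactly a constant times
  \<epsilon>^\<zeta>. A sum of negative exponentials detects long paths only for nonnegative
  \<open>a\<close>, so everything hinges on a lower bound for the distance exponent. A straight
  segment has expected length of order \<epsilon>^(- \<xi>^2 / 2), which gives \<lambda> >= -1 only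
  for \<xi>^2 <= 2. The crossing with small values works for every \<xi>: it is counted crudely by
  the whole lattice, about \<epsilon>^(-2) vertices of weight \<epsilon> up to a small power, and
  this count is the origin of -1. Raising the probability 1/2 must not cost a factor for the number
  of vertices, hence a concentration bound in which only the maximal variance enters. Since the
  exponent is a supremum of reals, the set of admissible exponents must also be shown to be bounded
  above.\<close>

lemma emeasure_lborel_translate:
  fixes A :: "real set"
  assumes [measurable]: "A \<in> sets borel"
  shows "emeasure lborel ((\<lambda>x. x - c) -` A) = emeasure lborel A"
proof -
  have "emeasure lborel A = emeasure (distr lborel borel ((+) (- c))) A"
    by (simp only: lborel_distr_plus)
  also have "\<dots> = emeasure lborel ((\<lambda>x. x - c) -` A)"
    by (subst emeasure_distr) (auto intro!: arg_cong[where f="emeasure lborel"])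
  finally show ?thesis by simp
qed

text \<open>The translates \<open>A1\<close> of \<open>A\<close> and \<open>B1\<close> of
  \<open>B\<close> both lie in \<open>C\<close>. With \<open>a\<close> close to the supremum of
  \<open>A\<close> and \<open>b\<close> close to the infimum of \<open>B\<close>, the first lies
  almost entirely to the left of the second: they can meet only in \<open>I\<close>, an interval of
  length at most \<open>e\<close>. Near-extremal points take the place of the extrema that
  compactness would supply.\<close>

lemma brunn_minkowski_real_bounded:
  fixes A B C :: "real set"
  assumes [measurable]: "A \<in> sets borel" "B \<in> sets borel" "C \<in> sets borel"
    and ne: "A \<noteq> {}" "B \<noteq> {}" and bd: "bdd_above A" "bdd_below B"
    and sub: "\<And>a b. a \<in> A \<Longrightarrow> b \<in> B \<Longrightarrow> a + b \<in> C"
  shows "emeasure lborel A + emeasure lborel B \<le> emeasure lborel C"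
proof (rule ennreal_le_epsilon)
  fix e :: real assume "0 < e"
  obtain a where a: "a \<in> A" "Sup A - e/2 < a"
    using less_cSupE[of "Sup A - e/2" A] ne \<open>0 < e\<close> by auto
  obtain b where b: "b \<in> B" "b < Inf B + e/2"
    using cInf_lessD[of B "Inf B + e/2"] ne \<open>0 < e\<close> by auto
  define A1 where "A1 = (\<lambda>x. x - b) -` A"
  define B1 where "B1 = (\<lambda>x. x - a) -` B"
  have [measurable]: "A1 \<in> sets borel" "B1 \<in> sets borel"
    unfolding A1_def B1_def by (rule measurable_sets_borel[where M=borel]; measurable)+
  define I where "I = {a + Inf B .. b + Sup A}"
  have "A1 - I \<subseteq> {..<a + Inf B}"
    using cSup_upper[OF _ bd(1)] by (force simp: A1_def I_def)
  moreover have "B1 \<subseteq> {a + Inf B..}"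
    using cInf_lower[OF _ bd(2)] by (force simp: B1_def)
  ultimately have disj: "(A1 - I) \<inter> B1 = {}" by force
  have "emeasure lborel A + emeasure lborel B = emeasure lborel A1 + emeasure lborel B1"
    by (simp add: A1_def B1_def emeasure_lborel_translate)
  also have "emeasure lborel A1 \<le> emeasure lborel ((A1 - I) \<union> I)"
    by (intro emeasure_mono) (auto simp: I_def)
  also have "\<dots> \<le> emeasure lborel (A1 - I) + emeasure lborel I"
    by (intro emeasure_subadditive) (auto simp: I_def)
  also have "emeasure lborel I \<le> ennreal e"
    using a b cSup_upper[OF a(1) bd(1)] cInf_lower[OF b(1) bd(2)]
    by (auto simp: I_def emeasure_lborel_Icc_eq intro!: ennreal_leI)
  also have "emeasure lborel (A1 - I) + ennreal e + emeasure lborel B1 = emeasure lborel ((A1 - I) \<union> B1) + ennreal e"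
    by (subst plus_emeasure[symmetric, OF _ _ disj]) (auto simp: I_def ac_simps)
  also have "emeasure lborel ((A1 - I) \<union> B1) \<le> emeasure lborel C"
    using sub[OF _ b(1)] sub[OF a(1)] by (intro emeasure_mono) (force simp: A1_def B1_def)+
  finally show "emeasure lborel A + emeasure lborel B \<le> emeasure lborel C + ennreal e"
    by (simp add: add_mono)
qed

text \<open>Exhaustion by [-n, n]. For large n the truncations still contain two fixed points
  \<open>a\<close> and \<open>b\<close>, so the nonemptiness that Brunn-Minkowski demands survives
  the truncation.\<close>

lemma brunn_minkowski_real:
  fixes A B C :: "real set"
  assumes A[measurable]: "A \<in> sets borel" and B[measurable]: "B \<in> sets borel" and [measurable]: "C \<in> sets borel"
    and ne: "A \<noteq> {}" "B \<noteq> {}"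
    and sub: "\<And>a b. a \<in> A \<Longrightarrow> b \<in> B \<Longrightarrow> a + b \<in> C"
  shows "emeasure lborel A + emeasure lborel B \<le> emeasure lborel C"
proof -
  have lim: "(\<lambda>n. emeasure lborel (D \<inter> {- real n..real n})) \<longlonglongrightarrow> emeasure lborel D"
    if D: "D \<in> sets borel" for D :: "real set"
  proof -
    have "(\<lambda>n. emeasure lborel (D \<inter> {- real n..real n})) \<longlonglongrightarrow> emeasure lborel (\<Union>n. D \<inter> {- real n..real n})"
      using D by (intro Lim_emeasure_incseq) (auto simp: incseq_def)
    also have "(\<Union>n. D \<inter> {- real n..real n}) = D"
    proof -
      have "x \<in> {- real (nat \<lceil>\<bar>x\<bar>\<rceil>)..real (nat \<lceil>\<bar>x\<bar>\<rceil>)}" for x :: real by auto linarith+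
      then show ?thesis by blast
    qed
    finally show ?thesis .
  qed
  obtain a b where ab: "a \<in> A" "b \<in> B" using ne by auto
  have "eventually (\<lambda>n. emeasure lborel (A \<inter> {- real n..real n}) + emeasure lborel (B \<inter> {- real n..real n})
      \<le> emeasure lborel C) sequentially"
    using eventually_ge_at_top[of "nat \<lceil>max \<bar>a\<bar> \<bar>b\<bar>\<rceil>"]
  proof eventually_elim
    case (elim n)
    then have "max \<bar>a\<bar> \<bar>b\<bar> \<le> real n" by linarith
    then have ne: "a \<in> A \<inter> {- real n..real n}" "b \<in> B \<inter> {- real n..real n}" using ab by auto
    then show ?case
      using sub by (intro brunn_minkowski_real_bounded) (auto intro: bdd_above_Int2 bdd_below_Int2)
  qed
  then show ?thesis
    by (intro tendsto_le[OF sequentially_bot tendsto_const tendsto_add[OF lim[OF A] lim[OF B]]])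
qed

section \<open>The Prekopa-Leindler inequality on the line\<close>

lemma nn_integral_layer_cake:
  fixes f :: "real \<Rightarrow> real"
  assumes [measurable]: "f \<in> borel_measurable borel" and f: "\<And>x. 0 \<le> f x"
  shows "(\<integral>\<^sup>+x. ennreal (f x) \<partial>lborel) = (\<integral>\<^sup>+t\<in>{0<..}. emeasure lborel {x. t < f x} \<partial>lborel)"
proof -
  have "(\<integral>\<^sup>+x. ennreal (f x) \<partial>lborel) = (\<integral>\<^sup>+x. \<integral>\<^sup>+t. indicator {0<..<f x} t \<partial>lborel \<partial>lborel)"
    using f by (intro nn_integral_cong) (simp add: emeasure_lborel_Ioo)
  also have "\<dots> = (\<integral>\<^sup>+x. \<integral>\<^sup>+t. (if 0 < t \<and> t < f x then 1 else 0) \<partial>lborel \<partial>lborel)"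
    by (intro nn_integral_cong) (auto simp: indicator_def)
  also have "\<dots> = (\<integral>\<^sup>+t. \<integral>\<^sup>+x. (if 0 < t \<and> t < f x then 1 else 0) \<partial>lborel \<partial>lborel)"
    by (rule lborel_pair.Fubini') measurable
  also have "\<dots> = (\<integral>\<^sup>+t. \<integral>\<^sup>+x. indicator {x. t < f x} x * indicator {0<..} t \<partial>lborel \<partial>lborel)"
    by (intro nn_integral_cong) (auto simp: indicator_def)
  also have "\<dots> = (\<integral>\<^sup>+t\<in>{0<..}. emeasure lborel {x. t < f x} \<partial>lborel)"
    by (intro nn_integral_cong) (simp add: nn_integral_multc)
  finally show ?thesis .
qed

text \<open>As \<open>f\<close> and \<open>g\<close> both have supremum 1, their superlevel sets are
  nonempty at the same levels, those below 1. Brunn-Minkowski then applies level by level, and the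
  layer cake formula integrates it. Evaluating \<open>h\<close> at x + y instead of the midpoint
  avoids halving the sets.\<close>

lemma prekopa_leindler_real_aux:
  fixes f g h :: "real \<Rightarrow> real"
  assumes [measurable]: "f \<in> borel_measurable borel" "g \<in> borel_measurable borel" "h \<in> borel_measurable borel"
    and nn: "\<And>x. 0 \<le> f x" "\<And>x. 0 \<le> g x" "\<And>x. 0 \<le> h x" and le1: "\<And>x. f x \<le> 1" "\<And>x. g x \<le> 1"
    and near: "\<And>t. t < 1 \<Longrightarrow> \<exists>x. t < f x" "\<And>t. t < 1 \<Longrightarrow> \<exists>x. t < g x"
    and le: "\<And>x y. f x * g y \<le> (h (x + y))\<^sup>2"
  shows "(\<integral>\<^sup>+x. f x \<partial>lborel) + (\<integral>\<^sup>+x. g x \<partial>lborel) \<le> (\<integral>\<^sup>+x. h x \<partial>lborel)"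
proof -
  have *: "emeasure lborel {x. t < f x} + emeasure lborel {x. t < g x} \<le> emeasure lborel {x. t < h x}"
    if t: "0 < t" for t
  proof (cases "t < 1")
    case True
    show ?thesis
    proof (rule brunn_minkowski_real)
      fix a b assume "a \<in> {x. t < f x}" "b \<in> {x. t < g x}"
      then have "t\<^sup>2 < f a * g b" using t by (auto simp: power2_eq_square intro!: mult_strict_mono)
      also have "\<dots> \<le> (h (a + b))\<^sup>2" by (rule le)
      finally show "a + b \<in> {x. t < h x}" using nn(3) power_less_imp_less_base by auto
    qed (use near True in auto)
  next
    case False
    then have "{x. t < f x} = {}" "{x. t < g x} = {}" using le1 by (auto simp: not_less intro: order_trans)
    then show ?thesis by simp
  qed
  have [measurable]: "(\<lambda>t. emeasure lborel {x. t < k x}) \<in> borel_measurable lborel" 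
    if [measurable]: "k \<in> borel_measurable borel" for k :: "real \<Rightarrow> real"
  proof -
    have "(\<lambda>t. emeasure lborel {x. t < k x}) = (\<lambda>t. emeasure lborel (Pair t -` {p \<in> space (borel \<Otimes>\<^sub>M borel). fst p < k (snd p)}))"
      by (auto simp: space_pair_measure vimage_def)
    also have "\<dots> \<in> borel_measurable borel"
      by (rule lborel.measurable_emeasure_Pair) measurable
    finally show ?thesis by simp
  qed
  show ?thesis
    unfolding nn_integral_layer_cake[OF assms(1) nn(1)] nn_integral_layer_cake[OF assms(2) nn(2)] nn_integral_layer_cake[OF assms(3) nn(3)]
    by (subst nn_integral_add[symmetric]) (auto intro!: nn_integral_mono simp: indicator_def *)
qed

lemma four_mult_le_power2_add: 
  fixes a b :: ennreal shows "4 * (a * b) \<le> (a + b)\<^sup>2"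
proof (cases "a = \<top> \<or> b = \<top>")
  case True
  then show ?thesis by (auto simp: power2_eq_square ennreal_top_mult ennreal_mult_top)
next
  case False
  then obtain x y where "a = ennreal x" "b = ennreal y" "0 \<le> x" "0 \<le> y"
    by (metis ennreal_cases)
  moreover have "4 * (x * y) \<le> (x + y)\<^sup>2" using sum_squares_ge_zero[of "x - y" 0]
    by (simp add: power2_eq_square algebra_simps)
  ultimately show ?thesis
    using ennreal_leI[of "4 * (x * y)" "(x + y)\<^sup>2"] by (simp add: ennreal_mult'' ennreal_power flip: ennreal_plus)
qed

text \<open>Dividing \<open>f\<close>, \<open>g\<close>, \<open>h\<close> by \<open>F\<close>,
  \<open>G\<close> and their geometric mean \<open>s\<close> keeps the pointwise hypothesis and
  makes both suprema 1. The additive bound becomes multiplicative by the inequality of arithmetic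
  and geometric means. The factor 4 reflects that \<open>h\<close> is evaluated at twice the
  midpoint.\<close>

lemma prekopa_leindler_real:
  fixes f g h :: "real \<Rightarrow> real"
  assumes [measurable]: "f \<in> borel_measurable borel" "g \<in> borel_measurable borel" "h \<in> borel_measurable borel"
    and nn: "\<And>x. 0 \<le> f x" "\<And>x. 0 \<le> g x" "\<And>x. 0 \<le> h x" and bd: "\<And>x. f x \<le> K" "\<And>x. g x \<le> K"
    and le: "\<And>x y. f x * g y \<le> (h (x + y))\<^sup>2"
  shows "4 * ((\<integral>\<^sup>+x. f x \<partial>lborel) * (\<integral>\<^sup>+x. g x \<partial>lborel)) \<le> (\<integral>\<^sup>+x. h x \<partial>lborel)\<^sup>2"
proof -
  define F where "F = Sup (range f)"
  define G where "G = Sup (range g)"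
  have bdd: "bdd_above (range f)" "bdd_above (range g)" 
    using bd by (auto intro: bdd_aboveI2[where M=K])
  have FG: "f x \<le> F" "g x \<le> G" for x unfolding F_def G_def using bdd by (auto intro: cSup_upper)
  have FG0: "0 \<le> F" "0 \<le> G" using FG nn order_trans by blast+
  show ?thesis
  proof (cases "F = 0 \<or> G = 0")
    case True
    then have "(\<forall>x. f x = 0) \<or> (\<forall>x. g x = 0)" using FG nn by (metis order_antisym)
    then show ?thesis by auto
  next
    case False
    then have pos: "0 < F" "0 < G" using FG0 by auto
    define s where "s = sqrt (F * G)"
    have s: "0 < s" "s\<^sup>2 = F * G" using pos by (auto simp: s_def)
    have sum: "(\<integral>\<^sup>+x. ennreal (f x / F) \<partial>lborel) + (\<integral>\<^sup>+x. ennreal (g x / G) \<partial>lborel) \<le> (\<integral>\<^sup>+x. ennreal (h x / s) \<partial>lborel)"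
    proof (rule prekopa_leindler_real_aux)
      show "\<exists>x. t < f x / F" if "t < 1" for t
        using less_cSupE[of "t * F" "range f"] that pos unfolding F_def[symmetric]
        by (auto simp: pos_less_divide_eq) 
      show "\<exists>x. t < g x / G" if "t < 1" for t
        using less_cSupE[of "t * G" "range g"] that pos unfolding G_def[symmetric]
        by (auto simp: pos_less_divide_eq) 
      show "f x / F * (g y / G) \<le> (h (x + y) / s)\<^sup>2" for x y
        using le[of x y] s pos by (simp add: power_divide divide_right_mono)
    qed (use nn FG pos s in auto)
    have sc: "(\<integral>\<^sup>+x. ennreal (k x) \<partial>lborel) = ennreal c * (\<integral>\<^sup>+x. ennreal (k x / c) \<partial>lborel)"
      if [measurable]: "k \<in> borel_measurable borel" and "0 < c" for k :: "real \<Rightarrow> real" and c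
      using that by (subst nn_integral_cmult[symmetric]) (auto simp: ennreal_mult'[symmetric])
    have "4 * ((\<integral>\<^sup>+x. f x \<partial>lborel) * (\<integral>\<^sup>+x. g x \<partial>lborel)) =
        ennreal (s\<^sup>2) * (4 * ((\<integral>\<^sup>+x. ennreal (f x / F) \<partial>lborel) * (\<integral>\<^sup>+x. ennreal (g x / G) \<partial>lborel)))"
      using pos sc[of f F] sc[of g G] s by (simp add: ennreal_mult ac_simps)
    also have "\<dots> \<le> ennreal (s\<^sup>2) * (\<integral>\<^sup>+x. ennreal (h x / s) \<partial>lborel)\<^sup>2"
      by (intro mult_left_mono order_trans[OF four_mult_le_power2_add] power_mono sum) auto
    also have "\<dots> = (\<integral>\<^sup>+x. h x \<partial>lborel)\<^sup>2"
      using sc[of h s] s by (simp add: power_mult_distrib ennreal_power)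
    finally show ?thesis .
  qed
qed

text \<open>Prekopa-Leindler applied to \<open>u\<close> and \<open>v\<close> times the Gaussian
  density. The constant 1/4 comes from the parallelogram law x^2/2 + y^2/2 - (x-y)^2/4 =
  ((x+y)/2)^2: the product of the two densities times the allowed exponential is the squared density
  at the midpoint.\<close>

lemma gaussian_transport_real:
  fixes u v :: "real \<Rightarrow> ennreal"
  assumes [measurable]: "u \<in> borel_measurable borel" "v \<in> borel_measurable borel"
    and bd: "\<And>x. u x \<le> ennreal K" "\<And>x. v x \<le> ennreal K" and K: "0 \<le> K"
    and le: "\<And>x y. u x * v y \<le> ennreal (c * exp ((x - y)\<^sup>2 / 4))" and c: "0 \<le> c"
  shows "(\<integral>\<^sup>+x. u x \<partial>std_normal_distribution) * (\<integral>\<^sup>+x. v x \<partial>std_normal_distribution) \<le> ennreal c"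
proof -
  let ?p = std_normal_density
  define U where "U = (\<lambda>x. enn2real (u x))"
  define V where "V = (\<lambda>x. enn2real (v x))"
  have top: "u x \<noteq> \<top>" "v x \<noteq> \<top>" for x using bd[of x] by (auto simp: top_unique)
  have uU: "u x = ennreal (U x)" "v x = ennreal (V x)" for x
    using top by (simp_all add: U_def V_def ennreal_enn2real_if)
  have UV0: "0 \<le> U x" "0 \<le> V x" for x by (auto simp: U_def V_def)
  have UVK: "U x \<le> K" "V x \<le> K" for x using bd[of x] K by (auto simp: uU)
  have [measurable]: "U \<in> borel_measurable borel" "V \<in> borel_measurable borel" unfolding U_def V_def by measurable
  have p1: "?p x \<le> 1" for x
  proof -
    have "1 \<le> sqrt (2 * pi)" using pi_gt3 by (intro real_le_rsqrt) auto
    then have "1 / sqrt (2 * pi) \<le> 1" by simp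
    moreover have "exp (- x\<^sup>2 / 2) \<le> 1" by simp
    ultimately show ?thesis unfolding std_normal_density_def
      by (intro mult_le_one) auto
  qed
  \<comment> \<open>The density is taken at z/2 because Prekopa-Leindler is stated with x + y. The
    integral of \<open>h\<close> is then 2 sqrt c, and its square cancels the factor 4.\<close>
  define h where "h = (\<lambda>z. sqrt c * ?p (z / 2))"
  have "4 * ((\<integral>\<^sup>+x. ennreal (U x * ?p x) \<partial>lborel) * (\<integral>\<^sup>+x. ennreal (V x * ?p x) \<partial>lborel)) \<le> (\<integral>\<^sup>+x. ennreal (h x) \<partial>lborel)\<^sup>2"
  proof (rule prekopa_leindler_real)
    show "(U x * ?p x) * (V y * ?p y) \<le> (h (x + y))\<^sup>2" for x y
    proof -
      have e: "U x * V y \<le> c * exp ((x - y)\<^sup>2 / 4)"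
        using le[of x y] UV0 c by (simp add: uU flip: ennreal_mult)
      have "(U x * ?p x) * (V y * ?p y) = (U x * V y) * (?p x * ?p y)" by simp
      also have "\<dots> \<le> (c * exp ((x - y)\<^sup>2 / 4)) * (?p x * ?p y)"
        by (intro mult_right_mono e) auto
      also have "\<dots> = (h (x + y))\<^sup>2"
        using c by (simp add: h_def std_normal_density_def power_mult_distrib power_divide exp_double[symmetric] mult_exp_exp)
          (simp add: power2_eq_square field_simps)
      finally show ?thesis .
    qed
    show "U x * ?p x \<le> K" for x using UVK[of x] UV0[of x] p1[of x] mult_mono[of "U x" K "?p x" 1] K by auto
    show "V x * ?p x \<le> K" for x using UVK[of x] UV0[of x] p1[of x] mult_mono[of "V x" K "?p x" 1] K by auto
  qed (use UV0 c in \<open>auto simp: h_def\<close>)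
  also have "(\<integral>\<^sup>+x. ennreal (h x) \<partial>lborel) = ennreal (sqrt c) * (\<integral>\<^sup>+x. ennreal (?p (x / 2)) \<partial>lborel)"
    using c by (simp add: h_def ennreal_mult nn_integral_cmult)
  also have "(\<integral>\<^sup>+x. ennreal (?p (x / 2)) \<partial>lborel) = 2 * (\<integral>\<^sup>+x. ennreal (?p x) \<partial>lborel)"
    by (subst nn_integral_real_affine[where c=2 and t=0]) auto
  also have "(\<integral>\<^sup>+x. ennreal (?p x) \<partial>lborel) = 1"
    by (subst nn_integral_eq_integral) auto
  also have "(ennreal (sqrt c) * (2 * 1))\<^sup>2 = 4 * ennreal c"
    using c by (simp add: power_mult_distrib ennreal_power mult.commute)
  finally have "(\<integral>\<^sup>+x. ennreal (U x * ?p x) \<partial>lborel) * (\<integral>\<^sup>+x. ennreal (V x * ?p x) \<partial>lborel) \<le> ennreal c"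
    by (subst (asm) ennreal_mult_le_mult_iff) auto
  then show ?thesis
    by (simp add: nn_integral_density uU UV0 mult.commute flip: ennreal_mult)
qed

text \<open>Tensorisation: with coordinate \<open>i\<close> frozen at s and t, the induction
  hypothesis for the constant c exp((s-t)^2/4) is exactly the one-dimensional hypothesis for the
  partial integrals \<open>U\<close> and \<open>V\<close>. Hence \<open>c\<close> is generalised in
  the induction, and the bound is free of the dimension.\<close>

lemma gaussian_transport_PiM:
  fixes u v :: "('i \<Rightarrow> real) \<Rightarrow> ennreal"
  assumes "finite I" and "u \<in> borel_measurable (PiM I (\<lambda>_. std_normal_distribution))" "v \<in> borel_measurable (PiM I (\<lambda>_. std_normal_distribution))"
    and "\<And>x. u x \<le> ennreal K" "\<And>x. v x \<le> ennreal K" and K: "0 \<le> K"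
    and "\<And>x y. x \<in> space (PiM I (\<lambda>_. std_normal_distribution)) \<Longrightarrow> y \<in> space (PiM I (\<lambda>_. std_normal_distribution)) \<Longrightarrow>
       u x * v y \<le> ennreal (c * exp ((\<Sum>i\<in>I. (x i - y i)\<^sup>2) / 4))" and "0 \<le> c"
  shows "(\<integral>\<^sup>+x. u x \<partial>PiM I (\<lambda>_. std_normal_distribution)) * (\<integral>\<^sup>+x. v x \<partial>PiM I (\<lambda>_. std_normal_distribution)) \<le> ennreal c"
  using assms(1-5,7-)
proof (induction I arbitrary: u v c rule: finite_induct)
  case empty
  then show ?case by (simp add: PiM_empty nn_integral_count_space_finite space_count_space)
next
  case (insert i I)
  interpret product_prob_space "\<lambda>_. std_normal_distribution" I
    by (intro product_prob_spaceI prob_space_normal_density) auto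
  note [measurable] = insert.prems(1,2)
  let ?P = "PiM I (\<lambda>_. std_normal_distribution)"
  define U where "U = (\<lambda>s. \<integral>\<^sup>+x. u (x(i := s)) \<partial>?P)"
  define V where "V = (\<lambda>s. \<integral>\<^sup>+x. v (x(i := s)) \<partial>?P)"
  have [measurable]: "U \<in> borel_measurable borel" "V \<in> borel_measurable borel"
    unfolding U_def V_def by measurable
  have UVK: "U s \<le> ennreal K" "V s \<le> ennreal K" for s
  proof -
    have "(\<integral>\<^sup>+x. w (x(i := s)) \<partial>?P) \<le> ennreal K" if "\<And>x. w x \<le> ennreal K" for w
    proof -
      have "(\<integral>\<^sup>+x. w (x(i := s)) \<partial>?P) \<le> (\<integral>\<^sup>+x. ennreal K \<partial>?P)"
        using that by (rule nn_integral_mono)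
      then show ?thesis by (simp add: emeasure_space_1)
    qed
    then show "U s \<le> ennreal K" "V s \<le> ennreal K"
      unfolding U_def V_def using insert.prems(3,4) by blast+
  qed
  have "(\<integral>\<^sup>+s. U s \<partial>std_normal_distribution) * (\<integral>\<^sup>+s. V s \<partial>std_normal_distribution) \<le> ennreal c"
  proof (rule gaussian_transport_real[OF _ _ UVK K])
    fix s t :: real
    show "U s * V t \<le> ennreal (c * exp ((s - t)\<^sup>2 / 4))"
      unfolding U_def V_def
    proof (rule insert.IH)
      show "(\<lambda>x. u (x(i := s))) \<in> borel_measurable ?P" by measurable
      show "(\<lambda>x. v (x(i := t))) \<in> borel_measurable ?P" by measurable
      fix x y assume "x \<in> space ?P" "y \<in> space ?P"
      then have "x(i := s) \<in> space (PiM (insert i I) (\<lambda>_. std_normal_distribution))" "y(i := t) \<in> space (PiM (insert i I) (\<lambda>_. std_normal_distribution))"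
          by (auto simp: space_PiM PiE_def extensional_def)
      then have "u (x(i := s)) * v (y(i := t)) \<le> ennreal (c * exp ((\<Sum>j\<in>insert i I. ((x(i := s)) j - (y(i := t)) j)\<^sup>2) / 4))"
        by (rule insert.prems)
      also have "(\<Sum>j\<in>insert i I. ((x(i := s)) j - (y(i := t)) j)\<^sup>2) = (s - t)\<^sup>2 + (\<Sum>j\<in>I. (x j - y j)\<^sup>2)"
        using insert.hyps by (simp add: sum.insert) (auto intro!: sum.cong)
      also have "c * exp (((s - t)\<^sup>2 + (\<Sum>j\<in>I. (x j - y j)\<^sup>2)) / 4) = c * exp ((s - t)\<^sup>2 / 4) * exp ((\<Sum>j\<in>I. (x j - y j)\<^sup>2) / 4)"
        by (simp add: add_divide_distrib exp_add)
      finally show "u (x(i := s)) * v (y(i := t)) \<le> ennreal (c * exp ((s - t)\<^sup>2 / 4) * exp ((\<Sum>j\<in>I. (x j - y j)\<^sup>2) / 4))" .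
    qed (use insert.prems in auto)
  qed (use insert.prems in auto)
  then show ?case
    unfolding U_def V_def using insert.hyps by (simp add: product_nn_integral_insert_rev)
qed

text \<open>Transport with indicators for \<open>u\<close> and \<open>v\<close>: where both are 1
  the squared distance is at least \<open>r\<close>, so c = exp(-r/4) is admissible.\<close>

lemma gaussian_concentration_PiM:
  fixes A B :: "('i \<Rightarrow> real) set" and I :: "'i set"
  defines "\<gamma> \<equiv> PiM I (\<lambda>_. std_normal_distribution)"
  assumes I: "finite I" and [measurable]: "A \<in> sets \<gamma>" "B \<in> sets \<gamma>"
    and far: "\<And>x y. x \<in> A \<Longrightarrow> y \<in> B \<Longrightarrow> r \<le> (\<Sum>i\<in>I. (x i - y i)\<^sup>2)"
  shows "measure \<gamma> A * measure \<gamma> B \<le> exp (- r / 4)"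
proof -
  interpret product_prob_space "\<lambda>_. std_normal_distribution" I
    by (intro product_prob_spaceI prob_space_normal_density) auto
  have sub: "A \<subseteq> space \<gamma>" "B \<subseteq> space \<gamma>" by (rule sets.sets_into_space, measurable)+
  have "(\<integral>\<^sup>+x. indicator A x \<partial>\<gamma>) * (\<integral>\<^sup>+x. indicator B x \<partial>\<gamma>) \<le> ennreal (exp (- r / 4))"
    unfolding \<gamma>_def
  proof (rule gaussian_transport_PiM[OF I, where K=1])
    fix x y :: "'i \<Rightarrow> real"
    show "indicator A x * indicator B y \<le> ennreal (exp (- r / 4) * exp ((\<Sum>i\<in>I. (x i - y i)\<^sup>2) / 4))"
      using far[of x y] by (auto simp: indicator_def simp flip: exp_add)
  qed (auto simp: indicator_def \<gamma>_def[symmetric])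
  then have "emeasure \<gamma> A * emeasure \<gamma> B \<le> ennreal (exp (- r / 4))" by simp
  then show ?thesis
    unfolding \<gamma>_def by (simp add: emeasure_eq_measure flip: ennreal_mult)
qed

section \<open>Joint characteristic functions\<close>

lemma borel_measurable_cis[measurable (raw)]:
  "f \<in> borel_measurable M \<Longrightarrow> (\<lambda>x. cis (f x)) \<in> borel_measurable M"
  by (rule borel_measurable_continuous_on[OF continuous_on_cis]) (auto intro: continuous_intros)

lemma (in finite_measure) integrable_cis:
  "f \<in> borel_measurable M \<Longrightarrow> integrable M (\<lambda>x. cis (f x))"
  by (rule integrable_const_bound[where B=1]) auto

text \<open>The value at t = 0 shows that the total masses agree; rescaling by them reduces to Levy
  uniqueness for probability measures. Finite measures occur below as measures restricted to events
  or weighted by densities.\<close>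

lemma finite_measure_eqI_char:
  fixes N1 N2 :: "real measure"
  assumes fin: "finite_measure N1" "finite_measure N2" and sets: "sets N1 = sets borel" "sets N2 = sets borel"
    and char: "\<And>t. (\<integral>x. cis (t * x) \<partial>N1) = (\<integral>x. cis (t * x) \<partial>N2)"
  shows "N1 = N2"
proof -
  define m where "m = measure N1 UNIV"
  have sp: "space N1 = UNIV" "space N2 = UNIV" using sets_eq_imp_space_eq[OF sets(1)] sets_eq_imp_space_eq[OF sets(2)] by simp_all
  have m2: "measure N2 UNIV = m" using char[of 0] by (simp add: m_def sp)
  have em: "emeasure N1 UNIV = ennreal m" "emeasure N2 UNIV = ennreal m"
    using fin m2 by (simp_all add: m_def finite_measure.emeasure_eq_measure)
  show ?thesis
  proof (cases "m = 0")
    case True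
    show ?thesis
    proof (rule measure_eqI)
      fix A assume "A \<in> sets N1"
      have "emeasure N1 A \<le> emeasure N1 UNIV" "emeasure N2 A \<le> emeasure N2 UNIV"
        using sets by (auto intro!: emeasure_mono)
      then show "emeasure N1 A = emeasure N2 A" using em True by simp
    qed (use sets in simp)
  next
    case False
    then have m: "0 < m" by (simp add: m_def zero_less_measure_iff)
    define n where "n N = density N (\<lambda>_. ennreal (1 / m))" for N :: "real measure"
    have rd: "real_distribution (n N)" if "sets N = sets borel" "emeasure N UNIV = ennreal m" "space N = UNIV" for N
    proof -
      have "emeasure (n N) UNIV = ennreal (1 / m) * ennreal m"
        using that by (simp add: n_def emeasure_density nn_integral_cmult_indicator)
      also have "\<dots> = 1" using m by (simp flip: ennreal_mult)
      finally have "prob_space (n N)" using that by (intro prob_spaceI) (simp add: n_def)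
      then show ?thesis using that by (simp add: real_distribution_def real_distribution_axioms_def n_def)
    qed
    have "n N1 = n N2"
    proof (rule Levy_uniqueness)
      have c: "char (n N) t = (1 / m) *\<^sub>R (\<integral>x. cis (t * x) \<partial>N)" if [measurable_cong]: "sets N = sets borel" for N t
        using m unfolding char_def n_def by (subst integral_density) (simp_all flip: cis_conv_exp of_real_mult)
      show "char (n N1) = char (n N2)" using char sets by (intro ext) (simp add: c)
    qed (use rd sets em sp in auto)
    have recover: "density (n N) (\<lambda>_. ennreal m) = N" if "sets N = sets borel" for N
    proof -
      have "density (n N) (\<lambda>_. ennreal m) = density N (\<lambda>_. ennreal (1 / m) * ennreal m)"
        unfolding n_def by (rule density_density_eq) auto
      also have "ennreal (1 / m) * ennreal m = 1" using m by (simp flip: ennreal_mult)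
      finally show ?thesis by (simp add: density_1)
    qed
    show ?thesis using recover[of N1] recover[of N2] sets \<open>n N1 = n N2\<close> by metis
  qed
qed

text \<open>
  The functions \<open>1 + cos (S + \<phi>)\<close> and \<open>2 + cos (S + \<phi>)\<close> are nonnegative densities, and the
  characteristic function of \<open>Z\<close> with respect to them is a combination of joint characteristic
  functions of \<open>S\<close> and \<open>Z\<close>, so the one-dimensional uniqueness theorem applies.
\<close>

lemma char_restrict_unique:
  fixes S Z :: "'a \<Rightarrow> real" and S' Z' :: "'b \<Rightarrow> real"
  assumes fin: "finite_measure P" "finite_measure Q"
    and [measurable]: "S \<in> borel_measurable P" "Z \<in> borel_measurable P" "S' \<in> borel_measurable Q" "Z' \<in> borel_measurable Q"
    and eq: "\<And>s t. (\<integral>\<omega>. cis (s * S \<omega> + t * Z \<omega>) \<partial>P) = (\<integral>\<omega>. cis (s * S' \<omega> + t * Z' \<omega>) \<partial>Q)"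
    and [measurable]: "B \<in> sets borel"
  shows "(\<integral>\<omega>. indicator B (Z \<omega>) *\<^sub>R cis (S \<omega>) \<partial>P) = (\<integral>\<omega>. indicator B (Z' \<omega>) *\<^sub>R cis (S' \<omega>) \<partial>Q)"
proof -
  interpret P: finite_measure P by fact
  interpret Q: finite_measure Q by fact
  define I1 where "I1 s t = (\<integral>\<omega>. cis (s * S \<omega> + t * Z \<omega>) \<partial>P)" for s t
  have key: "(\<integral>\<omega>. indicator B (Z \<omega>) * (c + cos (S \<omega> + \<phi>)) \<partial>P) = (\<integral>\<omega>. indicator B (Z' \<omega>) * (c + cos (S' \<omega> + \<phi>)) \<partial>Q)"
    if c: "1 \<le> c" for c \<phi> :: real
  proof -
    define \<nu> where "\<nu> = distr (density P (\<lambda>\<omega>. ennreal (c + cos (S \<omega> + \<phi>)))) borel Z"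
    define \<nu>' where "\<nu>' = distr (density Q (\<lambda>\<omega>. ennreal (c + cos (S' \<omega> + \<phi>)))) borel Z'"
    have nn: "0 \<le> c + cos x" "c + cos x \<le> c + 1" for x using cos_ge_minus_one[of x] cos_le_one[of x] c by linarith+
    have char: "(\<integral>x. cis (t * x) \<partial>distr (density R (\<lambda>\<omega>. ennreal (c + cos (s \<omega> + \<phi>)))) borel z) =
        c *\<^sub>R (\<integral>\<omega>. cis (0 * s \<omega> + t * z \<omega>) \<partial>R) + (cis \<phi> * (\<integral>\<omega>. cis (1 * s \<omega> + t * z \<omega>) \<partial>R)
          + cis (- \<phi>) * (\<integral>\<omega>. cis ((- 1) * s \<omega> + t * z \<omega>) \<partial>R)) / 2"
      if [measurable]: "s \<in> borel_measurable R" "z \<in> borel_measurable R" and "finite_measure R"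
      for R :: "'c measure" and s z :: "'c \<Rightarrow> real" and t
    proof -
      interpret R: finite_measure R by fact
      have "(\<integral>x. cis (t * x) \<partial>distr (density R (\<lambda>\<omega>. ennreal (c + cos (s \<omega> + \<phi>)))) borel z) =
          (\<integral>\<omega>. (c + cos (s \<omega> + \<phi>)) *\<^sub>R cis (t * z \<omega>) \<partial>R)"
        by (subst integral_distr) (auto simp: integral_density nn)
      also have "\<dots> = (\<integral>\<omega>. c *\<^sub>R cis (0 * s \<omega> + t * z \<omega>) + (cis \<phi> * cis (1 * s \<omega> + t * z \<omega>)
          + cis (- \<phi>) * cis ((- 1) * s \<omega> + t * z \<omega>)) / 2 \<partial>R)"
      proof (rule Bochner_Integration.integral_cong[OF refl])
        fix \<omega>
        have "complex_of_real (cos (s \<omega> + \<phi>)) = (cis (s \<omega> + \<phi>) + cis (- (s \<omega> + \<phi>))) / 2"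
          using cos_minus[of "s \<omega> + \<phi>"] sin_minus[of "s \<omega> + \<phi>"] by (simp add: complex_eq_iff)
        moreover have "cis \<phi> * cis (1 * s \<omega> + t * z \<omega>) = cis (s \<omega> + \<phi>) * cis (t * z \<omega>)"
          "cis (- \<phi>) * cis ((- 1) * s \<omega> + t * z \<omega>) = cis (- (s \<omega> + \<phi>)) * cis (t * z \<omega>)"
          unfolding cis_mult by (simp_all add: algebra_simps)
        ultimately show "(c + cos (s \<omega> + \<phi>)) *\<^sub>R cis (t * z \<omega>) = c *\<^sub>R cis (0 * s \<omega> + t * z \<omega>) + (cis \<phi> * cis (1 * s \<omega> + t * z \<omega>)
          + cis (- \<phi>) * cis ((- 1) * s \<omega> + t * z \<omega>)) / 2"
          by (simp add: scaleR_conv_of_real distrib_right add_divide_distrib)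
      qed
      also have "\<dots> = c *\<^sub>R (\<integral>\<omega>. cis (0 * s \<omega> + t * z \<omega>) \<partial>R) + (cis \<phi> * (\<integral>\<omega>. cis (1 * s \<omega> + t * z \<omega>) \<partial>R)
          + cis (- \<phi>) * (\<integral>\<omega>. cis ((- 1) * s \<omega> + t * z \<omega>) \<partial>R)) / 2"
        by (subst Bochner_Integration.integral_add) (auto intro!: R.integrable_cis integrable_scaleR_right integrable_divide integrable_mult_right Bochner_Integration.integrable_add
           simp: Bochner_Integration.integral_add R.integrable_cis)
      finally show ?thesis .
    qed
    have finm: "finite_measure (distr (density R (\<lambda>\<omega>. ennreal (c + cos (s \<omega> + \<phi>)))) borel z)"
      if [measurable]: "s \<in> borel_measurable R" "z \<in> borel_measurable R" and "finite_measure R"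
      for R :: "'c measure" and s z :: "'c \<Rightarrow> real"
    proof (rule finite_measure.finite_measure_distr)
      have "emeasure (density R (\<lambda>\<omega>. ennreal (c + cos (s \<omega> + \<phi>)))) (space R) = (\<integral>\<^sup>+\<omega>. ennreal (c + cos (s \<omega> + \<phi>)) * indicator (space R) \<omega> \<partial>R)"
        by (subst emeasure_density) auto
      also have "\<dots> \<le> (\<integral>\<^sup>+\<omega>. ennreal (c + 1) \<partial>R)"
        by (rule nn_integral_mono) (auto simp: indicator_def intro!: ennreal_leI nn)
      also have "\<dots> < \<top>" using finite_measure.emeasure_finite[OF that(3)]
        by (simp add: ennreal_mult_less_top less_top)
      finally show "finite_measure (density R (\<lambda>\<omega>. ennreal (c + cos (s \<omega> + \<phi>))))"
        by (intro finite_measureI) (simp add: less_top)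
    qed auto
    have "\<nu> = \<nu>'"
    proof (rule finite_measure_eqI_char)
      show "(\<integral>x. cis (t * x) \<partial>\<nu>) = (\<integral>x. cis (t * x) \<partial>\<nu>')" for t
        unfolding \<nu>_def \<nu>'_def using fin by (simp only: char assms eq)
    qed (auto simp: \<nu>_def \<nu>'_def intro!: finm fin)
    have val: "measure (distr (density R (\<lambda>\<omega>. ennreal (c + cos (s \<omega> + \<phi>)))) borel z) B = (\<integral>\<omega>. indicator B (z \<omega>) * (c + cos (s \<omega> + \<phi>)) \<partial>R)"
      if [measurable]: "s \<in> borel_measurable R" "z \<in> borel_measurable R" and "finite_measure R"
      for R :: "'c measure" and s z :: "'c \<Rightarrow> real"
    proof -
      have "measure (distr (density R (\<lambda>\<omega>. ennreal (c + cos (s \<omega> + \<phi>)))) borel z) B =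
        (\<integral>x. indicator B x \<partial>distr (density R (\<lambda>\<omega>. ennreal (c + cos (s \<omega> + \<phi>)))) borel z)" by simp
      also have "\<dots> = (\<integral>\<omega>. indicator B (z \<omega>) * (c + cos (s \<omega> + \<phi>)) \<partial>R)"
        by (subst integral_distr) (auto simp: integral_density nn mult.commute)
      finally show ?thesis .
    qed
    show ?thesis using \<open>\<nu> = \<nu>'\<close> unfolding \<nu>_def \<nu>'_def by (simp flip: val add: fin)
  qed
  \<comment> \<open>The cosine is 2 (1 + cos) - (2 + cos), a combination of the two nonnegative
    densities in which the constant term cancels.\<close>
  have cosB: "(\<integral>\<omega>. indicator B (Z \<omega>) * cos (S \<omega> + \<phi>) \<partial>P) = (\<integral>\<omega>. indicator B (Z' \<omega>) * cos (S' \<omega> + \<phi>) \<partial>Q)" for \<phi>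
  proof -
    have *: "(\<integral>\<omega>. indicator B (z \<omega>) * cos (s \<omega> + \<phi>) \<partial>R) =
        2 * (\<integral>\<omega>. indicator B (z \<omega>) * (1 + cos (s \<omega> + \<phi>)) \<partial>R) - (\<integral>\<omega>. indicator B (z \<omega>) * (2 + cos (s \<omega> + \<phi>)) \<partial>R)"
      if [measurable]: "s \<in> borel_measurable R" "z \<in> borel_measurable R" and "finite_measure R"
      for R :: "'c measure" and s z :: "'c \<Rightarrow> real"
    proof -
      interpret R: finite_measure R by fact
      have i: "integrable R (\<lambda>\<omega>. indicator B (z \<omega>) * (d + cos (s \<omega> + \<phi>)))" for d :: real
      proof (rule R.integrable_const_bound[where B="\<bar>d\<bar> + 1"])
        have "\<bar>d + cos x\<bar> \<le> \<bar>d\<bar> + 1" for x using cos_ge_minus_one[of x] cos_le_one[of x] by linarith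
        then show "AE \<omega> in R. norm (indicator B (z \<omega>) * (d + cos (s \<omega> + \<phi>))) \<le> \<bar>d\<bar> + 1"
          by (auto simp: indicator_def)
      qed auto
      have "2 * (\<integral>\<omega>. indicator B (z \<omega>) * (1 + cos (s \<omega> + \<phi>)) \<partial>R) - (\<integral>\<omega>. indicator B (z \<omega>) * (2 + cos (s \<omega> + \<phi>)) \<partial>R) =
        (\<integral>\<omega>. 2 * (indicator B (z \<omega>) * (1 + cos (s \<omega> + \<phi>))) - indicator B (z \<omega>) * (2 + cos (s \<omega> + \<phi>)) \<partial>R)"
        using i by simp
      also have "\<dots> = (\<integral>\<omega>. indicator B (z \<omega>) * cos (s \<omega> + \<phi>) \<partial>R)"
        by (intro Bochner_Integration.integral_cong refl) (simp add: algebra_simps)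
      finally show ?thesis by simp
    qed
    show ?thesis
      using *[OF assms(3,4) fin(1)] *[OF assms(5,6) fin(2)] key[of 1 \<phi>] key[of 2 \<phi>] by simp
  qed
  have split: "(\<integral>\<omega>. indicator B (z \<omega>) *\<^sub>R cis (s \<omega>) \<partial>R) =
      complex_of_real (\<integral>\<omega>. indicator B (z \<omega>) * cos (s \<omega> + 0) \<partial>R) + \<i> * complex_of_real (\<integral>\<omega>. indicator B (z \<omega>) * cos (s \<omega> + (- (pi/2))) \<partial>R)"
    if [measurable]: "s \<in> borel_measurable R" "z \<in> borel_measurable R" and "finite_measure R"
    for R :: "'c measure" and s z :: "'c \<Rightarrow> real"
  proof -
    interpret R: finite_measure R by fact
    have "integrable R (\<lambda>\<omega>. indicator B (z \<omega>) *\<^sub>R cis (s \<omega>))"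
      by (rule R.integrable_const_bound[where B=1]) (auto simp: indicator_def)
    from integral_Re[OF this] integral_Im[OF this] show ?thesis
      by (simp add: complex_eq_iff cos_diff)
  qed
  show ?thesis using fin by (simp only: split cosB assms)
qed

text \<open>Induction on the coordinates: the condition on \<open>j\<close> is absorbed into the
  measures as the densities \<open>P'\<close> and \<open>Q'\<close>, and
  \<open>char_restrict_unique\<close> shows that the joint characteristic functions of the other
  coordinates still agree. The measures must therefore be allowed to have any finite mass.\<close>

lemma joint_char_unique_boxes:
  fixes X :: "'i \<Rightarrow> 'a \<Rightarrow> real" and Y :: "'i \<Rightarrow> 'b \<Rightarrow> real"
  assumes "finite I" "finite_measure P" "finite_measure Q"
    and "\<And>i. i \<in> I \<Longrightarrow> X i \<in> borel_measurable P" "\<And>i. i \<in> I \<Longrightarrow> Y i \<in> borel_measurable Q"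
    and "\<And>a. (\<integral>\<omega>. cis (\<Sum>i\<in>I. a i * X i \<omega>) \<partial>P) = (\<integral>\<omega>. cis (\<Sum>i\<in>I. a i * Y i \<omega>) \<partial>Q)"
    and B: "\<And>i. i \<in> I \<Longrightarrow> B i \<in> sets (borel :: real measure)"
  shows "measure P {\<omega> \<in> space P. \<forall>i\<in>I. X i \<omega> \<in> B i} = measure Q {\<omega> \<in> space Q. \<forall>i\<in>I. Y i \<omega> \<in> B i}"
  using assms
proof (induction I arbitrary: P Q rule: finite_induct)
  case empty
  then show ?case by (simp add: cis_zero)
next
  case (insert j I)
  note [measurable] = insert.prems(3,4)[OF insertI1] insert.prems(6)[OF insertI1]
  have mI[measurable]: "X i \<in> borel_measurable P" "Y i \<in> borel_measurable Q" "B i \<in> sets borel" if "i \<in> I" for i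
    using insert.prems that by auto
  have mS[measurable]: "(\<lambda>\<omega>. \<Sum>i\<in>I. a i * X i \<omega>) \<in> borel_measurable P" 
     "(\<lambda>\<omega>. \<Sum>i\<in>I. a i * Y i \<omega>) \<in> borel_measurable Q" for a
    using mI by (auto intro!: borel_measurable_sum borel_measurable_times)
  define P' where "P' = density P (\<lambda>\<omega>. ennreal (indicator (B j) (X j \<omega>)))"
  define Q' where "Q' = density Q (\<lambda>\<omega>. ennreal (indicator (B j) (Y j \<omega>)))"
  have fin': "finite_measure (density R (\<lambda>\<omega>. ennreal (indicator (B j) (z \<omega>))))"
    if [measurable]: "z \<in> borel_measurable R" and "finite_measure R" for R :: "'c measure" and z
  proof (rule finite_measureI)
    have "emeasure (density R (\<lambda>\<omega>. ennreal (indicator (B j) (z \<omega>)))) (space R) = (\<integral>\<^sup>+\<omega>. ennreal (indicator (B j) (z \<omega>)) * indicator (space R) \<omega> \<partial>R)"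
      by (subst emeasure_density) auto
    also have "\<dots> \<le> (\<integral>\<^sup>+\<omega>. 1 \<partial>R)"
      by (rule nn_integral_mono) (auto simp: indicator_def)
    also have "\<dots> < \<top>" using finite_measure.emeasure_finite[OF that(2)] by (simp add: less_top)
    finally show "emeasure (density R (\<lambda>\<omega>. ennreal (indicator (B j) (z \<omega>)))) (space (density R (\<lambda>\<omega>. ennreal (indicator (B j) (z \<omega>))))) \<noteq> \<infinity>"
      by simp
  qed
  have ch: "(\<integral>\<omega>. cis (\<Sum>i\<in>I. a i * X i \<omega>) \<partial>P') = (\<integral>\<omega>. cis (\<Sum>i\<in>I. a i * Y i \<omega>) \<partial>Q')" for a
  proof -
    have "(\<integral>\<omega>. cis (s * (\<Sum>i\<in>I. a i * X i \<omega>) + t * X j \<omega>) \<partial>P) = (\<integral>\<omega>. cis (s * (\<Sum>i\<in>I. a i * Y i \<omega>) + t * Y j \<omega>) \<partial>Q)" for s t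
    proof -
      have s: "(\<Sum>i\<in>insert j I. (if i = j then t else s * a i) * W i \<omega>) = s * (\<Sum>i\<in>I. a i * W i \<omega>) + t * W j \<omega>" for W :: "_ \<Rightarrow> 'z \<Rightarrow> real" and \<omega>
      proof -
        have "(\<Sum>i\<in>I. (if i = j then t else s * a i) * W i \<omega>) = (\<Sum>i\<in>I. s * (a i * W i \<omega>))"
          using insert.hyps by (intro sum.cong) auto
        then show ?thesis using insert.hyps by (simp add: sum_distrib_left)
      qed
      show ?thesis using insert.prems(5)[of "\<lambda>i. if i = j then t else s * a i"]
        unfolding s[of X] s[of Y] .
    qed
    then have "(\<integral>\<omega>. indicator (B j) (X j \<omega>) *\<^sub>R cis (\<Sum>i\<in>I. a i * X i \<omega>) \<partial>P) = (\<integral>\<omega>. indicator (B j) (Y j \<omega>) *\<^sub>R cis (\<Sum>i\<in>I. a i * Y i \<omega>) \<partial>Q)"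
      by (intro char_restrict_unique insert.prems) auto
    then show ?thesis unfolding P'_def Q'_def by (simp add: integral_density)
  qed
  have meas_eq: "measure P' {\<omega> \<in> space P'. \<forall>i\<in>I. X i \<omega> \<in> B i} = measure Q' {\<omega> \<in> space Q'. \<forall>i\<in>I. Y i \<omega> \<in> B i}"
  proof (rule insert.IH)
    show "finite_measure P'" "finite_measure Q'" unfolding P'_def Q'_def
      by (rule fin'[OF insert.prems(3)[OF insertI1] insert.prems(1)], rule fin'[OF insert.prems(4)[OF insertI1] insert.prems(2)])
    show "X i \<in> borel_measurable P'" "Y i \<in> borel_measurable Q'" if "i \<in> I" for i
      using mI(1,2)[OF that] by (simp_all add: P'_def Q'_def)
  qed (use ch insert.prems in auto)
  have *: "measure (density R (\<lambda>\<omega>. ennreal (indicator (B j) (W j \<omega>)))) {\<omega> \<in> space (density R (\<lambda>\<omega>. ennreal (indicator (B j) (W j \<omega>)))). \<forall>i\<in>I. W i \<omega> \<in> B i}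
     = measure R {\<omega> \<in> space R. \<forall>i\<in>insert j I. W i \<omega> \<in> B i}" if "\<And>i. i \<in> insert j I \<Longrightarrow> W i \<in> borel_measurable R" for R :: "'c measure" and W
  proof -
    have [measurable]: "{\<omega> \<in> space R. \<forall>i\<in>I. W i \<omega> \<in> B i} \<in> sets R"
      using insert.hyps that mI by (intro sets.sets_Collect_finite_All' predE pred_sets2) auto
    have [measurable]: "W j \<in> borel_measurable R" using that by auto
    have E: "{\<omega> \<in> space R. \<forall>i\<in>insert j I. W i \<omega> \<in> B i} = {\<omega> \<in> space R. \<forall>i\<in>I. W i \<omega> \<in> B i} \<inter> {\<omega> \<in> space R. W j \<omega> \<in> B j}"
      by auto
    have "emeasure (density R (\<lambda>\<omega>. ennreal (indicator (B j) (W j \<omega>)))) {\<omega> \<in> space R. \<forall>i\<in>I. W i \<omega> \<in> B i}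
      = (\<integral>\<^sup>+\<omega>. ennreal (indicator (B j) (W j \<omega>)) * indicator {\<omega> \<in> space R. \<forall>i\<in>I. W i \<omega> \<in> B i} \<omega> \<partial>R)"
      by (rule emeasure_density) measurable
    also have "\<dots> = (\<integral>\<^sup>+\<omega>. indicator {\<omega> \<in> space R. \<forall>i\<in>insert j I. W i \<omega> \<in> B i} \<omega> \<partial>R)"
      by (rule nn_integral_cong) (auto simp: indicator_def)
    also have "\<dots> = emeasure R {\<omega> \<in> space R. \<forall>i\<in>insert j I. W i \<omega> \<in> B i}"
      unfolding E by (rule nn_integral_indicator) measurable
    finally show ?thesis by (simp add: measure_def)
  qed
  show ?case
    using meas_eq *[of X P, OF insert.prems(3)] *[of Y Q, OF insert.prems(4)] unfolding P'_def Q'_def by simp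
qed

lemma joint_char_unique:
  fixes X :: "'i \<Rightarrow> 'a \<Rightarrow> real" and Y :: "'i \<Rightarrow> 'b \<Rightarrow> real"
  assumes I: "finite I" and fin: "finite_measure P" "finite_measure Q"
    and m: "\<And>i. i \<in> I \<Longrightarrow> X i \<in> borel_measurable P" "\<And>i. i \<in> I \<Longrightarrow> Y i \<in> borel_measurable Q"
    and ch: "\<And>a. (\<integral>\<omega>. cis (\<Sum>i\<in>I. a i * X i \<omega>) \<partial>P) = (\<integral>\<omega>. cis (\<Sum>i\<in>I. a i * Y i \<omega>) \<partial>Q)"
    and S: "S \<in> sets (PiM I (\<lambda>_. borel))"
  shows "measure P {\<omega> \<in> space P. (\<lambda>i\<in>I. X i \<omega>) \<in> S} = measure Q {\<omega> \<in> space Q. (\<lambda>i\<in>I. Y i \<omega>) \<in> S}"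
proof -
  have mX: "(\<lambda>\<omega>. \<lambda>i\<in>I. W i \<omega>) \<in> measurable R (PiM I (\<lambda>_. borel))" if "\<And>i. i \<in> I \<Longrightarrow> W i \<in> borel_measurable R"
    for W :: "'i \<Rightarrow> 'c \<Rightarrow> real" and R
    using that by (intro measurable_restrict) auto
  define DP where "DP = distr P (PiM I (\<lambda>_. borel)) (\<lambda>\<omega>. \<lambda>i\<in>I. X i \<omega>)"
  define DQ where "DQ = distr Q (PiM I (\<lambda>_. borel)) (\<lambda>\<omega>. \<lambda>i\<in>I. Y i \<omega>)"
  have finD: "finite_measure DP" "finite_measure DQ"
    unfolding DP_def DQ_def using mX m fin by (auto intro!: finite_measure.finite_measure_distr)
  have box: "measure (distr R (PiM I (\<lambda>_. borel)) (\<lambda>\<omega>. \<lambda>i\<in>I. W i \<omega>)) (Pi\<^sub>E I A) = measure R {\<omega> \<in> space R. \<forall>i\<in>I. W i \<omega> \<in> A i}"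
    if "\<And>i. i \<in> I \<Longrightarrow> W i \<in> borel_measurable R" "\<And>i. i \<in> I \<Longrightarrow> A i \<in> sets borel"
    for W :: "'i \<Rightarrow> 'c \<Rightarrow> real" and R and A :: "'i \<Rightarrow> real set"
    using that mX[of W R] I by (subst measure_distr) (auto intro!: arg_cong[where f="measure R"] sets_PiM_I_finite)
  have "DP = DQ"
  proof (rule measure_eqI_PiM_finite[OF I, where M="\<lambda>_. borel" and A="\<lambda>_. space (PiM I (\<lambda>_. borel))"])
    fix A :: "'i \<Rightarrow> real set" assume "\<And>i. i \<in> I \<Longrightarrow> A i \<in> sets borel"
    then have "measure DP (Pi\<^sub>E I A) = measure DQ (Pi\<^sub>E I A)"
      unfolding DP_def DQ_def using m joint_char_unique_boxes[OF I fin m ch, of A] by (subst (1 2) box) auto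
    then show "emeasure DP (Pi\<^sub>E I A) = emeasure DQ (Pi\<^sub>E I A)"
      using finD by (simp add: finite_measure.emeasure_eq_measure)
  next
    show "range (\<lambda>_::nat. space (PiM I (\<lambda>_. borel :: real measure))) \<subseteq> prod_algebra I (\<lambda>_. borel)"
      using space_in_prod_algebra[of I "\<lambda>_. borel :: real measure"] by (simp add: space_PiM)
    show "emeasure DP (space (PiM I (\<lambda>_. borel))) \<noteq> \<infinity>"
      using finite_measure.emeasure_finite[OF finD(1)] by simp
  qed (auto simp: DP_def DQ_def)
  then have "measure DP S = measure DQ S" by simp
  then show ?thesis
    unfolding DP_def DQ_def using m S mX
    by (subst (asm) (1 2) measure_distr) (auto simp: vimage_def Int_def conj_commute)
qed

section \<open>Gaussian vectors\<close>

text \<open>Cholesky factorisation by induction. If K n n is positive, the Schur complement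
  \<open>K'\<close> is again positive semidefinite, and its factor is extended by the column K i n /
  sqrt (K n n). If K n n = 0, semidefiniteness makes the whole row vanish and the factor is extended
  by zeros.\<close>

lemma psd_gram_factor:
  fixes K :: "'i \<Rightarrow> 'i \<Rightarrow> real"
  assumes "finite I" and "\<And>i j. K i j = K j i"
    and "\<And>a. 0 \<le> (\<Sum>i\<in>I. \<Sum>j\<in>I. a i * a j * K i j)"
  shows "\<exists>A. \<forall>i\<in>I. \<forall>j\<in>I. K i j = (\<Sum>k\<in>I. A i k * A j k)"
  using assms
proof (induction I arbitrary: K rule: finite_induct)
  case empty
  then show ?case by simp
next
  case (insert n I)
  note sym = insert.prems(1)
  have expand: "(\<Sum>i\<in>insert n I. \<Sum>j\<in>insert n I. a i * a j * K i j) =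
      (\<Sum>i\<in>I. \<Sum>j\<in>I. a i * a j * K i j) + 2 * a n * (\<Sum>i\<in>I. a i * K i n) + (a n)\<^sup>2 * K n n" for a
  proof -
    have 1: "(\<Sum>j\<in>I. a n * a j * K n j) = a n * (\<Sum>i\<in>I. a i * K i n)"
      unfolding sum_distrib_left using sym[of n] by (intro sum.cong) auto
    have 2: "(\<Sum>i\<in>I. a i * a n * K i n) = a n * (\<Sum>i\<in>I. a i * K i n)"
      unfolding sum_distrib_left by (intro sum.cong) auto
    show ?thesis
      using insert.hyps by (simp add: sum.distrib 1 2 power2_eq_square)
  qed
  have quad: "0 \<le> (\<Sum>i\<in>I. \<Sum>j\<in>I. a i * a j * K i j) + 2 * c * (\<Sum>i\<in>I. a i * K i n) + c\<^sup>2 * K n n" for a c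
  proof -
    have "(\<Sum>i\<in>I. \<Sum>j\<in>I. (if i = n then c else a i) * (if j = n then c else a j) * K i j) = (\<Sum>i\<in>I. \<Sum>j\<in>I. a i * a j * K i j)"
      "(\<Sum>i\<in>I. (if i = n then c else a i) * K i n) = (\<Sum>i\<in>I. a i * K i n)"
      using insert.hyps by (auto intro!: sum.cong)
    then show ?thesis
      using insert.prems(2)[of "\<lambda>i. if i = n then c else a i"] unfolding expand by simp
  qed
  have Knn: "0 \<le> K n n" using quad[of "\<lambda>_. 0" 1] by simp
  show ?case
  proof (cases "K n n = 0")
    case True
    have K0: "K i n = 0" if "i \<in> I" for i
    proof (rule ccontr)
      assume "K i n \<noteq> 0"
      have s: "(\<Sum>j\<in>I. (if j = i then 1 else 0) * K j n) = K i n"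
        "(\<Sum>j\<in>I. \<Sum>k\<in>I. (if j = i then 1 else 0) * (if k = i then 1 else 0) * K j k) = K i i"
      proof -
        have "(\<Sum>k\<in>I. (if j = i then 1 else 0) * (if k = i then 1 else 0) * K j k) = (if j = i then K i i else 0)" for j
          using that insert.hyps by (cases "j = i") (simp_all add: if_distrib[of "\<lambda>x. x * _"] cong: if_cong)
        then show "(\<Sum>j\<in>I. \<Sum>k\<in>I. (if j = i then 1 else 0) * (if k = i then 1 else 0) * K j k) = K i i"
          using that insert.hyps by simp
        show "(\<Sum>j\<in>I. (if j = i then 1 else 0) * K j n) = K i n"
          using that insert.hyps by (simp add: if_distrib[of "\<lambda>x. x * _"] cong: if_cong)
      qed
      have "0 \<le> K i i + 2 * c * K i n" for c
        using quad[of "\<lambda>j. if j = i then 1 else 0" c] True unfolding s by simp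
      \<comment> \<open>The form is affine in \<open>c\<close> here, and this choice gives it the
        value -1.\<close>
      from this[of "- (K i i + 1) / (2 * K i n)"] \<open>K i n \<noteq> 0\<close> show False
        by (simp add: field_simps)
    qed
    have "0 \<le> (\<Sum>i\<in>I. \<Sum>j\<in>I. a i * a j * K i j)" for a using quad[of a 0] by simp
    from insert.IH[OF sym this] obtain A where A: "\<And>i j. i \<in> I \<Longrightarrow> j \<in> I \<Longrightarrow> K i j = (\<Sum>k\<in>I. A i k * A j k)"
      by blast
    show ?thesis
    proof (intro exI ballI)
      fix i j assume ij: "i \<in> insert n I" "j \<in> insert n I"
      show "K i j = (\<Sum>k\<in>insert n I. (if i = n \<or> k = n then 0 else A i k) * (if j = n \<or> k = n then 0 else A j k))"
      proof (cases "i = n \<or> j = n")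
        case True
        then have "K i j = 0" using ij K0 sym[of i j] \<open>K n n = 0\<close> by auto
        moreover have "(\<Sum>k\<in>insert n I. (if i = n \<or> k = n then 0 else A i k) * (if j = n \<or> k = n then 0 else A j k)) = 0"
          using True by (intro sum.neutral) auto
        ultimately show ?thesis by simp
      next
        case False
        then have "K i j = (\<Sum>k\<in>I. A i k * A j k)" using ij A by blast
        also have "\<dots> = (\<Sum>k\<in>I. (if i = n \<or> k = n then 0 else A i k) * (if j = n \<or> k = n then 0 else A j k))"
          using False insert.hyps by (intro sum.cong) auto
        finally show ?thesis using insert.hyps by simp
      qed
    qed
  next
    case False
    then have pos: "0 < K n n" using Knn by simp
    define K' where "K' i j = K i j - K i n * K j n / K n n" for i j
    have "0 \<le> (\<Sum>i\<in>I. \<Sum>j\<in>I. a i * a j * K' i j)" for a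
    proof -
      define s where "s = (\<Sum>i\<in>I. a i * K i n)"
      have "(\<Sum>i\<in>I. \<Sum>j\<in>I. a i * a j * K' i j) = (\<Sum>i\<in>I. \<Sum>j\<in>I. a i * a j * K i j) - (\<Sum>i\<in>I. \<Sum>j\<in>I. (a i * K i n) * (a j * K j n)) / K n n"
        unfolding K'_def by (simp add: right_diff_distrib sum_subtractf sum_divide_distrib mult.assoc mult.left_commute)
      also have "(\<Sum>i\<in>I. \<Sum>j\<in>I. (a i * K i n) * (a j * K j n)) = s\<^sup>2"
        by (simp add: s_def power2_eq_square sum_product)
      \<comment> \<open>The form is minimised over the coefficient of \<open>n\<close>; the
        minimiser is -s / K n n.\<close>
      also have "0 \<le> (\<Sum>i\<in>I. \<Sum>j\<in>I. a i * a j * K i j) - s\<^sup>2 / K n n"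
        using quad[of a "- s / K n n"] pos by (simp add: s_def[symmetric] power2_eq_square field_simps)
      finally show ?thesis .
    qed
    moreover have "K' i j = K' j i" for i j using sym[of i j] by (simp add: K'_def)
    ultimately obtain A where A: "\<And>i j. i \<in> I \<Longrightarrow> j \<in> I \<Longrightarrow> K' i j = (\<Sum>k\<in>I. A i k * A j k)"
      using insert.IH[of K'] by blast
    define A' where "A' i k = (if k = n then K i n / sqrt (K n n) else if i = n then 0 else A i k)" for i k
    have "K i j = (\<Sum>k\<in>insert n I. A' i k * A' j k)" if ij: "i \<in> insert n I" "j \<in> insert n I" for i j
    proof -
      have "(\<Sum>k\<in>I. A' i k * A' j k) = (if i = n \<or> j = n then 0 else K' i j)"
      proof (cases "i = n \<or> j = n")
        case True
        then show ?thesis using insert.hyps by (auto simp: A'_def intro!: sum.neutral)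
      next
        case F: False
        then have "K' i j = (\<Sum>k\<in>I. A i k * A j k)" using ij A by auto
        then show ?thesis using F insert.hyps by (auto simp: A'_def intro!: sum.cong)
      qed
      moreover have "A' i n * A' j n = K i n * K j n / K n n"
        using pos by (simp add: A'_def flip: real_sqrt_mult)
      moreover have "K i j = (if i = n \<or> j = n then 0 else K' i j) + K i n * K j n / K n n"
        using pos sym[of j n] by (auto simp: K'_def)
      ultimately show ?thesis using insert.hyps by simp
    qed
    then show ?thesis by blast
  qed
qed

lemma char_PiM_std_normal:
  fixes b :: "'i \<Rightarrow> real"
  assumes I: "finite I"
  shows "(\<integral>g. cis (\<Sum>k\<in>I. b k * g k) \<partial>PiM I (\<lambda>_. std_normal_distribution)) = of_real (exp (- (\<Sum>k\<in>I. (b k)\<^sup>2) / 2))"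
proof -
  interpret N: product_prob_space "\<lambda>_. std_normal_distribution" I
    by (intro product_prob_spaceI prob_space_normal_density) auto
  have e: "cis (\<Sum>k\<in>I. b k * g k) = (\<Prod>k\<in>I. cis (b k * g k))" for g
    using I by (induction I rule: finite_induct) (simp_all add: cis_zero flip: cis_mult)
  have 1: "(\<integral>x. cis (t * x) \<partial>std_normal_distribution) = of_real (exp (- t\<^sup>2 / 2))" for t
    using fun_cong[OF char_std_normal_distribution, of t] by (simp add: char_def cis_conv_exp)
  have "(\<integral>g. (\<Prod>k\<in>I. cis (b k * g k)) \<partial>PiM I (\<lambda>_. std_normal_distribution)) = (\<Prod>k\<in>I. \<integral>x. cis (b k * x) \<partial>std_normal_distribution)"
    by (rule N.product_integral_prod[OF I]) (intro finite_measure.integrable_cis prob_space.finite_measure prob_space_normal_density; simp)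
  moreover have "(\<Prod>k\<in>I. exp (- (b k)\<^sup>2 / 2)) = exp (- (\<Sum>k\<in>I. (b k)\<^sup>2) / 2)"
    using I by (simp add: exp_sum[symmetric] sum_negf sum_divide_distrib)
  ultimately show ?thesis
    by (simp add: e 1 del: of_real_exp flip: of_real_prod)
qed

text \<open>Joint Gaussianity is expressed by characteristic functions of linear combinations rather
  than by a density, so singular \<open>K\<close> is included.\<close>

definition gaussian_vector :: "'a measure \<Rightarrow> 'i set \<Rightarrow> ('i \<Rightarrow> 'a \<Rightarrow> real) \<Rightarrow> ('i \<Rightarrow> 'i \<Rightarrow> real) \<Rightarrow> bool" where
  "gaussian_vector M I X K \<longleftrightarrow> finite I \<and> prob_space M \<and> (\<forall>i j. K i j = K j i) \<and> (\<forall>i\<in>I. X i \<in> borel_measurable M) \<and>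
     (\<forall>a. (\<integral>\<omega>. cis (\<Sum>i\<in>I. a i * X i \<omega>) \<partial>M) = of_real (exp (- (\<Sum>i\<in>I. \<Sum>j\<in>I. a i * a j * K i j) / 2)))"

lemma gaussian_vector_law_unique:
  assumes "gaussian_vector M I X K" "gaussian_vector M' I Y K" "S \<in> sets (PiM I (\<lambda>_. borel))"
  shows "measure M {\<omega> \<in> space M. (\<lambda>i\<in>I. X i \<omega>) \<in> S} = measure M' {\<omega> \<in> space M'. (\<lambda>i\<in>I. Y i \<omega>) \<in> S}"
  using assms unfolding gaussian_vector_def by (intro joint_char_unique) (auto intro: prob_space.finite_measure)

text \<open>A characteristic function has modulus at most 1, which forces the exponent to be
  nonpositive.\<close>

lemma gaussian_vector_psd:
  assumes "gaussian_vector M I X K"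
  shows "0 \<le> (\<Sum>i\<in>I. \<Sum>j\<in>I. a i * a j * K i j)"
proof -
  interpret prob_space M using assms by (simp add: gaussian_vector_def)
  have "norm (\<integral>\<omega>. cis (\<Sum>i\<in>I. a i * X i \<omega>) \<partial>M) \<le> (\<integral>\<omega>. norm (cis (\<Sum>i\<in>I. a i * X i \<omega>)) \<partial>M)"
    by (rule integral_norm_bound)
  also have "\<dots> = 1" by (simp add: prob_space)
  finally show ?thesis using assms by (simp add: gaussian_vector_def)
qed

text \<open>By uniqueness of the law, \<open>X\<close> may be replaced by the image \<open>Y\<close>
  of independent standard normals under a Gram factor \<open>R\<close>. By Cauchy-Schwarz the
  coordinate \<open>i\<close> of \<open>Y\<close> is Lipschitz with constant the square root of K i
  i, so a difference \<open>t\<close> in some coordinate forces squared distance at least t^2/s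
  between the preimages.\<close>

lemma gaussian_vector_concentration:
  assumes gv: "gaussian_vector M I X K" and [measurable]: "A \<in> sets (PiM I (\<lambda>_. borel))" "B \<in> sets (PiM I (\<lambda>_. borel))"
    and far: "\<And>x y. x \<in> A \<Longrightarrow> y \<in> B \<Longrightarrow> \<exists>i\<in>I. t \<le> \<bar>x i - y i\<bar>"
    and var: "\<And>i. i \<in> I \<Longrightarrow> K i i \<le> s" and s: "0 < s" and t: "0 \<le> t"
  shows "measure M {\<omega> \<in> space M. (\<lambda>i\<in>I. X i \<omega>) \<in> A} * measure M {\<omega> \<in> space M. (\<lambda>i\<in>I. X i \<omega>) \<in> B} \<le> exp (- t\<^sup>2 / (4 * s))"
proof -
  have I: "finite I" using gv by (simp add: gaussian_vector_def)
  obtain R where R: "\<And>i j. i \<in> I \<Longrightarrow> j \<in> I \<Longrightarrow> K i j = (\<Sum>k\<in>I. R i k * R j k)"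
    using psd_gram_factor[OF I, of K] gaussian_vector_psd[OF gv] gv unfolding gaussian_vector_def by blast
  let ?N = "PiM I (\<lambda>_. std_normal_distribution)"
  interpret N: product_prob_space "\<lambda>_. std_normal_distribution" I
    by (intro product_prob_spaceI prob_space_normal_density) auto
  define Y where "Y i g = (\<Sum>k\<in>I. R i k * g k)" for i g
  have mY[measurable]: "Y i \<in> borel_measurable ?N" for i
    unfolding Y_def by measurable
  have gvY: "gaussian_vector ?N I Y K"
    unfolding gaussian_vector_def
  proof (intro conjI allI ballI)
    fix a :: "'b \<Rightarrow> real"
    have "(\<Sum>i\<in>I. a i * Y i g) = (\<Sum>k\<in>I. (\<Sum>i\<in>I. a i * R i k) * g k)" for g
      unfolding Y_def by (simp add: sum_distrib_left sum_distrib_right mult.assoc) (rule sum.swap)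
    moreover have "(\<Sum>k\<in>I. (\<Sum>i\<in>I. a i * R i k)\<^sup>2) = (\<Sum>i\<in>I. \<Sum>j\<in>I. a i * a j * K i j)"
    proof -
      have "(\<Sum>k\<in>I. (\<Sum>i\<in>I. a i * R i k)\<^sup>2) = (\<Sum>k\<in>I. \<Sum>i\<in>I. \<Sum>j\<in>I. a i * a j * (R i k * R j k))"
        by (simp add: power2_eq_square sum_product mult.assoc mult.left_commute)
      also have "\<dots> = (\<Sum>i\<in>I. \<Sum>k\<in>I. \<Sum>j\<in>I. a i * a j * (R i k * R j k))" by (rule sum.swap)
      also have "\<dots> = (\<Sum>i\<in>I. \<Sum>j\<in>I. \<Sum>k\<in>I. a i * a j * (R i k * R j k))" by (intro sum.cong refl sum.swap)
      also have "\<dots> = (\<Sum>i\<in>I. \<Sum>j\<in>I. a i * a j * K i j)" by (intro sum.cong refl) (simp add: R sum_distrib_left)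
      finally show ?thesis .
    qed
    ultimately show "(\<integral>g. cis (\<Sum>i\<in>I. a i * Y i g) \<partial>?N) = of_real (exp (- (\<Sum>i\<in>I. \<Sum>j\<in>I. a i * a j * K i j) / 2))"
      by (simp add: char_PiM_std_normal[OF I])
  qed (use I gv N.prob_space_axioms in \<open>auto simp: gaussian_vector_def\<close>)
  have Ymap[measurable]: "(\<lambda>g. \<lambda>i\<in>I. Y i g) \<in> measurable ?N (PiM I (\<lambda>_. borel))" by measurable
  have "measure ?N {g \<in> space ?N. (\<lambda>i\<in>I. Y i g) \<in> A} * measure ?N {g \<in> space ?N. (\<lambda>i\<in>I. Y i g) \<in> B} \<le> exp (- (t\<^sup>2 / s) / 4)"
  proof (rule gaussian_concentration_PiM[OF I])
    fix g g' assume "g \<in> {g \<in> space ?N. (\<lambda>i\<in>I. Y i g) \<in> A}" "g' \<in> {g \<in> space ?N. (\<lambda>i\<in>I. Y i g) \<in> B}"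
    then obtain i where i: "i \<in> I" "t \<le> \<bar>Y i g - Y i g'\<bar>" using far by force
    have "t\<^sup>2 \<le> (Y i g - Y i g')\<^sup>2" using i t by (metis power2_abs power_mono)
    also have "Y i g - Y i g' = (\<Sum>k\<in>I. R i k * (g k - g' k))"
      by (simp add: Y_def right_diff_distrib sum_subtractf)
    also have "\<dots>\<^sup>2 \<le> (\<Sum>k\<in>I. (R i k)\<^sup>2) * (\<Sum>k\<in>I. (g k - g' k)\<^sup>2)"
      by (rule Cauchy_Schwarz_ineq_sum)
    also have "(\<Sum>k\<in>I. (R i k)\<^sup>2) \<le> s" using var[OF i(1)] R[OF i(1) i(1)] by (simp add: power2_eq_square)
    finally have "t\<^sup>2 \<le> s * (\<Sum>k\<in>I. (g k - g' k)\<^sup>2)" by (simp add: mult_right_mono sum_nonneg)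
    then show "t\<^sup>2 / s \<le> (\<Sum>k\<in>I. (g k - g' k)\<^sup>2)" using s by (simp add: field_simps)
  qed measurable
  then show ?thesis using s by (simp add: gaussian_vector_law_unique[OF gv gvY] mult.commute)
qed

section \<open>A planar crossing dichotomy\<close>

text \<open>Diagonal moves are what makes the dichotomy true: in a chessboard colouring neither
  colour has a nearest-neighbour crossing.\<close>

definition king_adjacent :: "nat \<times> nat \<Rightarrow> nat \<times> nat \<Rightarrow> bool" where
  "king_adjacent p q \<longleftrightarrow> fst p \<le> Suc (fst q) \<and> fst q \<le> Suc (fst p) \<and>
     snd p \<le> Suc (snd q) \<and> snd q \<le> Suc (snd p)"

text \<open>Reachability takes the place of explicit paths. The relation tests only the vertex being
  entered, so the initial vertex is tested by \<open>S \<inter> U\<close>.\<close>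

definition crosses_from :: "('v \<Rightarrow> 'v \<Rightarrow> bool) \<Rightarrow> 'v set \<Rightarrow> 'v set \<Rightarrow> 'v \<Rightarrow> bool" where
  "crosses_from adj S U q \<longleftrightarrow> (\<exists>p\<in>S \<inter> U. (\<lambda>p q. q \<in> S \<and> adj p q)\<^sup>*\<^sup>* p q)"

definition crosses :: "('v \<Rightarrow> 'v \<Rightarrow> bool) \<Rightarrow> 'v set \<Rightarrow> 'v set \<Rightarrow> 'v set \<Rightarrow> bool" where
  "crosses adj S U V \<longleftrightarrow> (\<exists>q\<in>V. crosses_from adj S U q)"

lemma crosses_from_start: "p \<in> S \<Longrightarrow> p \<in> U \<Longrightarrow> crosses_from adj S U p"
  by (auto simp: crosses_from_def)

lemma crosses_from_step: "crosses_from adj S U p \<Longrightarrow> adj p q \<Longrightarrow> q \<in> S \<Longrightarrow> crosses_from adj S U q"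
  unfolding crosses_from_def
  by (elim bexE, intro bexI) (auto intro: rtranclp.rtrancl_into_rtrancl)

definition grid :: "nat \<Rightarrow> (nat \<times> nat) set" where
  "grid n = {..n} \<times> {..n}"

text \<open>
  The board is extended by a frame, and the displacement rule of Gale's proof is used: a site of
  \<open>A\<close> moves right if it is joined to the left side within \<open>A\<close> and left otherwise, a site of
  \<open>- A\<close> moves up if it is joined to the bottom and down otherwise. The two labels are the signs of
  the coordinates of the displacement in a frame rotated by 45 degrees.
\<close>

lemma hex_dichotomy:
  shows "crosses king_adjacent (grid n \<inter> A) {p. fst p = 0} {p. fst p = n} \<or>
         crosses king_adjacent (grid n - A) {p. snd p = 0} {p. snd p = n}"
proof (rule ccontr)
  assume neg: "\<not> ?thesis"
  define SA where "SA = grid n \<inter> A"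
  define SB where "SB = grid n - A"
  define LA where "LA q = crosses_from king_adjacent SA {p. fst p = 0} q" for q
  define LB where "LB q = crosses_from king_adjacent SB {p. snd p = 0} q" for q
  have nA: "fst q \<noteq> n" if "LA q" for q
    using neg that unfolding LA_def SA_def crosses_def by blast
  have nB: "snd q \<noteq> n" if "LB q" for q
    using neg that unfolding LB_def SB_def crosses_def by blast
  have sA: "LA q" if "q \<in> SA" "fst q = 0" for q
    using that by (auto simp: LA_def intro: crosses_from_start)
  have sB: "LB q" if "q \<in> SB" "snd q = 0" for q
    using that by (auto simp: LB_def intro: crosses_from_start)
  have tA: "LA q" if "LA p" "king_adjacent p q" "q \<in> SA" for p q
    using that by (auto simp: LA_def intro: crosses_from_step)
  have tB: "LB q" if "LB p" "king_adjacent p q" "q \<in> SB" for p q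
    using that by (auto simp: LB_def intro: crosses_from_step)
  \<comment> \<open>The board occupies the indices 1 to n + 1, hence the subtraction of 1 below; 0
    and \<open>P\<close> are the frame.\<close>
  define P where "P = Suc (Suc n)"
  \<comment> \<open>The frame points towards the board. Its corners are assigned so that the first
    label is constant on the left and on the right side and the second on the bottom and on the top
    side, as the boundary conditions of \<open>kuhn_lemma\<close> demand.\<close>
  define d :: "nat \<Rightarrow> nat \<Rightarrow> int \<times> int" where
    "d x y = (if x = 0 then (if y = P then (0,-1) else (1,0))
              else if y = 0 then (0,1)
              else if x = P then (-1,0)
              else if y = P then (0,-1)
              else let p = (x - 1, y - 1) in
                if p \<in> A then (if LA p then (1,0) else (-1,0)) else (if LB p then (0,1) else (0,-1)))" for x y
  have d_cases: "d x y \<in> {(1,0),(-1,0),(0,1),(0,-1)}" for x y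
    by (auto simp: d_def Let_def)
  \<comment> \<open>Opposite horizontal displacements cannot occur in one unit cell. A site of
    \<open>A\<close> next to the left frame, or next to a site joined to the left side, is itself
    joined; a joined site next to the right frame would complete the excluded crossing.
    \<open>noB\<close> is the vertical counterpart.\<close>
  have noA: False if "d x y = (1,0)" "d x' y' = (-1,0)"
      "x \<le> P" "y \<le> P" "x' \<le> P" "y' \<le> P" "x \<le> x' + 1" "x' \<le> x + 1" "y \<le> y' + 1" "y' \<le> y + 1" for x y x' y'
  proof -
    have x'0: "x' \<noteq> 0" and y'0: "y' \<noteq> 0" using that(2) by (auto simp: d_def split: if_splits)
    have xP: "x \<noteq> P" using that(1) y'0 by (auto simp: d_def Let_def P_def split: if_splits)
    show False
    proof (cases "x = 0")
      case True
      then have "x' = 1" using x'0 that by simp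
      then have "(0, y'-1) \<in> SA" "\<not> LA (0, y'-1)" 
        using that(2) y'0 that(6) by (auto simp: d_def Let_def P_def SA_def grid_def split: if_splits)
      then show False using sA by auto
    next
      case False
      then have y: "y \<noteq> 0" "y \<noteq> P" and L: "LA (x-1, y-1)" "(x-1,y-1) \<in> SA"
        using that(1,3,4) xP by (auto simp: d_def Let_def P_def SA_def grid_def split: if_splits)
      show False
      proof (cases "x' = P")
        case True
        then have "x = Suc n" using that xP by (auto simp: P_def)
        then show False using nA[OF L(1)] by simp
      next
        case False
        then have "(x'-1,y'-1) \<in> SA" "\<not> LA (x'-1, y'-1)"
          using that(2) y'0 x'0 that(5,6) by (auto simp: d_def Let_def P_def SA_def grid_def split: if_splits)
        moreover have "king_adjacent (x-1,y-1) (x'-1,y'-1)"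
          using that y \<open>x \<noteq> 0\<close> x'0 y'0 by (auto simp: king_adjacent_def)
        ultimately show False using tA L by blast
      qed
    qed
  qed
  have noB: False if "d x y = (0,1)" "d x' y' = (0,-1)"
      "x \<le> P" "y \<le> P" "x' \<le> P" "y' \<le> P" "x \<le> x' + 1" "x' \<le> x + 1" "y \<le> y' + 1" "y' \<le> y + 1" for x y x' y'
  proof -
    have y'0: "y' \<noteq> 0" and yP: "y \<noteq> P" and x0: "x \<noteq> 0" 
      using that(1,2) by (auto simp: d_def P_def Let_def split: if_splits)
    show False
    proof (cases "y = 0")
      case True
      then have "y' = 1" using y'0 that by simp
      then have "x' \<noteq> 0" "x' \<noteq> P" "(x'-1, 0) \<in> SB" "\<not> LB (x'-1, 0)" 
        using that(2) y'0 that(5,6) by (auto simp: d_def Let_def P_def SB_def grid_def split: if_splits)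
      then show False using sB by auto
    next
      case False
      then have x: "x \<noteq> P" and L: "LB (x-1, y-1)" "(x-1,y-1) \<in> SB"
        using that(1,3,4) x0 yP by (auto simp: d_def Let_def P_def SB_def grid_def split: if_splits)
      show False
      proof (cases "y' = P")
        case True
        then have "y = Suc n" using that yP by (auto simp: P_def)
        then show False using nB[OF L(1)] by simp
      next
        case F: False
        then have "x' \<noteq> 0" "(x'-1,y'-1) \<in> SB" "\<not> LB (x'-1, y'-1)"
          using that(2) y'0 that(5,6) by (auto simp: d_def Let_def P_def SB_def grid_def split: if_splits)
        moreover have "king_adjacent (x-1,y-1) (x'-1,y'-1)"
          using that x0 y'0 \<open>y \<noteq> 0\<close> \<open>x' \<noteq> 0\<close> by (auto simp: king_adjacent_def)
        ultimately show False using tB L by blast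
      qed
    qed
  qed
  \<comment> \<open>For a displacement (u, v), label 0 records the sign of u - v and label 1 the
    sign of u + v, with value 0 for positive.\<close>
  define label :: "(nat \<Rightarrow> nat) \<Rightarrow> nat \<Rightarrow> nat" where
    "label x i = (if i = 0 then (if d (x 0) (x 1) \<in> {(1,0),(0,-1)} then 0 else 1)
                  else (if d (x 0) (x 1) \<in> {(1,0),(0,1)} then 0 else 1))" for x i
  have two: "i < 2 \<longleftrightarrow> i = 0 \<or> i = Suc 0" for i :: nat by auto
  obtain q where q: "\<forall>i<2. q i < P" and
    rs: "\<forall>i<2. \<exists>r s. (\<forall>j<2. q j \<le> r j \<and> r j \<le> q j + 1) \<and> (\<forall>j<2. q j \<le> s j \<and> s j \<le> q j + 1) \<and> label r i \<noteq> label s i"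
  proof (rule kuhn_lemma[of P 2 label])
    show "0 < P" by (simp add: P_def)
    show "\<forall>x. (\<forall>i<2. x i \<le> P) \<longrightarrow> (\<forall>i<2. label x i = 0 \<or> label x i = 1)"
      by (simp add: label_def)
    show "\<forall>x. (\<forall>i<2. x i \<le> P) \<longrightarrow> (\<forall>i<2. x i = 0 \<longrightarrow> label x i = 0)"
      by (auto simp: label_def two d_def P_def)
    show "\<forall>x. (\<forall>i<2. x i \<le> P) \<longrightarrow> (\<forall>i<2. x i = P \<longrightarrow> label x i = 1)"
      by (auto simp: label_def two d_def P_def)
  qed
  obtain r s where r: "q 0 \<le> r 0" "r 0 \<le> q 0 + 1" "q 1 \<le> r 1" "r 1 \<le> q 1 + 1"
      and s: "q 0 \<le> s 0" "s 0 \<le> q 0 + 1" "q 1 \<le> s 1" "s 1 \<le> q 1 + 1" and l0: "label r 0 \<noteq> label s 0"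
    using rs[rule_format, of 0] by (auto simp: two)
  obtain t u where t: "q 0 \<le> t 0" "t 0 \<le> q 0 + 1" "q 1 \<le> t 1" "t 1 \<le> q 1 + 1"
      and u: "q 0 \<le> u 0" "u 0 \<le> q 0 + 1" "q 1 \<le> u 1" "u 1 \<le> q 1 + 1" and l1: "label t 1 \<noteq> label u 1"
    using rs[rule_format, of 1] by (auto simp: two)
  define D where "D = {d x y |x y. x \<in> {q 0, q 0 + 1} \<and> y \<in> {q 1, q 1 + 1}}"
  have qP: "q 0 < P" "q 1 < P" using q by auto
  have A: "\<not> ((1,0) \<in> D \<and> (-1,0) \<in> D)"
  proof
    assume "(1,0) \<in> D \<and> (-1,0) \<in> D"
    then obtain x y x' y' where "d x y = (1,0)" "d x' y' = (-1,0)"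
      "x \<in> {q 0, q 0 + 1}" "y \<in> {q 1, q 1 + 1}" "x' \<in> {q 0, q 0 + 1}" "y' \<in> {q 1, q 1 + 1}"
      unfolding D_def mem_Collect_eq by (metis (no_types, lifting))
    then show False using qP by (intro noA[of x y x' y']) auto
  qed
  have B: "\<not> ((0,1) \<in> D \<and> (0,-1) \<in> D)"
  proof
    assume "(0,1) \<in> D \<and> (0,-1) \<in> D"
    then obtain x y x' y' where "d x y = (0,1)" "d x' y' = (0,-1)"
      "x \<in> {q 0, q 0 + 1}" "y \<in> {q 1, q 1 + 1}" "x' \<in> {q 0, q 0 + 1}" "y' \<in> {q 1, q 1 + 1}"
      unfolding D_def mem_Collect_eq by (metis (no_types, lifting))
    then show False using qP by (intro noB[of x y x' y']) auto
  qed
  have "d (v 0) (v 1) \<in> D" if "q 0 \<le> v 0" "v 0 \<le> q 0 + 1" "q 1 \<le> v 1" "v 1 \<le> q 1 + 1" for v :: "nat \<Rightarrow> nat"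
  proof -
    have "v 0 \<in> {q 0, q 0 + 1}" "v 1 \<in> {q 1, q 1 + 1}" using that by auto
    then show ?thesis unfolding D_def by blast
  qed
  then have "d (r 0) (r 1) \<in> D" "d (s 0) (s 1) \<in> D" "d (t 0) (t 1) \<in> D" "d (u 0) (u 1) \<in> D"
    using r s t u by auto
  note inD = this
  have "D \<subseteq> {(1,0),(-1,0),(0,1),(0,-1)}"
    unfolding D_def using d_cases by blast
  \<comment> \<open>Without opposite directions the cell \<open>D\<close> uses at most two
    perpendicular ones, and on each such pair one of the two labels is constant. But in the cell
    found by \<open>kuhn_lemma\<close> both labels take both values.\<close>
  with A B have four: "D \<subseteq> {(1,0),(0,1)} \<or> D \<subseteq> {(1,0),(0,-1)} \<or> D \<subseteq> {(-1,0),(0,1)} \<or> D \<subseteq> {(-1,0),(0,-1)}"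
    by blast
  have h0: "D \<inter> {(1,0),(0,-1)} \<noteq> {} \<and> \<not> D \<subseteq> {(1,0),(0,-1)}"
    using l0 inD(1,2) by (auto simp: label_def split: if_splits)
  have h1: "D \<inter> {(1,0),(0,1)} \<noteq> {} \<and> \<not> D \<subseteq> {(1,0),(0,1)}"
    using l1 inD(3,4) by (auto simp: label_def split: if_splits)
  have "{(-1,0),(0,1)} \<inter> {(1,0),(0,-1)} = ({} :: (int \<times> int) set)"
       "{(-1,0),(0,-1)} \<inter> {(1,0),(0,1)} = ({} :: (int \<times> int) set)"
    by simp_all
  with four h0 h1 show False by (metis (no_types, lifting) Int_mono order_refl subset_empty)
qed

text \<open>An edge may be mapped to a whole path, which is what replacing a diagonal step requires.
  Quarter turns and enlargements of the vertex set are handled by the same lemma.\<close>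

lemma crosses_map:
  assumes c: "crosses adj S U V" and S: "\<And>p. p \<in> S \<Longrightarrow> r p \<in> S'"
    and adj: "\<And>p q. p \<in> S \<Longrightarrow> q \<in> S \<Longrightarrow> adj p q \<Longrightarrow> (\<lambda>p q. q \<in> S' \<and> adj' p q)\<^sup>*\<^sup>* (r p) (r q)"
    and UV: "\<And>p. p \<in> S \<Longrightarrow> p \<in> U \<Longrightarrow> r p \<in> U'" "\<And>p. p \<in> S \<Longrightarrow> p \<in> V \<Longrightarrow> r p \<in> V'"
  shows "crosses adj' S' U' V'"
proof -
  obtain p q where p: "p \<in> S" "p \<in> U" "q \<in> V" and r: "(\<lambda>p q. q \<in> S \<and> adj p q)\<^sup>*\<^sup>* p q"
    using c by (auto simp: crosses_def crosses_from_def)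
  from r have "q \<in> S \<and> (\<lambda>p q. q \<in> S' \<and> adj' p q)\<^sup>*\<^sup>* (r p) (r q)"
  proof induction
    case (step y z)
    then show ?case using adj[of y z] by (auto intro: rtranclp_trans)
  qed (use p in simp)
  then show ?thesis using p S UV by (auto simp: crosses_def crosses_from_def)
qed

section \<open>Logarithmic energies of circles\<close>

abbreviation unit_interval_measure :: "real measure" where
  "unit_interval_measure \<equiv> uniform_measure lborel {0..1}"

abbreviation circle_point :: "real \<Rightarrow> complex" where
  "circle_point t \<equiv> cis (2 * pi * t)"

section \<open>Rotation invariance of the uniform measure on a circle\<close>

lemma circle_point_measurable[measurable]: "circle_point \<in> borel_measurable borel"
  by (intro borel_measurable_continuous_onI continuous_intros)

lemma prob_space_unit_interval: "prob_space unit_interval_measure"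
  by (rule prob_space_uniform_measure) auto

text \<open>With the half-open interval a shifted period can be cut and reassembled without
  overlap.\<close>

lemma nn_integral_unit_interval:
  assumes [measurable]: "f \<in> borel_measurable borel"
  shows "(\<integral>\<^sup>+t. f t \<partial>unit_interval_measure) = (\<integral>\<^sup>+t. f t * indicator {0..<1} t \<partial>lborel)"
proof -
  have "(\<integral>\<^sup>+t. f t \<partial>unit_interval_measure) = (\<integral>\<^sup>+t. f t * indicator {0..1} t \<partial>lborel)"
    by (subst nn_integral_uniform_measure) (auto simp: divide_ennreal_def)
  also have "\<dots> = (\<integral>\<^sup>+t. f t * indicator {0..<1} t \<partial>lborel)"
    using AE_lborel_singleton[of 1] by (intro nn_integral_cong_AE) (auto elim!: eventually_mono simp: indicator_def)
  finally show ?thesis .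
qed

lemma nn_integral_periodic_shift:
  fixes g :: "real \<Rightarrow> ennreal"
  assumes [measurable]: "g \<in> borel_measurable borel" and per: "\<And>t. g (t + 1) = g t" and s: "0 \<le> s" "s \<le> 1"
  shows "(\<integral>\<^sup>+t. g (t + s) \<partial>unit_interval_measure) = (\<integral>\<^sup>+t. g t \<partial>unit_interval_measure)"
proof -
  have tr: "(\<integral>\<^sup>+t. f (t + c) \<partial>lborel) = (\<integral>\<^sup>+t. f t \<partial>lborel)" if [measurable]: "f \<in> borel_measurable borel" for f :: "real \<Rightarrow> ennreal" and c
    using nn_integral_real_affine[of f 1 c] by (simp add: add.commute)
  have "(\<integral>\<^sup>+t. g (t + s) \<partial>unit_interval_measure) = (\<integral>\<^sup>+t. g (t + s) * indicator {s..<1+s} (t + s) \<partial>lborel)"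
    by (subst nn_integral_unit_interval) (auto intro!: nn_integral_cong simp: indicator_def)
  also have "\<dots> = (\<integral>\<^sup>+t. g t * indicator {s..<1+s} t \<partial>lborel)"
    by (rule tr[of "\<lambda>t. g t * indicator {s..<1+s} t"]) measurable
  also have "\<dots> = (\<integral>\<^sup>+t. g t * indicator {s..<1} t + g t * indicator {1..<1+s} t \<partial>lborel)"
    using s by (intro nn_integral_cong) (auto simp: indicator_def)
  also have "\<dots> = (\<integral>\<^sup>+t. g t * indicator {s..<1} t \<partial>lborel) + (\<integral>\<^sup>+t. g t * indicator {1..<1+s} t \<partial>lborel)"
    by (rule nn_integral_add) auto
  also have "(\<integral>\<^sup>+t. g t * indicator {1..<1+s} t \<partial>lborel) = (\<integral>\<^sup>+t. g (t + 1) * indicator {1..<1+s} (t + 1) \<partial>lborel)"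
    by (rule tr[of "\<lambda>t. g t * indicator {1..<1+s} t", symmetric]) measurable
  also have "\<dots> = (\<integral>\<^sup>+t. g t * indicator {0..<s} t \<partial>lborel)"
    by (intro nn_integral_cong) (auto simp: per indicator_def)
  also have "(\<integral>\<^sup>+t. g t * indicator {s..<1} t \<partial>lborel) + (\<integral>\<^sup>+t. g t * indicator {0..<s} t \<partial>lborel) =
      (\<integral>\<^sup>+t. g t * indicator {s..<1} t + g t * indicator {0..<s} t \<partial>lborel)"
    by (rule nn_integral_add[symmetric]) auto
  also have "\<dots> = (\<integral>\<^sup>+t. g t * indicator {0..<1} t \<partial>lborel)"
    using s by (intro nn_integral_cong) (auto simp: indicator_def)
  also have "\<dots> = (\<integral>\<^sup>+t. g t \<partial>unit_interval_measure)"
    by (rule nn_integral_unit_interval[symmetric]) measurable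
  finally show ?thesis .
qed

lemma unit_complex_circle_point:
  assumes "cmod u = 1" obtains s where "0 \<le> s" "s \<le> 1" "u = circle_point s"
proof -
  have "u \<noteq> 0" using assms by auto
  then have "u = cis (Arg2pi u)" using Arg2pi_eq[of u] assms by (simp add: cis_conv_exp)
  moreover have "0 \<le> Arg2pi u / (2 * pi)" "Arg2pi u / (2 * pi) \<le> 1"
    using Arg2pi_ge_0[of u] Arg2pi_lt_2pi[of u] by auto
  ultimately show ?thesis by (intro that[of "Arg2pi u / (2 * pi)"]) auto
qed

lemma nn_integral_circle_rotate:
  fixes f :: "complex \<Rightarrow> ennreal"
  assumes [measurable]: "f \<in> borel_measurable borel" and u: "cmod u = 1"
  shows "(\<integral>\<^sup>+t. f (u * circle_point t) \<partial>unit_interval_measure) = (\<integral>\<^sup>+t. f (circle_point t) \<partial>unit_interval_measure)"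
proof -
  obtain s where s: "0 \<le> s" "s \<le> 1" "u = circle_point s" using unit_complex_circle_point[OF u] by blast
  have "circle_point (t + 1) = circle_point t" for t
    by (simp add: ring_distribs complex_eq_iff)
  from nn_integral_periodic_shift[of "\<lambda>t. f (circle_point t)" s, OF _ _ s(1,2)] this
  have "(\<integral>\<^sup>+t. f (circle_point (t + s)) \<partial>unit_interval_measure) = (\<integral>\<^sup>+t. f (circle_point t) \<partial>unit_interval_measure)"
    by simp
  moreover have "u * circle_point t = circle_point (t + s)" for t
    by (simp add: s(3) cis_mult ring_distribs add.commute)
  ultimately show ?thesis by simp
qed

lemma uniform_circle_point_measurable[measurable]:
  "(\<lambda>t. z + of_real r * circle_point t) \<in> borel_measurable borel"
  by measurable

lemma
  shows sets_uniform_circle[simp, measurable_cong]: "sets (uniform_circle z r) = sets borel"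
    and space_uniform_circle[simp]: "space (uniform_circle z r) = UNIV"
  by (simp_all add: uniform_circle_def)

lemma prob_space_uniform_circle: "prob_space (uniform_circle z r)"
  unfolding uniform_circle_def by (intro prob_space.prob_space_distr prob_space_unit_interval) simp

lemma nn_integral_uniform_circle:
  assumes [measurable]: "f \<in> borel_measurable borel"
  shows "(\<integral>\<^sup>+x. f x \<partial>uniform_circle z r) = (\<integral>\<^sup>+t. f (z + of_real r * circle_point t) \<partial>unit_interval_measure)"
  unfolding uniform_circle_def by (subst nn_integral_distr) auto

lemma uniform_circle_isometry:
  assumes u: "cmod u = 1"
  shows "distr (uniform_circle z r) borel (\<lambda>x. u * x + b) = uniform_circle (u * z + b) r"
proof (rule measure_eqI)
  fix A :: "complex set" assume "A \<in> sets (distr (uniform_circle z r) borel (\<lambda>x. u * x + b))"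
  then have [measurable]: "A \<in> sets borel" by simp
  have "emeasure (distr (uniform_circle z r) borel (\<lambda>x. u * x + b)) A = (\<integral>\<^sup>+x. indicator A x \<partial>distr (uniform_circle z r) borel (\<lambda>x. u * x + b))"
    by simp
  also have "\<dots> = (\<integral>\<^sup>+x. indicator A (u * x + b) \<partial>uniform_circle z r)"
    by (rule nn_integral_distr) measurable
  also have "\<dots> = (\<integral>\<^sup>+t. indicator A (u * (z + of_real r * circle_point t) + b) \<partial>unit_interval_measure)"
    by (rule nn_integral_uniform_circle) measurable
  also have "\<dots> = (\<integral>\<^sup>+t. indicator A (u * z + b + of_real r * (u * circle_point t)) \<partial>unit_interval_measure)"
    by (simp add: algebra_simps)
  also have "\<dots> = (\<integral>\<^sup>+t. indicator A (u * z + b + of_real r * circle_point t) \<partial>unit_interval_measure)"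
    by (rule nn_integral_circle_rotate[of "\<lambda>y. indicator A (u * z + b + of_real r * y)", OF _ u]) measurable
  also have "\<dots> = (\<integral>\<^sup>+x. indicator A x \<partial>uniform_circle (u * z + b) r)"
    by (rule nn_integral_uniform_circle[symmetric]) measurable
  finally show "emeasure (distr (uniform_circle z r) borel (\<lambda>x. u * x + b)) A = emeasure (uniform_circle (u * z + b) r) A"
    by simp
qed simp

text \<open>It is used for the quarter turn of the lattice about its centre.\<close>

lemma mutual_log_energy_isometry:
  assumes u: "cmod u = 1"
  shows "mutual_log_energy (uniform_circle (u * z + b) r) (uniform_circle (u * w + b) s) =
    mutual_log_energy (uniform_circle z r) (uniform_circle w s)"
proof -
  let ?f = "\<lambda>x. u * x + b"
  have d: "dist (u * x) (u * y) = dist x y" for x y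
    using u by (simp add: dist_norm norm_mult flip: right_diff_distrib)
  have [measurable]: "(\<lambda>(x, y). (?f x, ?f y)) \<in> measurable (uniform_circle z r \<Otimes>\<^sub>M uniform_circle w s) (borel \<Otimes>\<^sub>M borel)"
    by measurable
  have "distr (uniform_circle z r) borel ?f \<Otimes>\<^sub>M distr (uniform_circle w s) borel ?f =
      distr (uniform_circle z r \<Otimes>\<^sub>M uniform_circle w s) (borel \<Otimes>\<^sub>M borel) (\<lambda>(x, y). (?f x, ?f y))"
    by (intro pair_measure_distr prob_space_imp_sigma_finite prob_space.prob_space_distr prob_space_uniform_circle) auto
  then show ?thesis
    unfolding mutual_log_energy_def uniform_circle_isometry[OF u]
    by (simp add: integral_distr split_beta d)
qed

text \<open>The integrand of the finite-energy condition in \<open>gff_test_measures\<close>. The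
  conversion to \<open>ennreal\<close> cuts the negative part off at 0, so points at distance at
  least 1 contribute nothing.\<close>

definition log_kernel :: "complex \<Rightarrow> complex \<Rightarrow> ennreal" where
  "log_kernel x y = (if x = y then \<top> else ennreal (- ln (dist x y)))"

lemma log_kernel_measurable[measurable (raw)]:
  assumes [measurable]: "f \<in> borel_measurable M" "g \<in> borel_measurable M"
  shows "(\<lambda>x. log_kernel (f x) (g x)) \<in> borel_measurable M"
  unfolding log_kernel_def by measurable

text \<open>In sin (2 y) = 2 sin y cos y with y <= pi/4, both sin y / y and cos y are at least sqrt
  2 / 2, the former by the mean value theorem. Their product is the constant 1/2.\<close>

lemma sin_ge_half:
  fixes x :: real assumes "0 \<le> x" "x \<le> pi / 2" shows "x / 2 \<le> sin x"
proof (cases "x = 0")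
  case False
  define y where "y = x / 2"
  have y: "0 < y" "y \<le> pi / 4" using assms False by (auto simp: y_def)
  obtain t where t: "0 < t" "t < y" "sin y - sin 0 = (y - 0) * cos t"
    using MVT2[of 0 y sin cos] y by (auto intro: DERIV_sin)
  have c: "cos (pi / 4) \<le> cos t" "cos (pi / 4) \<le> cos y"
    using t y by (auto intro!: cos_monotone_0_pi_le)
  have "0 < cos (pi / 4)" by (simp add: cos_45)
  then have c0: "0 < cos t" "0 < cos y" using c by linarith+
  have "y = 2 * (y * (sqrt 2 / 2)) * (sqrt 2 / 2)" by simp
  also have "\<dots> \<le> 2 * (y * cos t) * cos y"
    using c c0 y by (intro mult_mono) (auto simp: cos_45)
  also have "\<dots> = sin (2 * y)" using t by (simp add: sin_double)
  finally show ?thesis by (simp add: y_def)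
qed simp

text \<open>0, 1/2 and 1 are the zeros of sin (2 pi t) in [0, 1], and \<open>c\<close> is a nearest
  one. Near each zero the sine is at least pi times the distance, and pi is weakened to 1.\<close>

lemma abs_sin_circle_ge:
  assumes t: "0 \<le> t" "t \<le> 1"
  obtains c :: real where "c \<in> {0, 1/2, 1}" "\<bar>t - c\<bar> \<le> \<bar>sin (2 * pi * t)\<bar>"
proof -
  have pi1: "x \<le> pi * x" if "0 \<le> x" for x :: real using that pi_gt3 mult_right_mono[of 1 pi x] by simp
  consider "t \<le> 1/4" | "1/4 \<le> t" "t \<le> 1/2" | "1/2 \<le> t" "t \<le> 3/4" | "3/4 \<le> t" by linarith
  then show ?thesis
  proof cases
    case 1
    then have "pi * t \<le> sin (2 * pi * t)" using t sin_ge_half[of "2 * pi * t"] by simp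
    then show ?thesis using t pi1[of t] by (intro that[of 0]) auto
  next
    case 2
    then have "pi * (1/2 - t) \<le> sin (pi - 2 * pi * t)" using sin_ge_half[of "pi - 2 * pi * t"]
      by (simp add: field_simps)
    then show ?thesis using 2 pi1[of "1/2 - t"] by (intro that[of "1/2"]) auto
  next
    case 3
    then have "pi * (t - 1/2) \<le> sin (2 * pi * t - pi)" using sin_ge_half[of "2 * pi * t - pi"]
      by (simp add: field_simps)
    then show ?thesis using 3 pi1[of "t - 1/2"] by (intro that[of "1/2"]) (auto simp: sin_diff)
  next
    case 4
    then have "pi * (1 - t) \<le> sin (2 * pi - 2 * pi * t)" using t sin_ge_half[of "2 * pi - 2 * pi * t"]
      by (simp add: field_simps)
    then show ?thesis using t pi1[of "1 - t"] by (intro that[of 1]) (auto simp: sin_diff)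
  qed
qed

text \<open>An integrable majorant of the logarithmic singularity, from -ln d <= 2 d powr (-1/2).
  Summing over all three zeros of the sine avoids tracking which one is nearest to t.\<close>

definition log_circle_bound :: ennreal where
  "log_circle_bound = (\<Sum>c\<in>{0, 1/2, 1}. \<integral>\<^sup>+t. ennreal (2 * \<bar>t - c\<bar> powr (- 1/2)) * indicator {0..1} t \<partial>lborel)"

lemma log_circle_bound_finite: "log_circle_bound < \<top>"
proof -
  let ?f = "\<lambda>x::real. 2 * x powr (- 1/2) * indicator {0..1} x"
  have "((\<lambda>x::real. x powr (- 1/2)) has_integral (1 powr (- 1/2 + 1) / (- 1/2 + 1))) {0..1}"
    by (rule has_integral_powr_from_0) auto
  then have "((\<lambda>x::real. 2 * x powr (- 1/2)) has_integral 4) {0..1}"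
    using has_integral_mult_right[of "\<lambda>x::real. x powr (- 1/2)" 2 "{0..1}" 2] by simp
  then have "((\<lambda>x::real. if x \<in> {0..1} then 2 * x powr (- 1/2) else 0) has_integral 4) UNIV"
    by (subst has_integral_restrict_UNIV)
  then have "(?f has_integral 4) UNIV"
    by (rule has_integral_eq[rotated]) (simp add: indicator_def)
  then have four: "(\<integral>\<^sup>+x. ennreal (?f x) \<partial>lborel) = 4"
    by (subst nn_integral_has_integral_lborel) auto
  have fin: "(\<integral>\<^sup>+t. ennreal (2 * \<bar>t - c\<bar> powr (- 1/2)) * indicator {0..1} t \<partial>lborel) < \<top>" if c: "0 \<le> c" "c \<le> 1" for c :: real
  proof -
    have "(\<integral>\<^sup>+t. ennreal (2 * \<bar>t - c\<bar> powr (- 1/2)) * indicator {0..1} t \<partial>lborel) \<le> (\<integral>\<^sup>+t. ennreal (?f (- c + 1 * t)) + ennreal (?f (c + - 1 * t)) \<partial>lborel)"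
      using c by (intro nn_integral_mono) (auto simp: indicator_def abs_if simp flip: ennreal_plus)
    also have "\<dots> = (\<integral>\<^sup>+t. ennreal (?f (- c + 1 * t)) \<partial>lborel) + (\<integral>\<^sup>+t. ennreal (?f (c + - 1 * t)) \<partial>lborel)"
      by (rule nn_integral_add) auto
    also have "\<dots> = 4 + 4"
      using nn_integral_real_affine[of "\<lambda>x. ennreal (?f x)" 1 "- c"] nn_integral_real_affine[of "\<lambda>x. ennreal (?f x)" "- 1" c]
      unfolding four by simp
    also have "\<dots> < \<top>" by simp
    finally show ?thesis .
  qed
  have "\<forall>c\<in>{0, 1/2, 1}. (\<integral>\<^sup>+t. ennreal (2 * \<bar>t - c\<bar> powr (- 1/2)) * indicator {0..1} t \<partial>lborel) < \<top>"
    by (intro ballI fin) auto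
  then show ?thesis unfolding log_circle_bound_def
    by (subst ennreal_sum_less_top) blast+
qed

text \<open>The bound is uniform in \<open>x\<close>: a rotation moves \<open>x\<close> to the
  nonnegative real axis, and from there the distance to a point of the unit circle is at least the
  modulus of its imaginary part, \<open>\<bar>sin (2 * pi * t)\<bar>\<close>.\<close>

lemma log_kernel_circle_le:
  "(\<integral>\<^sup>+t. log_kernel x (circle_point t) \<partial>unit_interval_measure) \<le> log_circle_bound"
proof -
  define u where "u = (if x = 0 then 1 else cnj (sgn x))"
  have u: "cmod u = 1" by (auto simp: u_def norm_sgn)
  have ux: "u * x = of_real (cmod x)"
  proof (cases "x = 0")
    case False
    have "cnj x * x = of_real ((cmod x)\<^sup>2)" by (metis complex_norm_square mult.commute)
    then show ?thesis using False
      by (simp add: u_def sgn_div_norm scaleR_conv_of_real field_simps power2_eq_square)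
  qed (simp add: u_def)
  have rot: "log_kernel x y = log_kernel (u * x) (u * y)" for y
  proof -
    have "u \<noteq> 0" using u by auto
    moreover have "dist (u * x) (u * y) = dist x y" using u by (simp add: dist_norm norm_mult flip: right_diff_distrib)
    ultimately show ?thesis by (simp add: log_kernel_def)
  qed
  define r where "r = cmod x"
  have "(\<integral>\<^sup>+t. log_kernel x (circle_point t) \<partial>unit_interval_measure) = (\<integral>\<^sup>+t. log_kernel (of_real r) (u * circle_point t) \<partial>unit_interval_measure)"
    unfolding rot ux r_def ..
  also have "\<dots> = (\<integral>\<^sup>+t. log_kernel (of_real r) (circle_point t) \<partial>unit_interval_measure)"
    by (rule nn_integral_circle_rotate[OF _ u]) measurable
  also have "\<dots> = (\<integral>\<^sup>+t. log_kernel (of_real r) (circle_point t) * indicator {0..1} t \<partial>lborel)"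
    by (subst nn_integral_uniform_measure) (auto simp: divide_ennreal_def)
  also have "\<dots> \<le> (\<integral>\<^sup>+t. (\<Sum>c\<in>{0, 1/2, 1}. ennreal (2 * \<bar>t - c\<bar> powr (- 1/2)) * indicator {0..1} t) \<partial>lborel)"
  proof (rule nn_integral_mono_AE)
    show "AE t in lborel. log_kernel (of_real r) (circle_point t) * indicator {0..1} t \<le> (\<Sum>c\<in>{0, 1/2, 1}. ennreal (2 * \<bar>t - c\<bar> powr (- 1/2)) * indicator {0..1} t)"
      using AE_lborel_singleton[of 0] AE_lborel_singleton[of "1/2"] AE_lborel_singleton[of "1::real"]
    proof eventually_elim
      case (elim t)
      show ?case
      proof (cases "t \<in> {0..1}")
        case True
        then obtain c where c: "c \<in> {0, 1/2, 1}" "\<bar>t - c\<bar> \<le> \<bar>sin (2 * pi * t)\<bar>"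
          using abs_sin_circle_ge[of t] by auto
        have pos: "0 < \<bar>t - c\<bar>" using elim c(1) by auto
        have "\<bar>sin (2 * pi * t)\<bar> \<le> dist (of_real r) (circle_point t)"
          using abs_Im_le_cmod[of "of_real r - circle_point t"] by (simp add: dist_norm)
        with c pos have d: "\<bar>t - c\<bar> \<le> dist (of_real r) (circle_point t)" by simp
        then have "- ln (dist (of_real r) (circle_point t)) \<le> - ln \<bar>t - c\<bar>" using ln_mono[OF d pos] by simp
        also have "\<dots> = 2 * ln (\<bar>t - c\<bar> powr (- 1/2))" using pos by (simp add: ln_powr)
        also have "\<dots> \<le> 2 * \<bar>t - c\<bar> powr (- 1/2)" using pos by (intro mult_left_mono ln_bound) auto
        finally have "log_kernel (of_real r) (circle_point t) \<le> ennreal (2 * \<bar>t - c\<bar> powr (- 1/2))"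
          using d pos by (auto simp: log_kernel_def intro!: ennreal_leI)
        also have "\<dots> \<le> (\<Sum>c\<in>{0, 1/2, 1}. ennreal (2 * \<bar>t - c\<bar> powr (- 1/2)))"
          using c(1) by (intro member_le_sum) auto
        finally show ?thesis using True by simp
      qed simp
    qed
  qed
  also have "\<dots> = log_circle_bound"
    unfolding log_circle_bound_def by (rule nn_integral_sum) measurable
  finally show ?thesis .
qed

text \<open>Only an inequality, because the cut-off of the negative part does not commute with
  scaling.\<close>

lemma log_kernel_scale:
  assumes s: "0 < s"
  shows "log_kernel (of_real s * x) (of_real s * y) \<le> ennreal \<bar>ln s\<bar> + log_kernel x y"
proof (cases "x = y")
  case False
  have "dist (of_real s * x) (of_real s * y) = s * dist x y"
    using s by (simp add: dist_norm norm_mult flip: right_diff_distrib)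
  then have "- ln (dist (of_real s * x) (of_real s * y)) = - ln s - ln (dist x y)"
    using s False by (simp add: ln_mult)
  also have "\<dots> \<le> \<bar>ln s\<bar> + max 0 (- ln (dist x y))" by simp
  finally have "ennreal (- ln (dist (of_real s * x) (of_real s * y))) \<le> ennreal (\<bar>ln s\<bar> + max 0 (- ln (dist x y)))"
    by (rule ennreal_leI)
  also have "\<dots> = ennreal \<bar>ln s\<bar> + ennreal (- ln (dist x y))"
    by (subst ennreal_plus) (auto simp: max_def ennreal_neg)
  finally show ?thesis using False s by (simp add: log_kernel_def)
qed (simp add: log_kernel_def)

lemma log_kernel_uniform_circle_le:
  assumes s: "0 < s"
  shows "(\<integral>\<^sup>+y. log_kernel x y \<partial>uniform_circle w s) \<le> ennreal \<bar>ln s\<bar> + log_circle_bound"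
proof -
  have "(\<integral>\<^sup>+y. log_kernel x y \<partial>uniform_circle w s) = (\<integral>\<^sup>+t. log_kernel x (w + of_real s * circle_point t) \<partial>unit_interval_measure)"
    by (rule nn_integral_uniform_circle) measurable
  also have "\<dots> \<le> (\<integral>\<^sup>+t. ennreal \<bar>ln s\<bar> + log_kernel ((x - w) / of_real s) (circle_point t) \<partial>unit_interval_measure)"
  proof (rule nn_integral_mono)
    fix t
    have "log_kernel x (w + of_real s * circle_point t) = log_kernel (of_real s * ((x - w) / of_real s)) (of_real s * circle_point t)"
    proof -
      have "log_kernel (w + a) (w + b) = log_kernel a b" for a b by (simp add: log_kernel_def)
      from this[of "x - w" "of_real s * circle_point t"] show ?thesis using s by simp
    qed
    also have "\<dots> \<le> ennreal \<bar>ln s\<bar> + log_kernel ((x - w) / of_real s) (circle_point t)"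
      by (rule log_kernel_scale[OF s])
    finally show "log_kernel x (w + of_real s * circle_point t) \<le> ennreal \<bar>ln s\<bar> + log_kernel ((x - w) / of_real s) (circle_point t)" .
  qed
  also have "\<dots> = ennreal \<bar>ln s\<bar> + (\<integral>\<^sup>+t. log_kernel ((x - w) / of_real s) (circle_point t) \<partial>unit_interval_measure)"
    using prob_space.emeasure_space_1[OF prob_space_unit_interval] by (subst nn_integral_add) auto
  also have "\<dots> \<le> ennreal \<bar>ln s\<bar> + log_circle_bound"
    by (intro add_left_mono log_kernel_circle_le)
  finally show ?thesis .
qed

text \<open>The potential of a circle of positive radius is bounded on the whole plane, so its
  integral against any probability measure is finite.\<close>

lemma log_kernel_pair_finite:
  assumes s: "0 < s" and \<mu>: "prob_space \<mu>" "sets \<mu> = sets borel"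
  shows "(\<integral>\<^sup>+p. log_kernel (fst p) (snd p) \<partial>(\<mu> \<Otimes>\<^sub>M uniform_circle w s)) < \<top>"
proof -
  note [measurable_cong] = \<mu>(2)
  interpret C: prob_space "uniform_circle w s" by (rule prob_space_uniform_circle)
  interpret \<mu>: prob_space \<mu> by fact
  have "(\<integral>\<^sup>+p. log_kernel (fst p) (snd p) \<partial>(\<mu> \<Otimes>\<^sub>M uniform_circle w s)) = (\<integral>\<^sup>+x. \<integral>\<^sup>+y. log_kernel x y \<partial>uniform_circle w s \<partial>\<mu>)"
    by (subst C.nn_integral_fst[symmetric]) auto
  also have "\<dots> \<le> (\<integral>\<^sup>+x. ennreal \<bar>ln s\<bar> + log_circle_bound \<partial>\<mu>)"
    by (intro nn_integral_mono log_kernel_uniform_circle_le s)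
  also have "\<dots> = ennreal \<bar>ln s\<bar> + log_circle_bound" by (simp add: \<mu>.emeasure_space_1)
  also have "\<dots> < \<top>" using log_circle_bound_finite by simp
  finally show ?thesis .
qed

lemma uniform_circle_test_measure:
  assumes r: "0 < r" shows "uniform_circle z r \<in> gff_test_measures"
proof -
  interpret C: prob_space "uniform_circle z r" by (rule prob_space_uniform_circle)
  have "emeasure (uniform_circle z r) (- cball z r) = 0"
    unfolding uniform_circle_def using r
    by (subst emeasure_distr) (auto simp: vimage_def dist_norm norm_mult simp flip: emeasure_empty intro!: arg_cong2[where f=emeasure])
  then have "\<exists>K. compact K \<and> emeasure (uniform_circle z r) (- K) = 0" using compact_cball by blast
  then show ?thesis
    unfolding gff_test_measures_def using log_kernel_pair_finite[OF r C.prob_space_axioms, of z] C.finite_measure_axioms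
    by (simp add: log_kernel_def)
qed

section \<open>Logarithmic distances between points of two circles\<close>

lemma AE_circle_dist:
  "AE x in uniform_circle z r. dist z x = \<bar>r\<bar>"
  unfolding uniform_circle_def by (subst AE_distr_iff) (auto simp: dist_norm norm_mult)

text \<open>The kernel is infinite on the diagonal and has a finite integral, so the diagonal is
  null. This keeps the convention ln 0 = 0 out of the later estimates and of the scaling
  law.\<close>

lemma AE_pair_circle:
  assumes s: "0 < s"
  shows "AE p in uniform_circle z r \<Otimes>\<^sub>M uniform_circle w s. fst p \<noteq> snd p \<and> dist (fst p) (snd p) \<le> dist z w + \<bar>r\<bar> + s"
proof -
  interpret C: prob_space "uniform_circle w s" by (rule prob_space_uniform_circle)
  interpret D: prob_space "uniform_circle z r" by (rule prob_space_uniform_circle)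
  interpret P: pair_prob_space "uniform_circle z r" "uniform_circle w s" ..
  have 1: "AE p in uniform_circle z r \<Otimes>\<^sub>M uniform_circle w s. log_kernel (fst p) (snd p) \<noteq> \<infinity>"
    using log_kernel_pair_finite[OF s D.prob_space_axioms, of w] by (intro nn_integral_PInf_AE) auto
  have 2: "AE p in uniform_circle z r \<Otimes>\<^sub>M uniform_circle w s. dist z (fst p) = \<bar>r\<bar> \<and> dist w (snd p) = s"
  proof (rule P.AE_pair_measure)
    show "{p \<in> space (uniform_circle z r \<Otimes>\<^sub>M uniform_circle w s). dist z (fst p) = \<bar>r\<bar> \<and> dist w (snd p) = s}
        \<in> sets (uniform_circle z r \<Otimes>\<^sub>M uniform_circle w s)"
      by measurable
  next
    show "AE x in uniform_circle z r. AE y in uniform_circle w s. dist z (fst (x, y)) = \<bar>r\<bar> \<and> dist w (snd (x, y)) = s"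
      using AE_circle_dist[of z r] AE_circle_dist[of w s] s by (auto elim!: eventually_mono)
  qed
  from 1 2 show ?thesis
  proof eventually_elim
    case (elim p)
    have "dist (fst p) (snd p) \<le> dist (fst p) z + dist z w + dist w (snd p)"
      using dist_triangle[of "fst p" "snd p" z] dist_triangle[of z "snd p" w] by linarith
    then show ?case using elim by (auto simp: log_kernel_def dist_commute split: if_splits)
  qed
qed

lemma integrable_log_dist_circles:
  assumes s: "0 < s"
  shows "integrable (uniform_circle z r \<Otimes>\<^sub>M uniform_circle w s) (\<lambda>p. - ln (dist (fst p) (snd p)))"
proof (rule integrableI_bounded)
  interpret C: prob_space "uniform_circle w s" by (rule prob_space_uniform_circle)
  interpret D: prob_space "uniform_circle z r" by (rule prob_space_uniform_circle)
  interpret P: pair_prob_space "uniform_circle z r" "uniform_circle w s" ..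
  let ?P = "uniform_circle z r \<Otimes>\<^sub>M uniform_circle w s"
  define D where "D = dist z w + \<bar>r\<bar> + s"
  show "(\<lambda>p. - ln (dist (fst p) (snd p))) \<in> borel_measurable ?P" by measurable
  have "(\<integral>\<^sup>+p. ennreal (norm (- ln (dist (fst p) (snd p)))) \<partial>?P) \<le> (\<integral>\<^sup>+p. log_kernel (fst p) (snd p) + ennreal D \<partial>?P)"
  proof (rule nn_integral_mono_AE)
    show "AE p in ?P. ennreal (norm (- ln (dist (fst p) (snd p)))) \<le> log_kernel (fst p) (snd p) + ennreal D"
      using AE_pair_circle[OF s]
    proof eventually_elim
      case (elim p)
      define d where "d = dist (fst p) (snd p)"
      have d: "0 < d" "d \<le> D" using elim by (auto simp: d_def D_def)
      have "\<bar>ln d\<bar> \<le> max 0 (- ln d) + D" using ln_bound[OF d(1)] d by linarith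
      then have "ennreal \<bar>ln d\<bar> \<le> ennreal (max 0 (- ln d) + D)" by (rule ennreal_leI)
      also have "\<dots> = ennreal (- ln d) + ennreal D" using d by (subst ennreal_plus) (auto simp: max_def ennreal_neg)
      finally show ?case using elim by (simp add: log_kernel_def d_def)
    qed
  qed
  also have "\<dots> = (\<integral>\<^sup>+p. log_kernel (fst p) (snd p) \<partial>?P) + ennreal D"
    using P.emeasure_space_1 by (subst nn_integral_add) auto
  also have "\<dots> < \<infinity>" using log_kernel_pair_finite[OF s D.prob_space_axioms, of w] by simp
  finally show "(\<integral>\<^sup>+p. ennreal (norm (- ln (dist (fst p) (snd p)))) \<partial>?P) < \<infinity>" .
qed

lemma mutual_log_energy_ge:
  assumes s: "0 < s" and D: "dist z w + \<bar>r\<bar> + s \<le> D"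
  shows "- ln D \<le> mutual_log_energy (uniform_circle z r) (uniform_circle w s)"
proof -
  interpret C: prob_space "uniform_circle w s" by (rule prob_space_uniform_circle)
  interpret D: prob_space "uniform_circle z r" by (rule prob_space_uniform_circle)
  interpret P: pair_prob_space "uniform_circle z r" "uniform_circle w s" ..
  let ?P = "uniform_circle z r \<Otimes>\<^sub>M uniform_circle w s"
  have "(\<integral>p. - ln D \<partial>?P) \<le> (\<integral>p. - ln (dist (fst p) (snd p)) \<partial>?P)"
  proof (rule integral_mono_AE)
    show "AE p in ?P. - ln D \<le> - ln (dist (fst p) (snd p))"
      using AE_pair_circle[OF s]
    proof eventually_elim
      case (elim p)
      then have "dist (fst p) (snd p) \<le> D" "0 < dist (fst p) (snd p)" using D by auto
      from ln_mono[OF this] show ?case by simp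
    qed
  qed (use integrable_log_dist_circles[OF s] in auto)
  then show ?thesis using P.prob_space by (simp add: mutual_log_energy_def)
qed

lemma uniform_circle_scale:
  "uniform_circle (z + of_real r * w) (r * s) = distr (uniform_circle w s) borel (\<lambda>x. z + of_real r * x)"
  unfolding uniform_circle_def by (subst distr_distr[where N=borel and L=borel], measurable) (simp add: comp_def algebra_simps)

lemma mutual_log_energy_scale:
  assumes r: "0 < r" and s: "0 < s"
  shows "mutual_log_energy (uniform_circle (z + of_real r * v) (r * q)) (uniform_circle (z + of_real r * w) (r * s)) =
    - ln r + mutual_log_energy (uniform_circle v q) (uniform_circle w s)"
proof -
  interpret C: prob_space "uniform_circle w s" by (rule prob_space_uniform_circle)
  interpret D: prob_space "uniform_circle v q" by (rule prob_space_uniform_circle)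
  interpret P: pair_prob_space "uniform_circle v q" "uniform_circle w s" ..
  let ?P = "uniform_circle v q \<Otimes>\<^sub>M uniform_circle w s"
  let ?f = "\<lambda>x. z + of_real r * x"
  have [measurable]: "(\<lambda>(x, y). (?f x, ?f y)) \<in> measurable ?P (borel \<Otimes>\<^sub>M borel)"
    by measurable
  have d: "dist (of_real r * x) (of_real r * y) = r * dist x y" for x y :: complex
    using r by (simp add: dist_norm norm_mult flip: right_diff_distrib)
  have "distr (uniform_circle v q) borel ?f \<Otimes>\<^sub>M distr (uniform_circle w s) borel ?f =
      distr ?P (borel \<Otimes>\<^sub>M borel) (\<lambda>(x, y). (?f x, ?f y))"
    by (intro pair_measure_distr prob_space_imp_sigma_finite prob_space.prob_space_distr prob_space_uniform_circle) auto
  then have "mutual_log_energy (uniform_circle (z + of_real r * v) (r * q)) (uniform_circle (z + of_real r * w) (r * s)) =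
      (\<integral>p. - ln (r * dist (fst p) (snd p)) \<partial>?P)"
    unfolding mutual_log_energy_def uniform_circle_scale by (simp add: integral_distr split_beta d)
  also have "\<dots> = (\<integral>p. - ln r + - ln (dist (fst p) (snd p)) \<partial>?P)"
  proof (rule integral_cong_AE)
    show "AE p in ?P. - ln (r * dist (fst p) (snd p)) = - ln r + - ln (dist (fst p) (snd p))"
      using AE_pair_circle[OF s] by eventually_elim (use r in \<open>simp add: ln_mult\<close>)
  qed auto
  also have "\<dots> = - ln r + mutual_log_energy (uniform_circle v q) (uniform_circle w s)"
    using integrable_log_dist_circles[OF s] P.prob_space unfolding mutual_log_energy_def
    by (subst Bochner_Integration.integral_add) auto
  finally show ?thesis .
qed

section \<open>Circle averages of the whole-plane Gaussian free field\<close>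

lemma (in prob_space) centered_gaussian_char:
  assumes "centered_gaussian M X v"
  shows "(\<integral>\<omega>. cis (t * X \<omega>) \<partial>M) = of_real (exp (- (t\<^sup>2 * v) / 2))"
proof -
  have [measurable]: "X \<in> borel_measurable M" using assms by (simp add: centered_gaussian_def)
  show ?thesis
  proof (cases "v = 0")
    case True
    then have "AE \<omega> in M. X \<omega> = 0" using assms by (auto simp: centered_gaussian_def)
    then have "(\<integral>\<omega>. cis (t * X \<omega>) \<partial>M) = (\<integral>\<omega>. 1 \<partial>M)"
      by (intro integral_cong_AE) (auto elim!: eventually_mono)
    then show ?thesis using True by (simp add: prob_space)
  next
    case False
    then have v: "v > 0" and D: "distributed M lborel X (normal_density 0 (sqrt v))"
      using assms by (auto simp: centered_gaussian_def)
    define \<sigma> where "\<sigma> = sqrt v"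
    have \<sigma>: "0 < \<sigma>" "\<sigma>\<^sup>2 = v" using v by (auto simp: \<sigma>_def)
    have "(\<integral>\<omega>. cis (t * X \<omega>) \<partial>M) = (\<integral>x. cis (t * x) \<partial>distr M lborel X)"
      by (subst integral_distr) auto
    also have "\<dots> = (\<integral>x. normal_density 0 \<sigma> x *\<^sub>R cis (t * x) \<partial>lborel)"
      unfolding distributed_distr_eq_density[OF D] \<sigma>_def by (subst integral_density) auto
    also have "\<dots> = \<bar>\<sigma>\<bar> *\<^sub>R (\<integral>x. normal_density 0 \<sigma> (0 + \<sigma> * x) *\<^sub>R cis (t * (0 + \<sigma> * x)) \<partial>lborel)"
      using \<sigma> by (intro lborel_integral_real_affine) auto
    also have "\<dots> = (\<integral>x. \<sigma> *\<^sub>R (normal_density 0 \<sigma> (0 + \<sigma> * x) *\<^sub>R cis (t * (0 + \<sigma> * x))) \<partial>lborel)"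
      using \<sigma> by (simp del: scaleR_scaleR)
    also have "\<dots> = (\<integral>x. std_normal_density x *\<^sub>R cis ((t * \<sigma>) * x) \<partial>lborel)"
      using \<sigma>(1) by (intro Bochner_Integration.integral_cong refl)
        (simp add: normal_density_def power_mult_distrib real_sqrt_mult mult.assoc)
    also have "\<dots> = char std_normal_distribution (t * \<sigma>)"
      unfolding char_def by (subst integral_density) (auto simp: cis_conv_exp)
    also have "\<dots> = of_real (exp (- (t\<^sup>2 * v) / 2))"
      using \<sigma> by (simp add: char_std_normal_distribution power_mult_distrib)
    finally show ?thesis .
  qed
qed

lemma (in prob_space) centered_gaussian_mgf:
  assumes "centered_gaussian M X v"
  shows "(\<integral>\<^sup>+\<omega>. ennreal (exp (t * X \<omega>)) \<partial>M) = ennreal (exp (t\<^sup>2 * v / 2))"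
proof -
  have [measurable]: "X \<in> borel_measurable M" using assms by (simp add: centered_gaussian_def)
  show ?thesis
  proof (cases "v = 0")
    case True
    then have "AE \<omega> in M. X \<omega> = 0" using assms by (auto simp: centered_gaussian_def)
    then have "(\<integral>\<^sup>+\<omega>. ennreal (exp (t * X \<omega>)) \<partial>M) = (\<integral>\<^sup>+\<omega>. 1 \<partial>M)"
      by (intro nn_integral_cong_AE) (auto elim!: eventually_mono)
    then show ?thesis using True by (simp add: emeasure_space_1)
  next
    case False
    then have v: "v > 0" and D: "distributed M lborel X (normal_density 0 (sqrt v))"
      using assms by (auto simp: centered_gaussian_def)
    have e: "normal_density 0 (sqrt v) x * exp (t * x) = exp (t\<^sup>2 * v / 2) * normal_density (t * v) (sqrt v) x" for x
    proof -
      have "- x\<^sup>2 / (2 * v) + t * x = t\<^sup>2 * v / 2 + - (x - t * v)\<^sup>2 / (2 * v)"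
        using v by (simp add: field_simps power2_eq_square)
      then show ?thesis using v by (simp add: normal_density_def mult_exp_exp)
    qed
    have "(\<integral>\<^sup>+\<omega>. ennreal (exp (t * X \<omega>)) \<partial>M) = (\<integral>\<^sup>+x. ennreal (normal_density 0 (sqrt v) x) * ennreal (exp (t * x)) \<partial>lborel)"
      by (rule distributed_nn_integral[OF D, symmetric]) measurable
    also have "\<dots> = (\<integral>\<^sup>+x. ennreal (exp (t\<^sup>2 * v / 2)) * ennreal (normal_density (t * v) (sqrt v) x) \<partial>lborel)"
      by (intro nn_integral_cong) (simp add: e flip: ennreal_mult)
    also have "\<dots> = ennreal (exp (t\<^sup>2 * v / 2)) * (\<integral>\<^sup>+x. ennreal (normal_density (t * v) (sqrt v) x) \<partial>lborel)"
      by (rule nn_integral_cmult) measurable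
    also have "(\<integral>\<^sup>+x. ennreal (normal_density (t * v) (sqrt v) x) \<partial>lborel) = 1"
      using v by (subst nn_integral_eq_integral) auto
    finally show ?thesis by simp
  qed
qed

lemma (in prob_space) exp_Markov:
  assumes [measurable]: "X \<in> borel_measurable M" and le: "(\<integral>\<^sup>+\<omega>. ennreal (exp (t * X \<omega>)) \<partial>M) \<le> ennreal c" and "0 \<le> c" "0 \<le> t"
  shows "prob {\<omega> \<in> space M. a \<le> X \<omega>} \<le> c * exp (- t * a)"
proof -
  have "emeasure M {\<omega> \<in> space M. a \<le> X \<omega>} = (\<integral>\<^sup>+\<omega>. indicator {\<omega> \<in> space M. a \<le> X \<omega>} \<omega> \<partial>M)"
    by simp
  also have "\<dots> \<le> (\<integral>\<^sup>+\<omega>. ennreal (exp (- t * a)) * ennreal (exp (t * X \<omega>)) \<partial>M)"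
  proof (rule nn_integral_mono)
    fix \<omega>
    have "1 \<le> exp (t * (X \<omega> - a))" if "a \<le> X \<omega>" using that \<open>0 \<le> t\<close> by simp
    then show "indicator {\<omega> \<in> space M. a \<le> X \<omega>} \<omega> \<le> ennreal (exp (- t * a)) * ennreal (exp (t * X \<omega>))"
      by (auto simp: indicator_def mult_exp_exp right_diff_distrib simp flip: ennreal_mult)
  qed
  also have "\<dots> = ennreal (exp (- t * a)) * (\<integral>\<^sup>+\<omega>. ennreal (exp (t * X \<omega>)) \<partial>M)"
    by (rule nn_integral_cmult) measurable
  also have "\<dots> \<le> ennreal (exp (- t * a)) * ennreal c" by (intro mult_left_mono le) simp
  finally show ?thesis
    using \<open>0 \<le> c\<close> by (simp add: emeasure_eq_measure mult.commute flip: ennreal_mult)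
qed

section \<open>Energies between circles and moments of circle averages\<close>

abbreviation circle_energy :: "complex \<Rightarrow> real \<Rightarrow> complex \<Rightarrow> real \<Rightarrow> real" where
  "circle_energy z r w s \<equiv> mutual_log_energy (uniform_circle z r) (uniform_circle w s)"

lemma circle_energy_commute: "circle_energy z r w s = circle_energy w s z r"
proof -
  interpret C: prob_space "uniform_circle w s" by (rule prob_space_uniform_circle)
  interpret D: prob_space "uniform_circle z r" by (rule prob_space_uniform_circle)
  interpret P: pair_prob_space "uniform_circle z r" "uniform_circle w s" ..
  let ?f = "\<lambda>p :: complex \<times> complex. - ln (dist (fst p) (snd p))"
  have "integral\<^sup>L (uniform_circle w s \<Otimes>\<^sub>M uniform_circle z r) (\<lambda>(x, y). ?f (y, x)) = integral\<^sup>L (uniform_circle z r \<Otimes>\<^sub>M uniform_circle w s) ?f"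
    by (rule P.integral_product_swap) measurable
  moreover have "(\<lambda>(x, y). ?f (y, x)) = ?f" by (auto simp: dist_commute)
  ultimately show ?thesis unfolding mutual_log_energy_def by (simp only:)
qed

lemma circle_energy_self:
  assumes "0 < r" shows "circle_energy z r z r = - ln r + circle_energy 0 1 0 1"
  using mutual_log_energy_scale[OF assms, of 1 z 0 1 0] by simp

text \<open>After scaling, these are unit circles with centres at distance 1, so their points are at
  most 1 + 1 + 1 = 3 apart. The term -ln r also occurs in the self-energies and cancels in the
  variance of a neighbour difference.\<close>

lemma circle_energy_neighbour:
  assumes "0 < r" "dist z w = r" shows "- ln r - ln 3 \<le> circle_energy z r w r"
proof -
  define u where "u = (w - z) / of_real r"
  have u: "cmod u = 1" "w = z + of_real r * u"
    using assms by (auto simp: u_def norm_divide dist_norm norm_minus_commute)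
  have "circle_energy z r w r = - ln r + circle_energy 0 1 u 1"
    using mutual_log_energy_scale[OF assms(1), of 1 z 0 1 u] u by simp
  moreover have "- ln 3 \<le> circle_energy 0 1 u 1"
    using u by (intro mutual_log_energy_ge) (auto simp: dist_norm)
  ultimately show ?thesis by simp
qed

context whole_plane_gff
begin

lemma measurable_circle[measurable]: "0 < r \<Longrightarrow> h (uniform_circle z r) \<in> borel_measurable M"
  by (intro measurable_pairing uniform_circle_test_measure)

text \<open>The locale speaks of sets of measures, whereas an indexed family may repeat one. The
  coefficients \<open>b\<close> collect all indices with the same measure.\<close>

lemma gaussian_combination:
  fixes \<mu> :: "'i \<Rightarrow> complex measure" and a :: "'i \<Rightarrow> real"
  assumes I: "finite I" and \<mu>: "\<And>i. i \<in> I \<Longrightarrow> \<mu> i \<in> gff_test_measures" and zero: "(\<Sum>i\<in>I. a i * measure (\<mu> i) UNIV) = 0"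
  shows "centered_gaussian M (\<lambda>\<omega>. \<Sum>i\<in>I. a i * h (\<mu> i) \<omega>) (\<Sum>i\<in>I. \<Sum>j\<in>I. a i * a j * mutual_log_energy (\<mu> i) (\<mu> j))"
proof -
  define b where "b \<nu> = (\<Sum>i\<in>{i. i \<in> I \<and> \<mu> i = \<nu>}. a i)" for \<nu>
  have regroup: "(\<Sum>i\<in>I. a i * H (\<mu> i)) = (\<Sum>\<nu>\<in>\<mu> ` I. b \<nu> * H \<nu>)" for H :: "complex measure \<Rightarrow> real"
  proof -
    have "(\<Sum>i\<in>I. a i * H (\<mu> i)) = (\<Sum>\<nu>\<in>\<mu> ` I. \<Sum>i\<in>{i. i \<in> I \<and> \<mu> i = \<nu>}. a i * H (\<mu> i))"
      by (rule sum.image_gen[OF I])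
    also have "\<dots> = (\<Sum>\<nu>\<in>\<mu> ` I. b \<nu> * H \<nu>)"
      unfolding b_def by (auto simp: sum_distrib_right intro!: sum.cong)
    finally show ?thesis .
  qed
  have "(\<Sum>i\<in>I. \<Sum>j\<in>I. a i * a j * mutual_log_energy (\<mu> i) (\<mu> j)) = (\<Sum>i\<in>I. a i * (\<Sum>j\<in>I. a j * mutual_log_energy (\<mu> i) (\<mu> j)))"
    by (simp add: sum_distrib_left mult.assoc)
  also have "\<dots> = (\<Sum>i\<in>I. a i * (\<Sum>\<nu>\<in>\<mu> ` I. b \<nu> * mutual_log_energy (\<mu> i) \<nu>))"
    by (simp only: regroup)
  also have "\<dots> = (\<Sum>\<mu>'\<in>\<mu> ` I. b \<mu>' * (\<Sum>\<nu>\<in>\<mu> ` I. b \<nu> * mutual_log_energy \<mu>' \<nu>))"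
    by (rule regroup)
  also have "\<dots> = (\<Sum>\<mu>'\<in>\<mu> ` I. \<Sum>\<nu>\<in>\<mu> ` I. b \<mu>' * b \<nu> * mutual_log_energy \<mu>' \<nu>)"
    by (simp add: sum_distrib_left mult.assoc)
  finally have "(\<Sum>i\<in>I. \<Sum>j\<in>I. a i * a j * mutual_log_energy (\<mu> i) (\<mu> j)) = (\<Sum>\<mu>'\<in>\<mu> ` I. \<Sum>\<nu>\<in>\<mu> ` I. b \<mu>' * b \<nu> * mutual_log_energy \<mu>' \<nu>)" .
  moreover have "centered_gaussian M (\<lambda>\<omega>. \<Sum>\<nu>\<in>\<mu> ` I. b \<nu> * h \<nu> \<omega>) (\<Sum>\<mu>'\<in>\<mu> ` I. \<Sum>\<nu>\<in>\<mu> ` I. b \<mu>' * b \<nu> * mutual_log_energy \<mu>' \<nu>)"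
    using I \<mu> zero by (intro gaussian_modulo_constant) (auto simp: regroup[symmetric])
  ultimately show ?thesis by (simp only: regroup[of "\<lambda>\<nu>. h \<nu> _"])
qed

lemma measure_uniform_circle_UNIV: "measure (uniform_circle z r) UNIV = 1"
  using prob_space.prob_space[OF prob_space_uniform_circle, of z r] by simp

text \<open>The covariance of the circle averages after subtraction of the average over the unit
  circle around \<open>c\<close>. With \<open>c\<close> the centre of the lattice square this is
  invariant under quarter turns of the lattice, unlike the field normalised at the corner 0; the
  difference is a single random constant.\<close>

definition relative_covariance :: "complex \<Rightarrow> ('i \<Rightarrow> complex) \<Rightarrow> real \<Rightarrow> 'i \<Rightarrow> 'i \<Rightarrow> real" where
  "relative_covariance c p r i j = circle_energy (p i) r (p j) r - circle_energy (p i) r c 1 - circle_energy (p j) r c 1 + circle_energy c 1 c 1"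

lemma gaussian_vector_relative_circles:
  assumes I: "finite I" and r: "0 < r"
  shows "gaussian_vector M I (\<lambda>i \<omega>. h (uniform_circle (p i) r) \<omega> - h (uniform_circle c 1) \<omega>) (relative_covariance c p r)"
  unfolding gaussian_vector_def
proof (intro conjI allI ballI)
  show "relative_covariance c p r i j = relative_covariance c p r j i" for i j
    by (simp add: relative_covariance_def circle_energy_commute[of "p i" r "p j"])
  show "(\<lambda>\<omega>. h (uniform_circle (p i) r) \<omega> - h (uniform_circle c 1) \<omega>) \<in> borel_measurable M" for i
    using r by measurable
  fix a :: "_ \<Rightarrow> real"
  \<comment> \<open>\<open>None\<close> stands for the reference circle, whose weight is minus the
    sum of the others, so that the total mass is zero.\<close>
  define \<mu> where "\<mu> k = (case k of None \<Rightarrow> uniform_circle c 1 | Some i \<Rightarrow> uniform_circle (p i) r)" for k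
  define s where "s = (\<Sum>i\<in>I. a i)"
  define b where "b k = (case k of None \<Rightarrow> - s | Some i \<Rightarrow> a i)" for k
  have sumI: "(\<Sum>k\<in>insert None (Some ` I). f k) = f None + (\<Sum>i\<in>I. f (Some i))" for f :: "_ option \<Rightarrow> real"
    using I by (subst sum.insert) (auto simp: sum.reindex)
  have "centered_gaussian M (\<lambda>\<omega>. \<Sum>k\<in>insert None (Some ` I). b k * h (\<mu> k) \<omega>)
     (\<Sum>k\<in>insert None (Some ` I). \<Sum>l\<in>insert None (Some ` I). b k * b l * mutual_log_energy (\<mu> k) (\<mu> l))"
  proof (rule gaussian_combination)
    show "\<mu> k \<in> gff_test_measures" for k
      using r by (auto simp: \<mu>_def intro!: uniform_circle_test_measure split: option.split)
    show "(\<Sum>k\<in>insert None (Some ` I). b k * measure (\<mu> k) UNIV) = 0"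
      unfolding sumI by (simp add: b_def \<mu>_def measure_uniform_circle_UNIV s_def)
  qed (use I in auto)
  also have "(\<lambda>\<omega>. \<Sum>k\<in>insert None (Some ` I). b k * h (\<mu> k) \<omega>) = (\<lambda>\<omega>. \<Sum>i\<in>I. a i * (h (uniform_circle (p i) r) \<omega> - h (uniform_circle c 1) \<omega>))"
    unfolding sumI by (simp add: b_def \<mu>_def s_def right_diff_distrib sum_subtractf sum_distrib_right)
  also have "(\<Sum>k\<in>insert None (Some ` I). \<Sum>l\<in>insert None (Some ` I). b k * b l * mutual_log_energy (\<mu> k) (\<mu> l)) =
      (\<Sum>i\<in>I. \<Sum>j\<in>I. a i * a j * relative_covariance c p r i j)"
  proof -
    define E where "E = (\<Sum>i\<in>I. a i * circle_energy (p i) r c 1)"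
    have "(\<Sum>i\<in>I. \<Sum>j\<in>I. a i * a j * relative_covariance c p r i j) = (\<Sum>i\<in>I. \<Sum>j\<in>I. a i * a j * circle_energy (p i) r (p j) r)
       - (\<Sum>i\<in>I. \<Sum>j\<in>I. (a i * circle_energy (p i) r c 1) * a j) - (\<Sum>i\<in>I. \<Sum>j\<in>I. a i * (a j * circle_energy (p j) r c 1))
       + (\<Sum>i\<in>I. \<Sum>j\<in>I. a i * a j) * circle_energy c 1 c 1"
      unfolding sum_distrib_right sum_subtractf[symmetric] sum.distrib[symmetric] relative_covariance_def
      by (intro sum.cong refl) (simp add: algebra_simps)
    also have "\<dots> = (\<Sum>i\<in>I. \<Sum>j\<in>I. a i * a j * circle_energy (p i) r (p j) r) - 2 * s * E + s * s * circle_energy c 1 c 1"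
      unfolding sum_product[symmetric] E_def[symmetric] s_def[symmetric] by simp
    finally have R: "(\<Sum>i\<in>I. \<Sum>j\<in>I. a i * a j * relative_covariance c p r i j) = (\<Sum>i\<in>I. \<Sum>j\<in>I. a i * a j * circle_energy (p i) r (p j) r) - 2 * s * E + s * s * circle_energy c 1 c 1" .
    have "(\<Sum>k\<in>insert None (Some ` I). \<Sum>l\<in>insert None (Some ` I). b k * b l * mutual_log_energy (\<mu> k) (\<mu> l)) =
      s * s * circle_energy c 1 c 1 + (\<Sum>i\<in>I. - s * a i * circle_energy c 1 (p i) r) + (\<Sum>i\<in>I. a i * - s * circle_energy (p i) r c 1)
      + (\<Sum>i\<in>I. \<Sum>j\<in>I. a i * a j * circle_energy (p i) r (p j) r)"
      unfolding sumI option.case b_def \<mu>_def sum.distrib by simp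
    also have "(\<Sum>i\<in>I. - s * a i * circle_energy c 1 (p i) r) = - s * E"
      unfolding E_def sum_distrib_left by (intro sum.cong refl) (simp add: circle_energy_commute[of c])
    also have "(\<Sum>i\<in>I. a i * - s * circle_energy (p i) r c 1) = - s * E"
      unfolding E_def sum_distrib_left by (intro sum.cong refl) simp
    finally show ?thesis unfolding R by simp
  qed
  finally show "(\<integral>\<omega>. cis (\<Sum>i\<in>I. a i * (h (uniform_circle (p i) r) \<omega> - h (uniform_circle c 1) \<omega>)) \<partial>M) =
      of_real (exp (- (\<Sum>i\<in>I. \<Sum>j\<in>I. a i * a j * relative_covariance c p r i j) / 2))"
    by (drule_tac centered_gaussian_char[where t=1]) simp
qed (use I prob_space_axioms in auto)

lemma mgf_circle_difference:
  assumes r: "0 < r" and s: "0 < s"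
    and v: "circle_energy z r z r - 2 * circle_energy z r w s + circle_energy w s w s \<le> v"
  shows "(\<integral>\<^sup>+\<omega>. ennreal (exp (t * (h (uniform_circle z r) \<omega> - h (uniform_circle w s) \<omega>))) \<partial>M) \<le> ennreal (exp (t\<^sup>2 * v / 2))"
proof -
  define \<mu> where "\<mu> k = (if k then uniform_circle z r else uniform_circle w s)" for k
  define b where "b k = (if k then 1 else -1 :: real)" for k
  have "centered_gaussian M (\<lambda>\<omega>. \<Sum>k\<in>UNIV. b k * h (\<mu> k) \<omega>) (\<Sum>k\<in>UNIV. \<Sum>l\<in>UNIV. b k * b l * mutual_log_energy (\<mu> k) (\<mu> l))"
  proof (rule gaussian_combination)
    show "\<mu> k \<in> gff_test_measures" for k
      using r s by (auto simp: \<mu>_def intro!: uniform_circle_test_measure)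
  qed (auto simp: UNIV_bool b_def \<mu>_def measure_uniform_circle_UNIV)
  then have "(\<integral>\<^sup>+\<omega>. ennreal (exp (t * (h (uniform_circle z r) \<omega> - h (uniform_circle w s) \<omega>))) \<partial>M) =
     ennreal (exp (t\<^sup>2 * (circle_energy z r z r - 2 * circle_energy z r w s + circle_energy w s w s) / 2))"
    by (drule_tac centered_gaussian_mgf[where t=t]) (simp add: UNIV_bool b_def \<mu>_def circle_energy_commute[of w s z] algebra_simps)
  also have "\<dots> \<le> ennreal (exp (t\<^sup>2 * v / 2))"
    using v by (intro ennreal_leI) (simp add: mult_left_mono)
  finally show ?thesis .
qed

text \<open>Subtracting the normalising average, almost surely zero, makes the total mass zero. The
  4 bounds the distance between points of the two circles, 2 + 1 + 1.\<close>

lemma mgf_circle_average: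
  assumes r: "0 < r" "r \<le> 1" and z: "cmod z \<le> 2"
  shows "(\<integral>\<^sup>+\<omega>. ennreal (exp (t * h (uniform_circle z r) \<omega>)) \<partial>M) \<le>
    ennreal (exp (t\<^sup>2 * (- ln r + 2 * circle_energy 0 1 0 1 + 2 * ln 4) / 2))"
proof -
  have "(\<integral>\<^sup>+\<omega>. ennreal (exp (t * h (uniform_circle z r) \<omega>)) \<partial>M) =
    (\<integral>\<^sup>+\<omega>. ennreal (exp (t * (h (uniform_circle z r) \<omega> - h (uniform_circle 0 1) \<omega>))) \<partial>M)"
    using normalized by (intro nn_integral_cong_AE) (auto elim!: eventually_mono)
  also have "\<dots> \<le> ennreal (exp (t\<^sup>2 * (- ln r + 2 * circle_energy 0 1 0 1 + 2 * ln 4) / 2))"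
  proof (rule mgf_circle_difference)
    have "- ln 4 \<le> circle_energy z r 0 1"
      using r z by (intro mutual_log_energy_ge) (auto simp: dist_norm)
    then show "circle_energy z r z r - 2 * circle_energy z r 0 1 + circle_energy 0 1 0 1 \<le> - ln r + 2 * circle_energy 0 1 0 1 + 2 * ln 4"
      using circle_energy_self[OF r(1), of z] by simp
  qed (use r in auto)
  finally show ?thesis .
qed

lemma mgf_neighbour_difference:
  assumes r: "0 < r" and zw: "dist z w = r"
  shows "(\<integral>\<^sup>+\<omega>. ennreal (exp (t * (h (uniform_circle z r) \<omega> - h (uniform_circle w r) \<omega>))) \<partial>M) \<le>
    ennreal (exp (t\<^sup>2 * (2 * circle_energy 0 1 0 1 + 2 * ln 3) / 2))"
  by (rule mgf_circle_difference)
    (use r circle_energy_self[OF r] circle_energy_neighbour[OF r zw] in auto)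

lemma mgf_centre:
  assumes z: "cmod z \<le> 2"
  shows "(\<integral>\<^sup>+\<omega>. ennreal (exp (t * h (uniform_circle z 1) \<omega>)) \<partial>M) \<le>
    ennreal (exp (t\<^sup>2 * (2 * circle_energy 0 1 0 1 + 2 * ln 4) / 2))"
  using mgf_circle_average[of 1 z t] z by simp

lemma relative_variance_le:
  assumes r: "0 < r" "r \<le> 1" and d: "dist (p i) c \<le> 2"
  shows "relative_covariance c p r i i \<le> - ln r + 2 * circle_energy 0 1 0 1 + 2 * ln 4"
proof -
  have "- ln 4 \<le> circle_energy (p i) r c 1"
    using r d by (intro mutual_log_energy_ge) auto
  then show ?thesis
    unfolding relative_covariance_def using circle_energy_self[OF r(1), of "p i"] circle_energy_self[of 1 c] by simp
qed

lemma relative_covariance_rotate: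
  assumes u: "cmod u = 1" and c: "u * c + b = c"
  shows "relative_covariance c (\<lambda>i. u * p i + b) r = relative_covariance c p r"
proof (intro ext)
  fix i j
  have "circle_energy (u * p k + b) r c 1 = circle_energy (p k) r c 1" for k
    using mutual_log_energy_isometry[OF u, of "p k" b r c 1] by (simp add: c)
  then show "relative_covariance c (\<lambda>i. u * p i + b) r i j = relative_covariance c p r i j"
    by (simp add: relative_covariance_def mutual_log_energy_isometry[OF u])
qed

end

section \<open>Lattice paths and geodesics\<close>

definition lattice_point :: "real \<Rightarrow> nat \<times> nat \<Rightarrow> complex" where
  "lattice_point \<epsilon> p = Complex (\<epsilon> * real (fst p)) (\<epsilon> * real (snd p))"

text \<open>As 1/\<epsilon> need not be an integer, the lattice fills only the square of side
  \<epsilon> \<open>mesh_count \<epsilon>\<close>, whose centre is the centre of rotation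
  below.\<close>

definition mesh_count :: "real \<Rightarrow> nat" where
  "mesh_count \<epsilon> = nat \<lfloor>1 / \<epsilon>\<rfloor>"

lemma mesh_count_iff:
  assumes "0 < \<epsilon>" shows "m \<le> mesh_count \<epsilon> \<longleftrightarrow> \<epsilon> * real m \<le> 1"
proof -
  have "m \<le> mesh_count \<epsilon> \<longleftrightarrow> real m \<le> 1 / \<epsilon>"
    using assms by (simp add: mesh_count_def le_nat_iff le_floor_iff)
  then show ?thesis using assms by (simp add: field_simps)
qed

lemma square_lattice_eq:
  assumes e: "0 < \<epsilon>" shows "square_lattice \<epsilon> = lattice_point \<epsilon> ` grid (mesh_count \<epsilon>)"
proof (intro equalityI subsetI)
  fix z assume "z \<in> square_lattice \<epsilon>"
  then obtain m n :: int where z: "z = Complex (\<epsilon> * of_int m) (\<epsilon> * of_int n)"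
    and "Re z \<in> {0..1}" "Im z \<in> {0..1}"
    unfolding square_lattice_def by blast
  then have r: "0 \<le> \<epsilon> * of_int m" "\<epsilon> * of_int m \<le> 1" "0 \<le> \<epsilon> * of_int n" "\<epsilon> * of_int n \<le> 1" by auto
  have mn: "0 \<le> m" "0 \<le> n" using r(1,3) e by (auto simp: zero_le_mult_iff)
  then have "z = lattice_point \<epsilon> (nat m, nat n)" by (simp add: z lattice_point_def)
  moreover have "(nat m, nat n) \<in> grid (mesh_count \<epsilon>)"
    using mn r e by (simp add: grid_def mesh_count_iff)
  ultimately show "z \<in> lattice_point \<epsilon> ` grid (mesh_count \<epsilon>)" by blast
next
  fix z assume "z \<in> lattice_point \<epsilon> ` grid (mesh_count \<epsilon>)"
  then obtain x y where z: "z = Complex (\<epsilon> * of_int (int x)) (\<epsilon> * of_int (int y))" "\<epsilon> * real x \<le> 1" "\<epsilon> * real y \<le> 1"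
    using e by (auto simp: lattice_point_def grid_def mesh_count_iff)
  then show "z \<in> square_lattice \<epsilon>" using e unfolding square_lattice_def
    by (intro IntI CollectI exI[of _ "int x"] exI[of _ "int y"] conjI) auto
qed

lemma lattice_point_inj: "0 < \<epsilon> \<Longrightarrow> inj (lattice_point \<epsilon>)"
  by (auto simp: inj_def lattice_point_def)

lemma finite_grid[simp]: "finite (grid n)" by (simp add: grid_def)

lemma finite_square_lattice: "0 < \<epsilon> \<Longrightarrow> finite (square_lattice \<epsilon>)"
  by (simp add: square_lattice_eq)

lemma card_square_lattice_le:
  assumes e: "0 < \<epsilon>" "\<epsilon> \<le> 1" shows "real (card (square_lattice \<epsilon>)) \<le> 4 * \<epsilon> powr (- 2)"
proof -
  have "card (square_lattice \<epsilon>) = (mesh_count \<epsilon> + 1)\<^sup>2"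
    using lattice_point_inj[OF e(1)]
    by (simp add: square_lattice_eq[OF e(1)] card_image inj_on_subset grid_def power2_eq_square)
  moreover have "real (mesh_count \<epsilon>) + 1 \<le> 2 / \<epsilon>"
  proof -
    have "real (mesh_count \<epsilon>) \<le> 1 / \<epsilon>" using mesh_count_iff[OF e(1), of "mesh_count \<epsilon>"] e by (simp add: field_simps)
    moreover have "1 \<le> 1 / \<epsilon>" using e by simp
    ultimately show ?thesis by linarith
  qed
  ultimately have "real (card (square_lattice \<epsilon>)) \<le> (2 / \<epsilon>)\<^sup>2"
    by (simp add: power_mono)
  also have "\<dots> = 4 * \<epsilon> powr (- 2)"
    using e by (simp add: powr_minus power_divide divide_inverse powr_numeral power_inverse)
  finally show ?thesis .
qed

lemma cmod_square_lattice: assumes "z \<in> square_lattice \<epsilon>" shows "cmod z \<le> 2"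
  using assms cmod_le[of z] by (auto simp: square_lattice_def)

lemma left_boundary_point:
  assumes e: "0 < \<epsilon>" and y: "(0, y) \<in> grid (mesh_count \<epsilon>)" shows "lattice_point \<epsilon> (0, y) \<in> left_boundary \<epsilon>"
proof -
  have "lattice_point \<epsilon> (0, y) - of_real \<epsilon> \<notin> square_lattice \<epsilon>"
    using e by (auto simp: square_lattice_def lattice_point_def)
  then show ?thesis using y e by (auto simp: left_boundary_def square_lattice_eq)
qed

lemma right_boundary_point:
  assumes e: "0 < \<epsilon>" and y: "(mesh_count \<epsilon>, y) \<in> grid (mesh_count \<epsilon>)"
  shows "lattice_point \<epsilon> (mesh_count \<epsilon>, y) \<in> right_boundary \<epsilon>"
proof -
  have "\<not> \<epsilon> * real (Suc (mesh_count \<epsilon>)) \<le> 1"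
    using mesh_count_iff[OF e, of "Suc (mesh_count \<epsilon>)"] by simp
  then have "lattice_point \<epsilon> (mesh_count \<epsilon>, y) + of_real \<epsilon> \<notin> square_lattice \<epsilon>"
    by (auto simp: square_lattice_def lattice_point_def distrib_left)
  then show ?thesis using y e by (auto simp: right_boundary_def square_lattice_eq)
qed

definition grid_adjacent :: "nat \<times> nat \<Rightarrow> nat \<times> nat \<Rightarrow> bool" where
  "grid_adjacent p q \<longleftrightarrow> fst p = fst q \<and> (snd p = Suc (snd q) \<or> snd q = Suc (snd p)) \<or>
     snd p = snd q \<and> (fst p = Suc (fst q) \<or> fst q = Suc (fst p))"

lemma grid_adjacent_dist:
  assumes "0 < \<epsilon>" "grid_adjacent p q" shows "dist (lattice_point \<epsilon> p) (lattice_point \<epsilon> q) = \<epsilon>"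
  using assms by (auto simp: grid_adjacent_def lattice_point_def dist_norm cmod_def distrib_left)

lemma path_of_rtranclp:
  assumes e: "0 < \<epsilon>" and S: "S \<subseteq> grid (mesh_count \<epsilon>)" and p: "p \<in> S"
    and r: "(\<lambda>p q. q \<in> S \<and> grid_adjacent p q)\<^sup>*\<^sup>* p q"
  shows "\<exists>P. lattice_path \<epsilon> P \<and> hd P = lattice_point \<epsilon> p \<and> last P = lattice_point \<epsilon> q \<and> set P \<subseteq> lattice_point \<epsilon> ` S"
  using r
proof induction
  case base
  have "lattice_path \<epsilon> [lattice_point \<epsilon> p]" using p S e by (auto simp: lattice_path_def square_lattice_eq)
  then show ?case using p by (intro exI[of _ "[lattice_point \<epsilon> p]"]) auto
next
  case (step y z)
  then obtain P where P: "lattice_path \<epsilon> P" "hd P = lattice_point \<epsilon> p" "last P = lattice_point \<epsilon> y" "set P \<subseteq> lattice_point \<epsilon> ` S" by blast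
  have "lattice_path \<epsilon> (P @ [lattice_point \<epsilon> z])"
    using P step.hyps S e grid_adjacent_dist[OF e, of y z]
    by (auto simp: lattice_path_def successively_append_iff square_lattice_eq)
  then show ?case using P step.hyps
    by (intro exI[of _ "P @ [lattice_point \<epsilon> z]"]) (auto simp: lattice_path_def)
qed

lemma crossing_of_crosses:
  assumes e: "0 < \<epsilon>" and S: "S \<subseteq> grid (mesh_count \<epsilon>)"
    and c: "crosses grid_adjacent S {p. fst p = 0} {p. fst p = mesh_count \<epsilon>}"
  shows "\<exists>P. crossing \<epsilon> P \<and> set P \<subseteq> lattice_point \<epsilon> ` S"
proof -
  obtain p q where p: "p \<in> S" "fst p = 0" and q: "fst q = mesh_count \<epsilon>" and r: "(\<lambda>p q. q \<in> S \<and> grid_adjacent p q)\<^sup>*\<^sup>* p q"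
    using c by (auto simp: crosses_def crosses_from_def)
  have "q \<in> S" using r p(1) by (auto elim: rtranclp.cases)
  then have g: "(0, snd p) \<in> grid (mesh_count \<epsilon>)" "(mesh_count \<epsilon>, snd q) \<in> grid (mesh_count \<epsilon>)"
    using p q S by (auto simp: grid_def)
  have "p = (0, snd p)" "q = (mesh_count \<epsilon>, snd q)" using p q by (auto simp: prod_eq_iff)
  then show ?thesis
    using path_of_rtranclp[OF e S p(1) r] left_boundary_point[OF e g(1)] right_boundary_point[OF e g(2)]
    unfolding crossing_def by metis
qed

lemma grid_connected:
  assumes "p \<in> grid n" "q \<in> grid n"
  shows "(\<lambda>p q. q \<in> grid n \<and> grid_adjacent p q)\<^sup>*\<^sup>* p q"
proof -
  let ?R = "\<lambda>p q. q \<in> grid n \<and> grid_adjacent p q"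
  have h: "?R\<^sup>*\<^sup>* (x, y) (0, y) \<and> ?R\<^sup>*\<^sup>* (0, y) (x, y)" if "x \<le> n" "y \<le> n" for x y
    using that
  proof (induction x)
    case (Suc x)
    have "?R (Suc x, y) (x, y)" "?R (x, y) (Suc x, y)" using Suc.prems by (auto simp: grid_def grid_adjacent_def)
    then show ?case using Suc by (auto intro: converse_rtranclp_into_rtranclp rtranclp.rtrancl_into_rtrancl)
  qed simp
  have v: "?R\<^sup>*\<^sup>* (0, y) (0, 0) \<and> ?R\<^sup>*\<^sup>* (0, 0) (0, y)" if "y \<le> n" for y
    using that
  proof (induction y)
    case (Suc y)
    have "?R (0, Suc y) (0, y)" "?R (0, y) (0, Suc y)" using Suc.prems by (auto simp: grid_def grid_adjacent_def)
    then show ?case using Suc by (auto intro: converse_rtranclp_into_rtranclp rtranclp.rtrancl_into_rtrancl)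
  qed simp
  have "?R\<^sup>*\<^sup>* p (0, 0) \<and> ?R\<^sup>*\<^sup>* (0, 0) p" if "p \<in> grid n" for p
    using h[of "fst p" "snd p"] v[of "snd p"] that by (auto simp: grid_def intro: rtranclp_trans)
  then show ?thesis using assms by (blast intro: rtranclp_trans)
qed

lemma lattice_connected:
  assumes e: "0 < \<epsilon>" and "z \<in> square_lattice \<epsilon>" "w \<in> square_lattice \<epsilon>"
  shows "\<exists>P. lattice_path \<epsilon> P \<and> hd P = z \<and> last P = w"
proof -
  obtain p q where "p \<in> grid (mesh_count \<epsilon>)" "q \<in> grid (mesh_count \<epsilon>)" "z = lattice_point \<epsilon> p" "w = lattice_point \<epsilon> q"
    using assms by (auto simp: square_lattice_eq)
  then show ?thesis
    using path_of_rtranclp[OF e subset_refl _ grid_connected] by blast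
qed

lemma crossing_exists:
  assumes e: "0 < \<epsilon>" shows "\<exists>P. crossing \<epsilon> P"
proof -
  have "crosses grid_adjacent (grid (mesh_count \<epsilon>)) {p. fst p = 0} {p. fst p = mesh_count \<epsilon>}"
    unfolding crosses_def crosses_from_def
    by (rule bexI[of _ "(mesh_count \<epsilon>, 0)"], rule bexI[of _ "(0, 0)"], rule grid_connected) (auto simp: grid_def)
  from crossing_of_crosses[OF e subset_refl this] show ?thesis by blast
qed

section \<open>Loop erasure, minimisers and their measurability\<close>

lemma lattice_path_remove_loop:
  assumes "lattice_path \<epsilon> (xs @ [v] @ ys @ [v] @ zs)" shows "lattice_path \<epsilon> (xs @ [v] @ zs)"
  using assms by (auto simp: lattice_path_def successively_append_iff successively_Cons split: if_splits)

lemma lfpp_length_append: "lfpp_length h \<xi> \<epsilon> \<omega> (P @ Q) = lfpp_length h \<xi> \<epsilon> \<omega> P + lfpp_length h \<xi> \<epsilon> \<omega> Q"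
  by (simp add: lfpp_length_def)

lemma lfpp_length_pos: "0 < \<epsilon> \<Longrightarrow> P \<noteq> [] \<Longrightarrow> 0 < lfpp_length h \<xi> \<epsilon> \<omega> P"
proof (induction P)
  case (Cons z P)
  then show ?case by (cases "P = []") (auto simp: lfpp_length_def intro: add_pos_pos)
qed simp

lemma lfpp_length_nonneg: "0 < \<epsilon> \<Longrightarrow> 0 \<le> lfpp_length h \<xi> \<epsilon> \<omega> P"
  by (cases "P = []") (auto simp: less_imp_le lfpp_length_pos, simp add: lfpp_length_def)

text \<open>Cutting out a loop keeps both endpoints and removes at least one vertex of positive
  weight. Hence simple crossings suffice for the infimum, and every minimiser is simple.\<close>

lemma crossing_remove_loop:
  assumes e: "0 < \<epsilon>" and P: "crossing \<epsilon> P" "\<not> distinct P"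
  shows "\<exists>Q. crossing \<epsilon> Q \<and> set Q \<subseteq> set P \<and> length Q < length P \<and> lfpp_length h \<xi> \<epsilon> \<omega> Q < lfpp_length h \<xi> \<epsilon> \<omega> P"
proof -
  obtain xs ys zs v where P': "P = xs @ [v] @ ys @ [v] @ zs" using not_distinct_decomp[OF P(2)] by blast
  define Q where "Q = xs @ [v] @ zs"
  have "hd Q = hd P" "last Q = last P" by (cases xs; simp add: Q_def P')+
  then have "crossing \<epsilon> Q" using P(1) lattice_path_remove_loop[of \<epsilon> xs v ys zs] unfolding crossing_def Q_def P' by simp
  moreover have "lfpp_length h \<xi> \<epsilon> \<omega> Q < lfpp_length h \<xi> \<epsilon> \<omega> P"
    using lfpp_length_pos[OF e, of "ys @ [v]" h \<xi> \<omega>] unfolding P' Q_def lfpp_length_append by simp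
  ultimately show ?thesis by (intro exI[of _ Q]) (auto simp: Q_def P')
qed

definition simple_crossings :: "real \<Rightarrow> complex list set" where
  "simple_crossings \<epsilon> = {P. crossing \<epsilon> P \<and> distinct P}"

lemma simple_crossing_below:
  assumes e: "0 < \<epsilon>" and "crossing \<epsilon> P"
  shows "\<exists>Q\<in>simple_crossings \<epsilon>. set Q \<subseteq> set P \<and> lfpp_length h \<xi> \<epsilon> \<omega> Q \<le> lfpp_length h \<xi> \<epsilon> \<omega> P"
  using assms(2)
proof (induction "length P" arbitrary: P rule: less_induct)
  case less
  show ?case
  proof (cases "distinct P")
    case True
    then show ?thesis using less.prems by (auto simp: simple_crossings_def)
  next
    case False
    from crossing_remove_loop[OF e less.prems False, of h \<xi> \<omega>] obtain Q where
      Q: "crossing \<epsilon> Q" "set Q \<subseteq> set P" "length Q < length P" "lfpp_length h \<xi> \<epsilon> \<omega> Q < lfpp_length h \<xi> \<epsilon> \<omega> P"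
      by blast
    from less.hyps[OF Q(3,1)] Q(2,4) show ?thesis by (meson less_imp_le order_trans)
  qed
qed

lemma finite_simple_paths: "0 < \<epsilon> \<Longrightarrow> finite {P. simple_lattice_path \<epsilon> P}"
  by (rule finite_subset[OF _ finite_lists_length_le[OF finite_square_lattice, of \<epsilon> "card (square_lattice \<epsilon>)"]])
    (auto simp: simple_lattice_path_def lattice_path_def distinct_card[symmetric] intro!: card_mono finite_square_lattice)

lemma simple_crossings_finite: "0 < \<epsilon> \<Longrightarrow> finite (simple_crossings \<epsilon>)"
  by (rule finite_subset[OF _ finite_simple_paths]) (auto simp: simple_crossings_def crossing_def simple_lattice_path_def)

definition lfpp_minimizers :: "(complex measure \<Rightarrow> 'a \<Rightarrow> real) \<Rightarrow> real \<Rightarrow> real \<Rightarrow> 'a \<Rightarrow> complex list set" where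
  "lfpp_minimizers h \<xi> \<epsilon> \<omega> = {P. crossing \<epsilon> P \<and> (\<forall>Q. crossing \<epsilon> Q \<longrightarrow> lfpp_length h \<xi> \<epsilon> \<omega> P \<le> lfpp_length h \<xi> \<epsilon> \<omega> Q)}"

lemma lfpp_minimizers_eq:
  assumes e: "0 < \<epsilon>"
  shows "lfpp_minimizers h \<xi> \<epsilon> \<omega> = {P \<in> simple_crossings \<epsilon>. \<forall>Q\<in>simple_crossings \<epsilon>. lfpp_length h \<xi> \<epsilon> \<omega> P \<le> lfpp_length h \<xi> \<epsilon> \<omega> Q}"
proof (intro equalityI subsetI)
  fix P assume P: "P \<in> lfpp_minimizers h \<xi> \<epsilon> \<omega>"
  then have "distinct P" using crossing_remove_loop[OF e, of P h \<xi> \<omega>] by (force simp: lfpp_minimizers_def)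
  then show "P \<in> {P \<in> simple_crossings \<epsilon>. \<forall>Q\<in>simple_crossings \<epsilon>. lfpp_length h \<xi> \<epsilon> \<omega> P \<le> lfpp_length h \<xi> \<epsilon> \<omega> Q}"
    using P by (auto simp: lfpp_minimizers_def simple_crossings_def)
next
  fix P assume P: "P \<in> {P \<in> simple_crossings \<epsilon>. \<forall>Q\<in>simple_crossings \<epsilon>. lfpp_length h \<xi> \<epsilon> \<omega> P \<le> lfpp_length h \<xi> \<epsilon> \<omega> Q}"
  have "lfpp_length h \<xi> \<epsilon> \<omega> P \<le> lfpp_length h \<xi> \<epsilon> \<omega> Q" if "crossing \<epsilon> Q" for Q
    using simple_crossing_below[OF e that, of h \<xi> \<omega>] P by force
  then show "P \<in> lfpp_minimizers h \<xi> \<epsilon> \<omega>" using P by (auto simp: lfpp_minimizers_def simple_crossings_def)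
qed

lemma lfpp_geodesic_minimizer:
  assumes e: "0 < \<epsilon>" shows "lfpp_geodesic h \<xi> \<epsilon> \<omega> \<in> lfpp_minimizers h \<xi> \<epsilon> \<omega>"
proof -
  have "simple_crossings \<epsilon> \<noteq> {}" using crossing_exists[OF e] simple_crossing_below[OF e, of _ h \<xi> \<omega>] by blast
  then obtain P where "P \<in> simple_crossings \<epsilon>" "\<forall>Q\<in>simple_crossings \<epsilon>. lfpp_length h \<xi> \<epsilon> \<omega> P \<le> lfpp_length h \<xi> \<epsilon> \<omega> Q"
    using ex_min_if_finite[of "lfpp_length h \<xi> \<epsilon> \<omega> ` simple_crossings \<epsilon>"] simple_crossings_finite[OF e]
    by (metis (no_types, lifting) arg_min_if_finite(1) arg_min_least)
  then have "\<exists>P. P \<in> lfpp_minimizers h \<xi> \<epsilon> \<omega>" by (auto simp: lfpp_minimizers_eq[OF e])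
  then show ?thesis
    unfolding lfpp_geodesic_def lfpp_minimizers_def mem_Collect_eq by (rule someI_ex)
qed

text \<open>Real infima are meaningful only for nonempty sets bounded below; connectedness of the
  lattice and positivity of the weights provide this for both nested infima.\<close>

lemma lfpp_set_dist_eq:
  assumes e: "0 < \<epsilon>"
  shows "lfpp_set_dist h \<xi> \<epsilon> \<omega> (left_boundary \<epsilon>) (right_boundary \<epsilon>) = lfpp_length h \<xi> \<epsilon> \<omega> (lfpp_geodesic h \<xi> \<epsilon> \<omega>)"
proof (rule antisym)
  define G where "G = lfpp_geodesic h \<xi> \<epsilon> \<omega>"
  have G: "crossing \<epsilon> G" "\<And>Q. crossing \<epsilon> Q \<Longrightarrow> lfpp_length h \<xi> \<epsilon> \<omega> G \<le> lfpp_length h \<xi> \<epsilon> \<omega> Q"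
    using lfpp_geodesic_minimizer[OF e, of h \<xi> \<omega>] by (auto simp: G_def lfpp_minimizers_def)
  let ?paths = "\<lambda>z w. {lfpp_length h \<xi> \<epsilon> \<omega> P |P. lattice_path \<epsilon> P \<and> hd P = z \<and> last P = w}"
  have sub: "left_boundary \<epsilon> \<subseteq> square_lattice \<epsilon>" "right_boundary \<epsilon> \<subseteq> square_lattice \<epsilon>"
    by (auto simp: left_boundary_def right_boundary_def)
  have ne: "?paths z w \<noteq> {}" if "z \<in> left_boundary \<epsilon>" "w \<in> right_boundary \<epsilon>" for z w
    using lattice_connected[OF e, of z w] that sub by blast
  have lower: "c \<le> lfpp_dist h \<xi> \<epsilon> \<omega> z w" if "z \<in> left_boundary \<epsilon>" "w \<in> right_boundary \<epsilon>"
    "\<And>P. crossing \<epsilon> P \<Longrightarrow> c \<le> lfpp_length h \<xi> \<epsilon> \<omega> P" for c z w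
    unfolding lfpp_dist_def using ne that by (intro cInf_greatest) (auto simp: crossing_def)
  have "lfpp_set_dist h \<xi> \<epsilon> \<omega> (left_boundary \<epsilon>) (right_boundary \<epsilon>) \<le> lfpp_dist h \<xi> \<epsilon> \<omega> (hd G) (last G)"
    unfolding lfpp_set_dist_def
  proof (rule cInf_lower)
    show "bdd_below {lfpp_dist h \<xi> \<epsilon> \<omega> z w |z w. z \<in> left_boundary \<epsilon> \<and> w \<in> right_boundary \<epsilon>}"
      by (intro bdd_belowI[of _ 0]) (auto intro!: lower lfpp_length_nonneg e)
  qed (use G(1) in \<open>auto simp: crossing_def\<close>)
  also have "\<dots> \<le> lfpp_length h \<xi> \<epsilon> \<omega> G"
    unfolding lfpp_dist_def
  proof (rule cInf_lower)
    show "bdd_below (?paths (hd G) (last G))"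
      using lfpp_length_nonneg[OF e] by (intro bdd_belowI[of _ 0]) auto
  qed (use G(1) in \<open>auto simp: crossing_def\<close>)
  finally show "lfpp_set_dist h \<xi> \<epsilon> \<omega> (left_boundary \<epsilon>) (right_boundary \<epsilon>) \<le> lfpp_length h \<xi> \<epsilon> \<omega> (lfpp_geodesic h \<xi> \<epsilon> \<omega>)"
    by (simp add: G_def)
  show "lfpp_length h \<xi> \<epsilon> \<omega> (lfpp_geodesic h \<xi> \<epsilon> \<omega>) \<le> lfpp_set_dist h \<xi> \<epsilon> \<omega> (left_boundary \<epsilon>) (right_boundary \<epsilon>)"
    unfolding lfpp_set_dist_def
  proof (rule cInf_greatest)
    show "{lfpp_dist h \<xi> \<epsilon> \<omega> z w |z w. z \<in> left_boundary \<epsilon> \<and> w \<in> right_boundary \<epsilon>} \<noteq> {}"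
      using G(1) by (auto simp: crossing_def)
  qed (use lower G(2) in \<open>auto simp: G_def[symmetric]\<close>)
qed

text \<open>A random subset of a finite index set takes finitely many values, each on an event, so
  any predicate of it defines an event. This serves both crossing events and properties of the set
  of minimisers.\<close>

lemma sets_Collect_finite_predicate:
  assumes I: "finite I" and R: "\<And>i. i \<in> I \<Longrightarrow> {\<omega> \<in> space M. R i \<omega>} \<in> sets M"
  shows "{\<omega> \<in> space M. C {i \<in> I. R i \<omega>}} \<in> sets M"
proof -
  have eq: "{\<omega> \<in> space M. {i \<in> I. R i \<omega>} = T} \<in> sets M" if "T \<subseteq> I" for T
  proof -
    have "{\<omega> \<in> space M. {i \<in> I. R i \<omega>} = T} = {\<omega> \<in> space M. \<forall>i\<in>I. R i \<omega> \<longleftrightarrow> i \<in> T}" using that by auto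
    also have "\<dots> \<in> sets M"
    proof (rule sets.sets_Collect_finite_All[OF _ I])
      fix i assume "i \<in> I"
      from R[OF this] show "{\<omega> \<in> space M. R i \<omega> \<longleftrightarrow> i \<in> T} \<in> sets M"
        by (cases "i \<in> T") (auto intro: sets.sets_Collect_neg)
    qed
    finally show ?thesis .
  qed
  have "{\<omega> \<in> space M. C {i \<in> I. R i \<omega>}} = (\<Union>T\<in>{T. T \<subseteq> I \<and> C T}. {\<omega> \<in> space M. {i \<in> I. R i \<omega>} = T})" by auto
  also have "\<dots> \<in> sets M" using I eq by (intro sets.finite_UN) auto
  finally show ?thesis .
qed

lemma lfpp_length_measurable:
  assumes "\<And>z. z \<in> set P \<Longrightarrow> h (uniform_circle z \<epsilon>) \<in> borel_measurable M"
  shows "(\<lambda>\<omega>. lfpp_length h \<xi> \<epsilon> \<omega> P) \<in> borel_measurable M"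
  using assms unfolding lfpp_length_def circle_average_def
proof (induction P)
  case (Cons z P)
  note [measurable] = Cons.prems[OF list.set_intros(1)]
  have [measurable]: "(\<lambda>\<omega>. \<Sum>z\<leftarrow>P. \<epsilon> * exp (\<xi> * h (uniform_circle z \<epsilon>) \<omega>)) \<in> borel_measurable M"
    using Cons by auto
  show ?case by simp
qed simp

lemma lfpp_minimizers_measurable:
  assumes e: "0 < \<epsilon>" and h: "\<And>z. h (uniform_circle z \<epsilon>) \<in> borel_measurable M"
  shows "{\<omega> \<in> space M. C (lfpp_minimizers h \<xi> \<epsilon> \<omega>)} \<in> sets M"
  unfolding lfpp_minimizers_eq[OF e]
proof (rule sets_Collect_finite_predicate[OF simple_crossings_finite[OF e]])
  note [measurable] = lfpp_length_measurable[where h=h and \<epsilon>=\<epsilon>, OF h]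
  fix P
  show "{\<omega> \<in> space M. \<forall>Q\<in>simple_crossings \<epsilon>. lfpp_length h \<xi> \<epsilon> \<omega> P \<le> lfpp_length h \<xi> \<epsilon> \<omega> Q} \<in> sets M"
    by (rule sets.sets_Collect_finite_All[OF _ simple_crossings_finite[OF e]]) measurable
qed

text \<open>The chosen path depends on \<omega> only through the set of minimisers, so
  \<open>C\<close> may be any property.\<close>

lemma lfpp_geodesic_length_measurable:
  assumes e: "0 < \<epsilon>" and h: "\<And>z. h (uniform_circle z \<epsilon>) \<in> borel_measurable M"
  shows "{\<omega> \<in> space M. C (lfpp_geodesic h \<xi> \<epsilon> \<omega>)} \<in> sets M"
proof -
  have "lfpp_geodesic h \<xi> \<epsilon> \<omega> = (SOME P. P \<in> lfpp_minimizers h \<xi> \<epsilon> \<omega>)" for \<omega>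
    by (simp add: lfpp_geodesic_def lfpp_minimizers_def)
  then show ?thesis using lfpp_minimizers_measurable[where h=h, OF e h, where C="\<lambda>S. C (SOME P. P \<in> S)"] by simp
qed

lemma lfpp_set_dist_measurable:
  assumes e: "0 < \<epsilon>" and h: "\<And>z. h (uniform_circle z \<epsilon>) \<in> borel_measurable M"
  shows "{\<omega> \<in> space M. lfpp_set_dist h \<xi> \<epsilon> \<omega> (left_boundary \<epsilon>) (right_boundary \<epsilon>) \<le> c} \<in> sets M"
proof -
  note [measurable] = lfpp_length_measurable[where h=h and \<epsilon>=\<epsilon>, OF h]
  have "{\<omega> \<in> space M. lfpp_set_dist h \<xi> \<epsilon> \<omega> (left_boundary \<epsilon>) (right_boundary \<epsilon>) \<le> c} =
     {\<omega> \<in> space M. \<exists>P\<in>simple_crossings \<epsilon>. lfpp_length h \<xi> \<epsilon> \<omega> P \<le> c}"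
  proof -
    have "lfpp_length h \<xi> \<epsilon> \<omega> (lfpp_geodesic h \<xi> \<epsilon> \<omega>) \<le> c \<longleftrightarrow> (\<exists>P\<in>simple_crossings \<epsilon>. lfpp_length h \<xi> \<epsilon> \<omega> P \<le> c)" for \<omega>
      using lfpp_geodesic_minimizer[OF e, of h \<xi> \<omega>] order_trans unfolding lfpp_minimizers_eq[OF e] by blast
    then show ?thesis by (simp add: lfpp_set_dist_eq[OF e])
  qed
  also have "\<dots> \<in> sets M"
    by (rule sets.sets_Collect_finite_Ex[OF _ simple_crossings_finite[OF e]]) measurable
  finally show ?thesis .
qed

abbreviation negative_moment :: "(complex measure \<Rightarrow> 'a \<Rightarrow> real) \<Rightarrow> real \<Rightarrow> real \<Rightarrow> 'a \<Rightarrow> real" where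
  "negative_moment h a \<epsilon> \<omega> \<equiv> (\<Sum>z\<in>square_lattice \<epsilon>. exp (- a * h (uniform_circle z \<epsilon>) \<omega>))"

text \<open>This is Jensen's inequality for \<open>x \<mapsto> x powr (- a / \<xi>)\<close>, obtained from the tangent at the mean \<open>m\<close>.\<close>

lemma simple_path_negative_moment:
  fixes h :: "complex measure \<Rightarrow> 'a \<Rightarrow> real"
  assumes e: "0 < \<epsilon>" and \<xi>: "0 < \<xi>" and a: "0 \<le> a" and P: "simple_lattice_path \<epsilon> P"
  shows "real (length P) * (lfpp_length h \<xi> \<epsilon> \<omega> P / (\<epsilon> * real (length P))) powr (- a / \<xi>) \<le>
    negative_moment h a \<epsilon> \<omega>"
proof -
  define f where "f z = h (uniform_circle z \<epsilon>) \<omega>" for z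
  define n where "n = real (length P)"
  define m where "m = (\<Sum>z\<in>set P. exp (\<xi> * f z)) / n"
  have dP: "distinct P" "P \<noteq> []" "set P \<subseteq> square_lattice \<epsilon>" using P by (auto simp: simple_lattice_path_def lattice_path_def)
  have n: "0 < n" "real (card (set P)) = n" using dP by (auto simp: n_def distinct_card)
  have "lfpp_length h \<xi> \<epsilon> \<omega> P = (\<Sum>z\<in>set P. \<epsilon> * exp (\<xi> * f z))"
    unfolding lfpp_length_def circle_average_def f_def by (rule sum_list_distinct_conv_sum_set[OF dP(1)])
  then have L: "lfpp_length h \<xi> \<epsilon> \<omega> P / (\<epsilon> * n) = m"
    using e by (simp add: m_def sum_distrib_left[symmetric])
  have m: "0 < m" unfolding m_def using dP n by (intro divide_pos_pos sum_pos) auto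
  \<comment> \<open>The tangent bound follows from ln x <= x - 1, multiplied by the nonnegative a /
    \<xi>, and exp u >= 1 + u. Summed over the path, the linear terms vanish because
    \<open>m\<close> is the mean.\<close>
  have "m powr (- a / \<xi>) * (1 - a / \<xi> * (exp (\<xi> * f z) / m - 1)) \<le> exp (- a * f z)" for z
  proof -
    have "\<xi> * f z - ln m \<le> exp (\<xi> * f z) / m - 1"
      using ln_le_minus_one[of "exp (\<xi> * f z) / m"] m by (simp add: ln_div)
    then have "a / \<xi> * (\<xi> * f z - ln m) \<le> a / \<xi> * (exp (\<xi> * f z) / m - 1)"
      using a \<xi> by (intro mult_left_mono) auto
    then have "1 - a / \<xi> * (exp (\<xi> * f z) / m - 1) \<le> 1 + - (a / \<xi> * (\<xi> * f z - ln m))" by simp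
    also have "\<dots> \<le> exp (- (a / \<xi> * (\<xi> * f z - ln m)))" by (rule exp_ge_add_one_self)
    finally have "m powr (- a / \<xi>) * (1 - a / \<xi> * (exp (\<xi> * f z) / m - 1)) \<le> m powr (- a / \<xi>) * exp (- (a / \<xi> * (\<xi> * f z - ln m)))"
      by (intro mult_left_mono) auto
    also have "\<dots> = exp (- a * f z)"
      using m \<xi> by (simp add: powr_def mult_exp_exp) (simp add: field_simps)
    finally show ?thesis .
  qed
  then have "(\<Sum>z\<in>set P. m powr (- a / \<xi>) * (1 - a / \<xi> * (exp (\<xi> * f z) / m - 1))) \<le> (\<Sum>z\<in>set P. exp (- a * f z))"
    by (intro sum_mono)
  moreover have "(\<Sum>z\<in>set P. m powr (- a / \<xi>) * (1 - a / \<xi> * (exp (\<xi> * f z) / m - 1))) = n * m powr (- a / \<xi>)"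
  proof -
    have zero: "(\<Sum>z\<in>set P. exp (\<xi> * f z) / m - 1) = 0"
    proof -
      have "(\<Sum>z\<in>set P. exp (\<xi> * f z)) = n * m" using n by (simp add: m_def)
      then show ?thesis using m n by (simp add: sum_subtractf sum_divide_distrib[symmetric])
    qed
    have lin: "(\<Sum>z\<in>set P. c * (1 - d * g z)) = c * (real (card (set P)) - d * (\<Sum>z\<in>set P. g z))" for c d and g :: "complex \<Rightarrow> real"
      by (simp add: sum_distrib_left[symmetric] sum_subtractf)
    show ?thesis
      unfolding lin zero using n by simp
  qed
  moreover have "(\<Sum>z\<in>set P. exp (- a * f z)) \<le> (\<Sum>z\<in>square_lattice \<epsilon>. exp (- a * f z))"
    using dP e by (intro sum_mono2 finite_square_lattice) auto
  ultimately show ?thesis unfolding L[symmetric] n_def f_def by simp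
qed

section \<open>Crossings with small field values\<close>

lemma (in prob_space) nonneg_Markov:
  assumes [measurable]: "Z \<in> borel_measurable M" and nn: "\<And>\<omega>. 0 \<le> Z \<omega>"
    and le: "(\<integral>\<^sup>+\<omega>. ennreal (Z \<omega>) \<partial>M) \<le> ennreal c" and "0 \<le> c" and b: "0 < b"
  shows "prob {\<omega> \<in> space M. b \<le> Z \<omega>} \<le> c / b"
proof -
  have "ennreal b * emeasure M {\<omega> \<in> space M. b \<le> Z \<omega>} = (\<integral>\<^sup>+\<omega>. ennreal b * indicator {\<omega> \<in> space M. b \<le> Z \<omega>} \<omega> \<partial>M)"
    by (simp add: nn_integral_cmult_indicator)
  also have "\<dots> \<le> (\<integral>\<^sup>+\<omega>. ennreal (Z \<omega>) \<partial>M)"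
    by (rule nn_integral_mono) (auto simp: indicator_def intro: ennreal_leI)
  also note le
  finally have "b * prob {\<omega> \<in> space M. b \<le> Z \<omega>} \<le> c"
    using b \<open>0 \<le> c\<close> by (simp add: emeasure_eq_measure flip: ennreal_mult)
  then show ?thesis using b by (simp add: field_simps)
qed

lemma gaussian_vector_uminus:
  assumes "gaussian_vector M I X K" shows "gaussian_vector M I (\<lambda>i \<omega>. - X i \<omega>) K"
  unfolding gaussian_vector_def
proof (intro conjI allI ballI)
  fix a
  have "(\<integral>\<omega>. cis (\<Sum>i\<in>I. (- a i) * X i \<omega>) \<partial>M) = of_real (exp (- (\<Sum>i\<in>I. \<Sum>j\<in>I. (- a i) * (- a j) * K i j) / 2))"
  proof -
    have "\<forall>a. (\<integral>\<omega>. cis (\<Sum>i\<in>I. a i * X i \<omega>) \<partial>M) = of_real (exp (- (\<Sum>i\<in>I. \<Sum>j\<in>I. a i * a j * K i j) / 2))"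
      using assms unfolding gaussian_vector_def by blast
    then show ?thesis by (rule spec[where x="\<lambda>i. - a i"])
  qed
  then show "(\<integral>\<omega>. cis (\<Sum>i\<in>I. a i * - X i \<omega>) \<partial>M) = of_real (exp (- (\<Sum>i\<in>I. \<Sum>j\<in>I. a i * a j * K i j) / 2))"
    by simp
qed (use assms in \<open>auto simp: gaussian_vector_def\<close>)

definition low_crossing :: "nat \<Rightarrow> real \<Rightarrow> (nat \<times> nat \<Rightarrow> real) \<Rightarrow> bool" where
  "low_crossing n t y \<longleftrightarrow> crosses king_adjacent {i \<in> grid n. y i \<le> t} {p. fst p = 0} {p. fst p = n}"

lemma low_crossing_mono:
  assumes "low_crossing n s x" "\<And>i. i \<in> grid n \<Longrightarrow> x i \<le> s \<Longrightarrow> y i \<le> t" shows "low_crossing n t y"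
  using assms(1) unfolding low_crossing_def
  by (rule crosses_map[where r="\<lambda>p. p"]) (use assms(2) in auto)

lemma low_crossing_cong: "(\<And>i. i \<in> grid n \<Longrightarrow> x i = y i) \<Longrightarrow> low_crossing n t x = low_crossing n t y"
  using low_crossing_mono[of n t x y t] low_crossing_mono[of n t y x t] by auto

lemma low_crossing_sets:
  "{y \<in> space (PiM (grid n) (\<lambda>_. borel)). C (low_crossing n t y)} \<in> sets (PiM (grid n) (\<lambda>_. borel))"
  unfolding low_crossing_def
  by (rule sets_Collect_finite_predicate[where C="\<lambda>S. C (crosses king_adjacent S {p. fst p = 0} {p. fst p = n})"]) auto

text \<open>A bottom-top crossing by positive values becomes, after a quarter turn and a change of
  sign, a left-right crossing by negative values of the turned configuration.\<close>

lemma low_crossing_dichotomy: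
  "low_crossing n 0 y \<or> low_crossing n 0 (\<lambda>(a, b). - y (n - b, a))"
proof -
  from hex_dichotomy[of n "{i. y i \<le> 0}"] show ?thesis
  proof
    assume "crosses king_adjacent (grid n \<inter> {i. y i \<le> 0}) {p. fst p = 0} {p. fst p = n}"
    then show ?thesis unfolding low_crossing_def by (simp add: Int_def)
  next
    assume "crosses king_adjacent (grid n - {i. y i \<le> 0}) {p. snd p = 0} {p. snd p = n}"
    then have "low_crossing n 0 (\<lambda>(a, b). - y (n - b, a))"
      unfolding low_crossing_def
      by (rule crosses_map[where r="\<lambda>p. (snd p, n - fst p)"]) (auto simp: grid_def king_adjacent_def)
    then show ?thesis ..
  qed
qed

text \<open>A diagonal step is replaced by two steps through the corner (fst q, snd p), whose value
  exceeds that at p by at most \<open>t\<close>.\<close>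

lemma lattice_crossing_of_low_crossing:
  assumes e: "0 < \<epsilon>" and low: "low_crossing (mesh_count \<epsilon>) s y"
    and near: "\<And>p q. p \<in> grid (mesh_count \<epsilon>) \<Longrightarrow> q \<in> grid (mesh_count \<epsilon>) \<Longrightarrow> grid_adjacent p q \<Longrightarrow> y q - y p \<le> t"
    and t: "0 \<le> t"
  shows "\<exists>P. crossing \<epsilon> P \<and> set P \<subseteq> lattice_point \<epsilon> ` {i \<in> grid (mesh_count \<epsilon>). y i \<le> s + t}"
proof (rule crossing_of_crosses[OF e])
  let ?n = "mesh_count \<epsilon>"
  let ?S' = "{i \<in> grid ?n. y i \<le> s + t}"
  let ?R = "\<lambda>p q. q \<in> ?S' \<and> grid_adjacent p q"
  show "crosses grid_adjacent ?S' {p. fst p = 0} {p. fst p = ?n}"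
  proof (rule crosses_map[OF low[unfolded low_crossing_def], where r="\<lambda>p. p"])
    fix p q assume p: "p \<in> {i \<in> grid ?n. y i \<le> s}" and q: "q \<in> {i \<in> grid ?n. y i \<le> s}" and k: "king_adjacent p q"
    consider "p = q" | "grid_adjacent p q" | "grid_adjacent p (fst q, snd p)" "grid_adjacent (fst q, snd p) q"
      using k by (cases p; cases q) (auto simp: king_adjacent_def grid_adjacent_def le_Suc_eq)
    then show "?R\<^sup>*\<^sup>* p q"
    proof cases
      case 2
      then show ?thesis using q t by (intro r_into_rtranclp) auto
    next
      case 3
      have m: "(fst q, snd p) \<in> grid ?n" using p q by (auto simp: grid_def)
      have "y (fst q, snd p) \<le> s + t" using near[OF _ m 3(1)] p by force
      then have "?R\<^sup>*\<^sup>* p (fst q, snd p)" "?R\<^sup>*\<^sup>* (fst q, snd p) q" using 3 m q t by (auto intro!: r_into_rtranclp)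
      then show ?thesis by (rule rtranclp_trans)
    qed simp
  qed (use t in auto)
qed auto

section \<open>Probabilities tending to 1\<close>

lemma Liminf_eq_1_iff:
  fixes f :: "real \<Rightarrow> real"
  assumes le: "\<And>x. f x \<le> 1"
  shows "Liminf (at_right 0) (\<lambda>x. ereal (f x)) = 1 \<longleftrightarrow> (f \<longlongrightarrow> 1) (at_right 0)"
proof
  assume L: "Liminf (at_right 0) (\<lambda>x. ereal (f x)) = 1"
  show "(f \<longlongrightarrow> 1) (at_right 0)"
  proof (rule order_tendstoI)
    fix a :: real assume "a < 1"
    then have "ereal a < Liminf (at_right 0) (\<lambda>x. ereal (f x))" unfolding L by simp
    from less_LiminfD[OF this] show "\<forall>\<^sub>F x in at_right 0. a < f x" by simp
  next
    fix a :: real assume "1 < a"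
    then show "\<forall>\<^sub>F x in at_right 0. f x < a" by (intro always_eventually allI order.strict_trans1[OF le])
  qed
next
  assume "(f \<longlongrightarrow> 1) (at_right 0)"
  then have "((\<lambda>x. ereal (f x)) \<longlongrightarrow> ereal 1) (at_right 0)" by simp
  from lim_imp_Liminf[OF _ this] show "Liminf (at_right 0) (\<lambda>x. ereal (f x)) = 1"
    by (simp add: one_ereal_def)
qed

lemma tendsto_1_squeeze:
  fixes f g :: "real \<Rightarrow> real"
  assumes le: "\<And>x. f x \<le> 1" and ev: "\<forall>\<^sub>F x in at_right 0. 1 - g x \<le> f x" and g: "(g \<longlongrightarrow> 0) (at_right 0)"
  shows "(f \<longlongrightarrow> 1) (at_right 0)"
proof (rule tendsto_sandwich[OF ev])
  show "((\<lambda>x. 1 - g x) \<longlongrightarrow> 1) (at_right 0)" using tendsto_diff[OF tendsto_const g, of 1] by simp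
qed (use le in auto)

lemma eventually_small: "0 < (c::real) \<Longrightarrow> \<forall>\<^sub>F x in at_right (0::real). 0 < x \<and> x < c"
  by (auto simp: eventually_at_right)

context whole_plane_gff
begin

text \<open>One positive constant that dominates the bounded part of every variance used below. The
  absolute value makes it independent of the sign of the energy of the unit circle, and ln 4 also
  covers the ln 3 of neighbours.\<close>

definition variance_const :: real where
  "variance_const = 2 * \<bar>circle_energy 0 1 0 1\<bar> + 2 * ln 4"

lemma variance_const_pos: "0 < variance_const"
  by (simp add: variance_const_def add_nonneg_pos)

lemma negative_moment_tail:
  assumes e: "0 < \<epsilon>" "\<epsilon> \<le> 1" and b: "0 < b"
  shows "prob {\<omega> \<in> space M. b \<le> negative_moment h a \<epsilon> \<omega>} \<le>
    4 * exp (a\<^sup>2 * variance_const / 2) * \<epsilon> powr (- 2 - a\<^sup>2 / 2) / b"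
proof (rule nonneg_Markov[OF _ _ _ _ b])
  note [measurable] = measurable_circle[OF e(1)]
  show "(\<lambda>\<omega>. \<Sum>z\<in>square_lattice \<epsilon>. exp (- a * h (uniform_circle z \<epsilon>) \<omega>)) \<in> borel_measurable M"
    by measurable
  have one: "(\<integral>\<^sup>+\<omega>. ennreal (exp (- a * h (uniform_circle z \<epsilon>) \<omega>)) \<partial>M) \<le> ennreal (exp (a\<^sup>2 * variance_const / 2) * \<epsilon> powr (- a\<^sup>2 / 2))"
    if "z \<in> square_lattice \<epsilon>" for z
  proof -
    have "(\<integral>\<^sup>+\<omega>. ennreal (exp (- a * h (uniform_circle z \<epsilon>) \<omega>)) \<partial>M) \<le>
        ennreal (exp ((- a)\<^sup>2 * (- ln \<epsilon> + 2 * circle_energy 0 1 0 1 + 2 * ln 4) / 2))"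
      by (rule mgf_circle_average[OF e cmod_square_lattice[OF that]])
    also have "\<dots> \<le> ennreal (exp (a\<^sup>2 * (- ln \<epsilon> + variance_const) / 2))"
      unfolding variance_const_def power2_minus by (intro ennreal_leI) (simp add: mult_left_mono)
    also have "exp (a\<^sup>2 * (- ln \<epsilon> + variance_const) / 2) = exp (a\<^sup>2 * variance_const / 2) * \<epsilon> powr (- a\<^sup>2 / 2)"
      using e by (simp add: powr_def mult_exp_exp algebra_simps add_divide_distrib diff_divide_distrib)
    finally show ?thesis .
  qed
  have "(\<integral>\<^sup>+\<omega>. ennreal (negative_moment h a \<epsilon> \<omega>) \<partial>M) =
      (\<Sum>z\<in>square_lattice \<epsilon>. \<integral>\<^sup>+\<omega>. ennreal (exp (- a * h (uniform_circle z \<epsilon>) \<omega>)) \<partial>M)"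
    by (subst nn_integral_sum[symmetric]) (auto simp: sum_ennreal)
  also have "\<dots> \<le> (\<Sum>z\<in>square_lattice \<epsilon>. ennreal (exp (a\<^sup>2 * variance_const / 2) * \<epsilon> powr (- a\<^sup>2 / 2)))"
    by (intro sum_mono one)
  also have "\<dots> = ennreal (real (card (square_lattice \<epsilon>)) * (exp (a\<^sup>2 * variance_const / 2) * \<epsilon> powr (- a\<^sup>2 / 2)))"
    by (simp add: ennreal_mult flip: ennreal_of_nat_eq_real_of_nat)
  also have "\<dots> \<le> ennreal (4 * \<epsilon> powr (- 2) * (exp (a\<^sup>2 * variance_const / 2) * \<epsilon> powr (- a\<^sup>2 / 2)))"
    using card_square_lattice_le[OF e] by (intro ennreal_leI mult_right_mono) auto
  also have "4 * \<epsilon> powr (- 2) * (exp (a\<^sup>2 * variance_const / 2) * \<epsilon> powr (- a\<^sup>2 / 2)) = 4 * exp (a\<^sup>2 * variance_const / 2) * \<epsilon> powr (- 2 - a\<^sup>2 / 2)"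
    using powr_add[of \<epsilon> "- 2" "- a\<^sup>2 / 2"] by simp
  finally show "(\<integral>\<^sup>+\<omega>. ennreal (negative_moment h a \<epsilon> \<omega>) \<partial>M) \<le> ennreal (4 * exp (a\<^sup>2 * variance_const / 2) * \<epsilon> powr (- 2 - a\<^sup>2 / 2))" .
qed (auto intro: sum_nonneg)

abbreviation crossing_distance :: "real \<Rightarrow> real \<Rightarrow> 'a \<Rightarrow> real" where
  "crossing_distance \<xi> \<epsilon> \<omega> \<equiv> lfpp_set_dist h \<xi> \<epsilon> \<omega> (left_boundary \<epsilon>) (right_boundary \<epsilon>)"

abbreviation distance_prob :: "real \<Rightarrow> real \<Rightarrow> real \<Rightarrow> real" where
  "distance_prob \<xi> \<epsilon> c \<equiv> prob {\<omega> \<in> space M. crossing_distance \<xi> \<epsilon> \<omega> \<le> c}"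

lemma crossing_distance_sets: "0 < \<epsilon> \<Longrightarrow> {\<omega> \<in> space M. crossing_distance \<xi> \<epsilon> \<omega> \<le> c} \<in> events"
  by (rule lfpp_set_dist_measurable) (auto intro: measurable_circle)

text \<open>This bounds the admissible exponents from above. Any crossing is at least as long as the
  weight of its first vertex, and a weight this small means h <= 3 ln \<epsilon> there. The 3
  exceeds 5/2, the exponent in the expectation of the sum of exp (-h); the excess is the power
  1/2.\<close>

lemma crossing_distance_small_prob:
  assumes e: "0 < \<epsilon>" "\<epsilon> \<le> 1" and \<xi>: "0 < \<xi>"
  shows "distance_prob \<xi> \<epsilon> (\<epsilon> powr (1 + 3 * \<xi>)) \<le> 4 * exp (variance_const / 2) * \<epsilon> powr (1 / 2)"
proof -
  note [measurable] = measurable_circle[OF e(1)]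
  have "distance_prob \<xi> \<epsilon> (\<epsilon> powr (1 + 3 * \<xi>)) \<le>
    prob {\<omega> \<in> space M. \<epsilon> powr (- 3) \<le> negative_moment h 1 \<epsilon> \<omega>}"
  proof (rule finite_measure_mono)
    show "{\<omega> \<in> space M. crossing_distance \<xi> \<epsilon> \<omega> \<le> \<epsilon> powr (1 + 3 * \<xi>)} \<subseteq>
        {\<omega> \<in> space M. \<epsilon> powr (- 3) \<le> negative_moment h 1 \<epsilon> \<omega>}"
    proof safe
      fix \<omega> assume d: "crossing_distance \<xi> \<epsilon> \<omega> \<le> \<epsilon> powr (1 + 3 * \<xi>)"
      define G where "G = lfpp_geodesic h \<xi> \<epsilon> \<omega>"
      have "crossing \<epsilon> G" using lfpp_geodesic_minimizer[OF e(1), of h \<xi> \<omega>] by (simp add: G_def lfpp_minimizers_def)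
      then obtain z P where G: "G = z # P" and z: "z \<in> square_lattice \<epsilon>"
        by (cases G) (auto simp: crossing_def lattice_path_def)
      have "\<epsilon> * exp (\<xi> * h (uniform_circle z \<epsilon>) \<omega>) \<le> lfpp_length h \<xi> \<epsilon> \<omega> G"
        using lfpp_length_nonneg[OF e(1), of h \<xi> \<omega> P] by (simp add: G lfpp_length_def circle_average_def)
      also have "\<dots> \<le> \<epsilon> * \<epsilon> powr (3 * \<xi>)"
        using d e by (simp add: lfpp_set_dist_eq G_def powr_add)
      finally have "exp (\<xi> * h (uniform_circle z \<epsilon>) \<omega>) \<le> exp (\<xi> * (3 * ln \<epsilon>))"
        using e by (simp add: powr_def ac_simps)
      then have "h (uniform_circle z \<epsilon>) \<omega> \<le> 3 * ln \<epsilon>" using \<xi> by simp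
      then have "\<epsilon> powr (- 3) \<le> exp (- 1 * h (uniform_circle z \<epsilon>) \<omega>)" using e by (simp add: powr_def)
      also have "\<dots> \<le> negative_moment h 1 \<epsilon> \<omega>"
        by (rule member_le_sum[OF z]) (auto intro: finite_square_lattice e)
      finally show "\<epsilon> powr (- 3) \<le> negative_moment h 1 \<epsilon> \<omega>" .
    qed
  qed measurable
  also have "\<dots> \<le> 4 * exp (1\<^sup>2 * variance_const / 2) * \<epsilon> powr (- 2 - 1\<^sup>2 / 2) / \<epsilon> powr (- 3)"
    by (rule negative_moment_tail[OF e]) (use e in simp)
  also have "\<dots> = 4 * exp (variance_const / 2) * (\<epsilon> powr (- 2 - 1 / 2) / \<epsilon> powr (- 3))" by simp
  also have "\<epsilon> powr (- 2 - 1 / 2) / \<epsilon> powr (- 3) = \<epsilon> powr (1 / 2)" by (subst powr_diff[symmetric]) simp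
  finally show ?thesis .
qed

text \<open>The quarter turn about \<open>c\<close> maps the lattice to itself and preserves the
  covariance, so the turned and negated field has the same law as the original. By the dichotomy the
  two events of equal probability cover the space.\<close>

lemma low_crossing_prob_half:
  assumes e: "0 < \<epsilon>"
  defines "n \<equiv> mesh_count \<epsilon>"
  defines "c \<equiv> Complex (\<epsilon> * n / 2) (\<epsilon> * n / 2)"
  shows "1 / 2 \<le> prob {\<omega> \<in> space M. low_crossing n 0 (\<lambda>i. h (uniform_circle (lattice_point \<epsilon> i) \<epsilon>) \<omega> - h (uniform_circle c 1) \<omega>)}"
proof -
  note [measurable] = measurable_circle[OF e] measurable_circle[of 1]
  \<comment> \<open>This translation makes z -> i z + b fix \<open>c\<close>.\<close>
  define b where "b = complex_of_real (\<epsilon> * n)"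
  define Y where "Y p i \<omega> = h (uniform_circle (p i) \<epsilon>) \<omega> - h (uniform_circle c 1) \<omega>" for p :: "nat \<times> nat \<Rightarrow> complex" and i \<omega>
  let ?p = "lattice_point \<epsilon>" and ?q = "\<lambda>i. \<i> * lattice_point \<epsilon> i + b"
  have cov: "relative_covariance c ?q \<epsilon> = relative_covariance c ?p \<epsilon>"
    by (rule relative_covariance_rotate) (auto simp: c_def b_def complex_eq_iff)
  have gp: "gaussian_vector M (grid n) (Y ?p) (relative_covariance c ?p \<epsilon>)"
    unfolding Y_def by (rule gaussian_vector_relative_circles[OF _ e]) simp
  have gq: "gaussian_vector M (grid n) (\<lambda>i \<omega>. - Y ?q i \<omega>) (relative_covariance c ?p \<epsilon>)"
    unfolding Y_def cov[symmetric] by (rule gaussian_vector_uminus[OF gaussian_vector_relative_circles[OF _ e]]) simp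
  let ?S = "{y \<in> space (PiM (grid n) (\<lambda>_. borel)). low_crossing n 0 y}"
  have mem: "(\<lambda>i\<in>grid n. X i \<omega>) \<in> ?S \<longleftrightarrow> low_crossing n 0 (\<lambda>i. X i \<omega>)" for X :: "nat \<times> nat \<Rightarrow> 'a \<Rightarrow> real" and \<omega>
    using low_crossing_cong[of n "\<lambda>i\<in>grid n. X i \<omega>" "\<lambda>i. X i \<omega>" 0] by (simp add: space_PiM)
  have eq: "prob {\<omega> \<in> space M. low_crossing n 0 (\<lambda>i. Y ?p i \<omega>)} = prob {\<omega> \<in> space M. low_crossing n 0 (\<lambda>i. - Y ?q i \<omega>)}"
    using gaussian_vector_law_unique[OF gp gq low_crossing_sets[of n "\<lambda>x. x" 0]]
    unfolding mem[of "Y ?p"] mem[of "\<lambda>i \<omega>. - Y ?q i \<omega>"] .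
  have sets: "{\<omega> \<in> space M. low_crossing n 0 (\<lambda>i. X i \<omega>)} \<in> events" if [measurable]: "\<And>i. X i \<in> borel_measurable M" for X
    unfolding low_crossing_def
    by (rule sets_Collect_finite_predicate[where C="\<lambda>S. crosses king_adjacent S {p. fst p = 0} {p. fst p = n}"]) auto
  have Ym[measurable]: "Y p i \<in> borel_measurable M" for p i unfolding Y_def by measurable
  have "1 = prob ({\<omega> \<in> space M. low_crossing n 0 (\<lambda>i. Y ?p i \<omega>)} \<union> {\<omega> \<in> space M. low_crossing n 0 (\<lambda>i. - Y ?q i \<omega>)})"
  proof -
    have "low_crossing n 0 (\<lambda>i. Y ?p i \<omega>) \<or> low_crossing n 0 (\<lambda>i. - Y ?q i \<omega>)" for \<omega>
    proof -
      have "?p (n - y, x) = ?q (x, y)" if "(x, y) \<in> grid n" for x y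
        using that by (auto simp: lattice_point_def b_def complex_eq_iff grid_def of_nat_diff algebra_simps)
      then have "low_crossing n 0 (\<lambda>i. - Y ?q i \<omega>) = low_crossing n 0 (\<lambda>(x, y). - Y ?p (n - y, x) \<omega>)"
        by (intro low_crossing_cong) (auto simp: Y_def)
      then show ?thesis using low_crossing_dichotomy[of n "\<lambda>i. Y ?p i \<omega>"] by simp
    qed
    then have "{\<omega> \<in> space M. low_crossing n 0 (\<lambda>i. Y ?p i \<omega>)} \<union> {\<omega> \<in> space M. low_crossing n 0 (\<lambda>i. - Y ?q i \<omega>)} = space M"
      by blast
    then show ?thesis by (simp add: prob_space)
  qed
  also have "\<dots> \<le> prob {\<omega> \<in> space M. low_crossing n 0 (\<lambda>i. Y ?p i \<omega>)} + prob {\<omega> \<in> space M. low_crossing n 0 (\<lambda>i. - Y ?q i \<omega>)}"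
    by (intro measure_Un_le sets) measurable
  finally show ?thesis unfolding eq[symmetric] by (simp add: Y_def)
qed

text \<open>A configuration with a crossing at level 0 and one without a crossing at level
  \<open>t\<close> differ by at least \<open>t\<close> at some vertex, so concentration bounds the
  product of their probabilities. The first is at least 1/2, whence the factor 2.\<close>

lemma low_crossing_fail_prob:
  assumes e: "0 < \<epsilon>" "\<epsilon> \<le> 1" and t: "0 \<le> t"
  defines "n \<equiv> mesh_count \<epsilon>"
  defines "c \<equiv> Complex (\<epsilon> * n / 2) (\<epsilon> * n / 2)"
  shows "prob {\<omega> \<in> space M. \<not> low_crossing n t (\<lambda>i. h (uniform_circle (lattice_point \<epsilon> i) \<epsilon>) \<omega> - h (uniform_circle c 1) \<omega>)}
    \<le> 2 * exp (- t\<^sup>2 / (4 * (- ln \<epsilon> + variance_const)))"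
proof -
  define Y where "Y i \<omega> = h (uniform_circle (lattice_point \<epsilon> i) \<epsilon>) \<omega> - h (uniform_circle c 1) \<omega>" for i \<omega>
  let ?P = "PiM (grid n) (\<lambda>_. borel :: real measure)"
  let ?S = "{y \<in> space ?P. low_crossing n 0 y}" and ?T = "{y \<in> space ?P. \<not> low_crossing n t y}"
  have cong: "low_crossing n s (\<lambda>i\<in>grid n. Y i \<omega>) \<longleftrightarrow> low_crossing n s (\<lambda>i. Y i \<omega>)" for s \<omega>
    by (rule low_crossing_cong) simp
  have memS: "(\<lambda>i\<in>grid n. Y i \<omega>) \<in> ?S \<longleftrightarrow> low_crossing n 0 (\<lambda>i. Y i \<omega>)"
    and memT: "(\<lambda>i\<in>grid n. Y i \<omega>) \<in> ?T \<longleftrightarrow> \<not> low_crossing n t (\<lambda>i. Y i \<omega>)" for \<omega>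
    by (simp_all add: cong space_PiM)
  have n1: "\<epsilon> * n \<le> 1" "0 \<le> \<epsilon> * n" using mesh_count_iff[OF e(1), of n] e by (auto simp: n_def)
  have s: "0 < - ln \<epsilon> + variance_const" using variance_const_pos ln_le_zero_iff[of \<epsilon>] e by linarith
  have "prob {\<omega> \<in> space M. (\<lambda>i\<in>grid n. Y i \<omega>) \<in> ?S} * prob {\<omega> \<in> space M. (\<lambda>i\<in>grid n. Y i \<omega>) \<in> ?T} \<le> exp (- t\<^sup>2 / (4 * (- ln \<epsilon> + variance_const)))"
  proof (rule gaussian_vector_concentration[where K="relative_covariance c (lattice_point \<epsilon>) \<epsilon>"])
    show "gaussian_vector M (grid n) Y (relative_covariance c (lattice_point \<epsilon>) \<epsilon>)"
      unfolding Y_def by (rule gaussian_vector_relative_circles[OF _ e(1)]) simp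
    show "?S \<in> sets ?P" using low_crossing_sets[of n "\<lambda>x. x" 0] .
    show "?T \<in> sets ?P" using low_crossing_sets[of n "\<lambda>x. \<not> x" t] .
    show "\<exists>i\<in>grid n. t \<le> \<bar>x i - y i\<bar>" if x: "x \<in> ?S" and y: "y \<in> ?T" for x y
    proof (rule ccontr)
      assume "\<not> ?thesis"
      then have "y i \<le> t" if "i \<in> grid n" "x i \<le> 0" for i using that by force
      then show False using x y low_crossing_mono[of n 0 x y t] by auto
    qed
    fix i assume i: "i \<in> grid n"
    have "dist (lattice_point \<epsilon> i) c \<le> 2"
    proof -
      have "cmod (lattice_point \<epsilon> i - c) \<le> \<bar>Re (lattice_point \<epsilon> i - c)\<bar> + \<bar>Im (lattice_point \<epsilon> i - c)\<bar>" by (rule cmod_le)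
      also have "\<dots> \<le> 2"
      proof -
        have "\<epsilon> * fst i \<le> 1" "\<epsilon> * snd i \<le> 1" "0 \<le> \<epsilon> * fst i" "0 \<le> \<epsilon> * snd i"
        proof -
          have "fst i \<le> n" "snd i \<le> n" using i by (auto simp: grid_def)
          then show "\<epsilon> * fst i \<le> 1" "\<epsilon> * snd i \<le> 1"
            unfolding n_def mesh_count_iff[OF e(1)] .
        qed (use e in simp_all)
        then have "\<bar>\<epsilon> * fst i - \<epsilon> * n / 2\<bar> \<le> 1" "\<bar>\<epsilon> * snd i - \<epsilon> * n / 2\<bar> \<le> 1"
          using n1 by linarith+
        then show ?thesis by (simp add: lattice_point_def c_def)
      qed
      finally show ?thesis by (simp add: dist_norm)
    qed
    from relative_variance_le[where p="lattice_point \<epsilon>", OF e this] show "relative_covariance c (lattice_point \<epsilon>) \<epsilon> i i \<le> - ln \<epsilon> + variance_const"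
      by (simp add: variance_const_def)
  qed (use s t in auto)
  moreover have "1 / 2 \<le> prob {\<omega> \<in> space M. low_crossing n 0 (\<lambda>i. Y i \<omega>)}"
    using low_crossing_prob_half[OF e(1)] unfolding n_def c_def Y_def .
  ultimately have "1 / 2 * prob {\<omega> \<in> space M. \<not> low_crossing n t (\<lambda>i. Y i \<omega>)} \<le> exp (- t\<^sup>2 / (4 * (- ln \<epsilon> + variance_const)))"
    unfolding memS memT by (meson mult_right_mono measure_nonneg order_trans)
  then show ?thesis by (simp add: Y_def)
qed

text \<open>A union bound over all ordered pairs of vertices, at most the square of 4
  \<epsilon>^(-2). The loss is harmless because \<theta> is free and neighbour differences have
  bounded variance.\<close>

lemma neighbour_difference_prob:
  assumes e: "0 < \<epsilon>" "\<epsilon> \<le> 1" and \<theta>: "0 \<le> \<theta>"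
  shows "prob {\<omega> \<in> space M. \<exists>p\<in>grid (mesh_count \<epsilon>). \<exists>q\<in>grid (mesh_count \<epsilon>). grid_adjacent p q \<and>
      t \<le> h (uniform_circle (lattice_point \<epsilon> q) \<epsilon>) \<omega> - h (uniform_circle (lattice_point \<epsilon> p) \<epsilon>) \<omega>}
    \<le> 16 * \<epsilon> powr (- 4) * (exp (\<theta>\<^sup>2 * variance_const / 2) * exp (- \<theta> * t))"
proof -
  note [measurable] = measurable_circle[OF e(1)]
  let ?G = "grid (mesh_count \<epsilon>)"
  let ?B = "\<lambda>p q. {\<omega> \<in> space M. t \<le> h (uniform_circle (lattice_point \<epsilon> q) \<epsilon>) \<omega> - h (uniform_circle (lattice_point \<epsilon> p) \<epsilon>) \<omega>}"
  define A where "A = {(p, q). p \<in> ?G \<and> q \<in> ?G \<and> grid_adjacent p q}"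
  define \<kappa> where "\<kappa> = exp (\<theta>\<^sup>2 * variance_const / 2) * exp (- \<theta> * t)"
  have A: "A \<subseteq> ?G \<times> ?G" by (auto simp: A_def)
  then have finA: "finite A" by (rule finite_subset) simp
  have one: "prob (?B p q) \<le> \<kappa>" if "(p, q) \<in> A" for p q
    unfolding \<kappa>_def
  proof (rule exp_Markov)
    have "dist (lattice_point \<epsilon> q) (lattice_point \<epsilon> p) = \<epsilon>"
      using grid_adjacent_dist[OF e(1), of p q] that by (simp add: A_def dist_commute)
    from mgf_neighbour_difference[OF e(1) this, of \<theta>]
    have "(\<integral>\<^sup>+\<omega>. ennreal (exp (\<theta> * (h (uniform_circle (lattice_point \<epsilon> q) \<epsilon>) \<omega> - h (uniform_circle (lattice_point \<epsilon> p) \<epsilon>) \<omega>))) \<partial>M)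
       \<le> ennreal (exp (\<theta>\<^sup>2 * (2 * circle_energy 0 1 0 1 + 2 * ln 3) / 2))" .
    also have "\<dots> \<le> ennreal (exp (\<theta>\<^sup>2 * variance_const / 2))"
    proof -
      have "2 * circle_energy 0 1 0 1 + 2 * ln 3 \<le> variance_const" by (simp add: variance_const_def add_mono)
      then show ?thesis by (intro ennreal_leI) (simp add: mult_left_mono)
    qed
    finally show "(\<integral>\<^sup>+\<omega>. ennreal (exp (\<theta> * (h (uniform_circle (lattice_point \<epsilon> q) \<epsilon>) \<omega> - h (uniform_circle (lattice_point \<epsilon> p) \<epsilon>) \<omega>))) \<partial>M)
       \<le> ennreal (exp (\<theta>\<^sup>2 * variance_const / 2))" .
  qed (use \<theta> in auto)
  have "{\<omega> \<in> space M. \<exists>p\<in>?G. \<exists>q\<in>?G. grid_adjacent p q \<and> t \<le> h (uniform_circle (lattice_point \<epsilon> q) \<epsilon>) \<omega> - h (uniform_circle (lattice_point \<epsilon> p) \<epsilon>) \<omega>}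
    = (\<Union>(p, q)\<in>A. ?B p q)" by (auto simp: A_def)
  also have "prob (\<Union>(p, q)\<in>A. ?B p q) \<le> (\<Sum>(p, q)\<in>A. prob (?B p q))"
    using measure_UNION_le[OF finA, of "\<lambda>(p, q). ?B p q" M] by (auto simp: split_beta)
  also have "\<dots> \<le> (\<Sum>a\<in>A. \<kappa>)" using one by (intro sum_mono) auto
  also have "\<dots> \<le> real ((card ?G)\<^sup>2) * \<kappa>"
  proof -
    have "card A \<le> card (?G \<times> ?G)" using A by (intro card_mono) auto
    then show ?thesis by (simp add: card_cartesian_product power2_eq_square \<kappa>_def mult_right_mono flip: of_nat_mult)
  qed
  also have "\<dots> \<le> (4 * \<epsilon> powr (- 2))\<^sup>2 * \<kappa>"
  proof -
    have "card ?G = card (square_lattice \<epsilon>)"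
      using lattice_point_inj[OF e(1)] by (simp add: square_lattice_eq[OF e(1)] card_image inj_on_subset)
    then show ?thesis
      unfolding of_nat_power using card_square_lattice_le[OF e] by (intro mult_right_mono power_mono) (auto simp: \<kappa>_def)
  qed
  also have "(4 * \<epsilon> powr (- 2))\<^sup>2 = 16 * \<epsilon> powr (- 4)"
    using e by (simp add: power_mult_distrib power2_eq_square powr_add[symmetric])
  finally show ?thesis by (simp add: \<kappa>_def)
qed

lemma centre_prob:
  assumes z: "cmod z \<le> 2"
  shows "prob {\<omega> \<in> space M. t \<le> h (uniform_circle z 1) \<omega>} \<le> exp (variance_const / 2) * exp (- 1 * t)"
proof (rule exp_Markov)
  have "(\<integral>\<^sup>+\<omega>. ennreal (exp (1 * h (uniform_circle z 1) \<omega>)) \<partial>M) \<le> ennreal (exp (1\<^sup>2 * (2 * circle_energy 0 1 0 1 + 2 * ln 4) / 2))"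
    by (rule mgf_centre[OF z])
  also have "\<dots> \<le> ennreal (exp (variance_const / 2))" by (intro ennreal_leI) (simp add: variance_const_def)
  finally show "(\<integral>\<^sup>+\<omega>. ennreal (exp (1 * h (uniform_circle z 1) \<omega>)) \<partial>M) \<le> ennreal (exp (variance_const / 2))" .
qed (auto intro: measurable_circle)

text \<open>With t = \<delta> ln (1/\<epsilon>), the values on the crossing are at most 3 t: one t
  for concentration, one for the average around \<open>c\<close>, one for removing diagonals. A
  simple crossing has at most 4 \<epsilon>^(-2) vertices, each of weight at most \<epsilon>^(1 - 3
  \<delta> \<xi>).\<close>

lemma crossing_distance_upper_prob:
  assumes e: "0 < \<epsilon>" "\<epsilon> < 1" and \<xi>: "0 < \<xi>" and \<delta>: "0 < \<delta>"
  shows "1 - (2 * exp (- (\<delta> * - ln \<epsilon>)\<^sup>2 / (4 * (- ln \<epsilon> + variance_const))) + exp (variance_const / 2) * \<epsilon> powr \<delta>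
      + 16 * exp ((5 / \<delta>)\<^sup>2 * variance_const / 2) * \<epsilon>) \<le> distance_prob \<xi> \<epsilon> (4 * \<epsilon> powr (- 1 - 3 * \<delta> * \<xi>))"
proof -
  note [measurable] = measurable_circle[OF e(1)] measurable_circle[of 1]
  define n where "n = mesh_count \<epsilon>"
  define c where "c = Complex (\<epsilon> * n / 2) (\<epsilon> * n / 2)"
  define t where "t = \<delta> * - ln \<epsilon>"
  have t: "0 < t" using e \<delta> by (simp add: t_def mult_pos_neg)
  define H where "H i \<omega> = h (uniform_circle (lattice_point \<epsilon> i) \<epsilon>) \<omega>" for i \<omega>
  have Hm[measurable]: "H i \<in> borel_measurable M" for i unfolding H_def by measurable
  define B1 where "B1 = {\<omega> \<in> space M. \<not> low_crossing n t (\<lambda>i. H i \<omega> - h (uniform_circle c 1) \<omega>)}"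
  define B2 where "B2 = {\<omega> \<in> space M. t \<le> h (uniform_circle c 1) \<omega>}"
  define B3 where "B3 = {\<omega> \<in> space M. \<exists>p\<in>grid n. \<exists>q\<in>grid n. grid_adjacent p q \<and> t \<le> H q \<omega> - H p \<omega>}"
  have [measurable]: "B1 \<in> events" unfolding B1_def low_crossing_def
    by (rule sets_Collect_finite_predicate[where C="\<lambda>S. \<not> crosses king_adjacent S {p. fst p = 0} {p. fst p = n}"]) auto
  have [measurable]: "B2 \<in> events" unfolding B2_def by measurable
  have [measurable]: "B3 \<in> events" unfolding B3_def by measurable
  have p1: "prob B1 \<le> 2 * exp (- t\<^sup>2 / (4 * (- ln \<epsilon> + variance_const)))"
    using low_crossing_fail_prob[of \<epsilon> t] e t unfolding B1_def n_def c_def H_def by simp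
  have n1: "\<epsilon> * n \<le> 1" "0 \<le> \<epsilon> * n" using mesh_count_iff[OF e(1), of n] e by (auto simp: n_def)
  have "cmod c \<le> 2" using cmod_le[of c] n1 by (simp add: c_def)
  from centre_prob[OF this, of t] have p2: "prob B2 \<le> exp (variance_const / 2) * \<epsilon> powr \<delta>"
    using e by (simp add: B2_def t_def powr_def)
  \<comment> \<open>\<theta> = 5/\<delta> turns exp (- \<theta> t) into \<epsilon>^5, which beats
    the \<epsilon>^(-4) of the union bound.\<close>
  have p3: "prob B3 \<le> 16 * exp ((5 / \<delta>)\<^sup>2 * variance_const / 2) * \<epsilon>"
  proof -
    have "prob B3 \<le> 16 * \<epsilon> powr (- 4) * (exp ((5 / \<delta>)\<^sup>2 * variance_const / 2) * exp (- (5 / \<delta>) * t))"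
      unfolding B3_def n_def H_def using e \<delta> by (intro neighbour_difference_prob) auto
    also have "exp (- (5 / \<delta>) * t) = \<epsilon> powr 5" using e \<delta> by (simp add: t_def powr_def)
    also have "16 * \<epsilon> powr (- 4) * (exp ((5 / \<delta>)\<^sup>2 * variance_const / 2) * \<epsilon> powr 5) =
        16 * exp ((5 / \<delta>)\<^sup>2 * variance_const / 2) * (\<epsilon> powr (- 4) * \<epsilon> powr 5)" by simp
    also have "\<epsilon> powr (- 4) * \<epsilon> powr 5 = \<epsilon>" using e by (subst powr_add[symmetric]) simp
    finally show ?thesis .
  qed
  have "space M - (B1 \<union> B2 \<union> B3) \<subseteq> {\<omega> \<in> space M. crossing_distance \<xi> \<epsilon> \<omega> \<le> 4 * \<epsilon> powr (- 1 - 3 * \<delta> * \<xi>)}"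
  proof
    fix \<omega> assume \<omega>: "\<omega> \<in> space M - (B1 \<union> B2 \<union> B3)"
    have "low_crossing n t (\<lambda>i. H i \<omega> - h (uniform_circle c 1) \<omega>)" using \<omega> by (auto simp: B1_def)
    then have "low_crossing n (2 * t) (\<lambda>i. H i \<omega>)"
      by (rule low_crossing_mono) (use \<omega> in \<open>auto simp: B2_def\<close>)
    then have "\<exists>P. crossing \<epsilon> P \<and> set P \<subseteq> lattice_point \<epsilon> ` {i \<in> grid n. H i \<omega> \<le> 2 * t + t}"
      unfolding n_def
    proof (rule lattice_crossing_of_low_crossing[OF e(1)])
      fix p q assume "p \<in> grid (mesh_count \<epsilon>)" "q \<in> grid (mesh_count \<epsilon>)" "grid_adjacent p q"
      then have "\<not> t \<le> H q \<omega> - H p \<omega>" using \<omega> by (auto simp: B3_def n_def)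
      then show "H q \<omega> - H p \<omega> \<le> t" by simp
    qed (use t in simp)
    then obtain P where P: "crossing \<epsilon> P" "set P \<subseteq> lattice_point \<epsilon> ` {i \<in> grid n. H i \<omega> \<le> 2 * t + t}" by blast
    obtain Q where Q: "Q \<in> simple_crossings \<epsilon>" "set Q \<subseteq> set P" using simple_crossing_below[OF e(1) P(1), of h \<xi> \<omega>] by blast
    have Qs: "distinct Q" "set Q \<subseteq> square_lattice \<epsilon>" "crossing \<epsilon> Q"
      using Q(1) by (auto simp: simple_crossings_def crossing_def lattice_path_def)
    have low: "h (uniform_circle z \<epsilon>) \<omega> \<le> 3 * t" if "z \<in> set Q" for z
      using that Q(2) P(2) by (auto simp: H_def)
    have "crossing_distance \<xi> \<epsilon> \<omega> \<le> lfpp_length h \<xi> \<epsilon> \<omega> Q"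
      using lfpp_geodesic_minimizer[OF e(1), of h \<xi> \<omega>] Qs(3) by (simp add: lfpp_set_dist_eq[OF e(1)] lfpp_minimizers_def)
    also have "\<dots> = (\<Sum>z\<in>set Q. \<epsilon> * exp (\<xi> * h (uniform_circle z \<epsilon>) \<omega>))"
      unfolding lfpp_length_def circle_average_def by (rule sum_list_distinct_conv_sum_set[OF Qs(1)])
    also have "\<dots> \<le> (\<Sum>z\<in>set Q. \<epsilon> * exp (\<xi> * (3 * t)))"
      using low e \<xi> by (intro sum_mono mult_left_mono) auto
    also have "\<dots> = real (card (set Q)) * (\<epsilon> * exp (\<xi> * (3 * t)))" by simp
    also have "\<dots> \<le> (4 * \<epsilon> powr (- 2)) * (\<epsilon> * exp (\<xi> * (3 * t)))"
    proof (rule mult_right_mono)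
      have "card (set Q) \<le> card (square_lattice \<epsilon>)" using Qs e by (intro card_mono finite_square_lattice) auto
      then show "real (card (set Q)) \<le> 4 * \<epsilon> powr (- 2)" using card_square_lattice_le[of \<epsilon>] e by linarith
    qed (use e in simp)
    also have "\<epsilon> * exp (\<xi> * (3 * t)) = \<epsilon> powr (1 - 3 * \<delta> * \<xi>)"
      using e by (simp add: t_def powr_def algebra_simps exp_add exp_diff)
        (simp add: exp_minus field_simps)
    also have "(4 * \<epsilon> powr (- 2)) * \<epsilon> powr (1 - 3 * \<delta> * \<xi>) = 4 * \<epsilon> powr (- 1 - 3 * \<delta> * \<xi>)"
      using powr_add[of \<epsilon> "- 2" "1 - 3 * \<delta> * \<xi>"] by simp
    finally show "\<omega> \<in> {\<omega> \<in> space M. crossing_distance \<xi> \<epsilon> \<omega> \<le> 4 * \<epsilon> powr (- 1 - 3 * \<delta> * \<xi>)}" using \<omega> by simp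
  qed
  then have "prob (space M - (B1 \<union> B2 \<union> B3)) \<le> distance_prob \<xi> \<epsilon> (4 * \<epsilon> powr (- 1 - 3 * \<delta> * \<xi>))"
    by (rule finite_measure_mono[OF _ crossing_distance_sets[OF e(1)]])
  moreover have "prob (space M - (B1 \<union> B2 \<union> B3)) = 1 - prob (B1 \<union> B2 \<union> B3)" by (rule prob_compl) measurable
  moreover have "prob (B1 \<union> B2 \<union> B3) \<le> prob B1 + prob B2 + prob B3"
    using measure_Un_le[of "B1 \<union> B2" M B3] measure_Un_le[of B1 M B2] by simp
  ultimately show ?thesis using p1 p2 p3 unfolding t_def by linarith
qed

end

section \<open>The distance exponent and the geodesic dimension\<close>

context whole_plane_gff
begin

lemma crossing_distance_tendsto_1:
  assumes \<xi>: "0 < \<xi>" and \<eta>: "0 < \<eta>"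
  shows "((\<lambda>\<epsilon>. distance_prob \<xi> \<epsilon> (\<epsilon> powr (- 1 - \<eta>))) \<longlongrightarrow> 1) (at_right 0)"
proof -
  \<comment> \<open>Then 3 \<delta> \<xi> = \<eta>/2, and the other half of \<eta> absorbs the
    factor 4 for small \<epsilon>.\<close>
  define \<delta> where "\<delta> = \<eta> / (6 * \<xi>)"
  have \<delta>: "0 < \<delta>" "3 * \<delta> * \<xi> = \<eta> / 2" using assms by (auto simp: \<delta>_def)
  define V where "V = variance_const"
  define C where "C = exp ((5 / \<delta>)\<^sup>2 * V / 2)"
  let ?g = "\<lambda>\<epsilon>::real. 2 * exp (- (\<delta> * - ln \<epsilon>)\<^sup>2 / (4 * (- ln \<epsilon> + V))) + exp (V / 2) * \<epsilon> powr \<delta> + 16 * C * \<epsilon>"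
  show ?thesis
  proof (rule tendsto_1_squeeze[where g="?g"])
    show "\<forall>\<^sub>F \<epsilon> in at_right 0. 1 - ?g \<epsilon> \<le> distance_prob \<xi> \<epsilon> (\<epsilon> powr (- 1 - \<eta>))"
      using eventually_small[of "min 1 ((1/4) powr (2 / \<eta>))"]
    proof (rule eventually_mono)
      fix \<epsilon> :: real assume "0 < \<epsilon> \<and> \<epsilon> < min 1 ((1/4) powr (2 / \<eta>))"
      then have e: "0 < \<epsilon>" "\<epsilon> < 1" "\<epsilon> < (1/4) powr (2 / \<eta>)" by auto
      have "\<epsilon> powr (\<eta> / 2) \<le> ((1/4) powr (2 / \<eta>)) powr (\<eta> / 2)" using e \<eta> by (intro powr_mono2) auto
      also have "\<dots> = 1/4" using \<eta> by (simp add: powr_powr)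
      finally have "4 * \<epsilon> powr (\<eta> / 2) \<le> 1" by simp
      then have "4 * \<epsilon> powr (\<eta> / 2) * \<epsilon> powr (- 1 - \<eta>) \<le> 1 * \<epsilon> powr (- 1 - \<eta>)" by (rule mult_right_mono) simp
      moreover have "\<epsilon> powr (\<eta> / 2) * \<epsilon> powr (- 1 - \<eta>) = \<epsilon> powr (- 1 - \<eta> / 2)"
      proof -
        have "\<eta> / 2 + (- 1 - \<eta>) = - 1 - \<eta> / 2" by simp
        then show ?thesis by (simp only: powr_add[symmetric])
      qed
      ultimately have le: "4 * \<epsilon> powr (- 1 - 3 * \<delta> * \<xi>) \<le> \<epsilon> powr (- 1 - \<eta>)" by (simp add: \<delta>(2))
      have "1 - ?g \<epsilon> \<le> distance_prob \<xi> \<epsilon> (4 * \<epsilon> powr (- 1 - 3 * \<delta> * \<xi>))"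
        unfolding V_def C_def by (rule crossing_distance_upper_prob[OF e(1,2) \<xi> \<delta>(1)])
      also have "\<dots> \<le> distance_prob \<xi> \<epsilon> (\<epsilon> powr (- 1 - \<eta>))"
        using le by (intro finite_measure_mono crossing_distance_sets e) (auto intro: order_trans)
      finally show "1 - ?g \<epsilon> \<le> distance_prob \<xi> \<epsilon> (\<epsilon> powr (- 1 - \<eta>))" .
    qed (use \<eta> in simp)
    show "(?g \<longlongrightarrow> 0) (at_right 0)"
    proof -
      define k where "k = \<delta>\<^sup>2 / 4"
      define C' where "C' = exp (V / 2)"
      have pos: "0 < V" "0 < C" "0 < C'" "0 < k"
        using \<delta>(1) by (simp_all add: V_def C_def C'_def k_def variance_const_pos)
      have "((\<lambda>\<epsilon>::real. 2 * exp (- (k * (ln \<epsilon>)\<^sup>2 / (- ln \<epsilon> + V)))) \<longlongrightarrow> 0) (at_right 0)"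
        using pos by real_asymp
      moreover have "((\<lambda>\<epsilon>::real. C' * \<epsilon> powr \<delta>) \<longlongrightarrow> 0) (at_right 0)"
        using \<delta>(1) by real_asymp
      moreover have "((\<lambda>\<epsilon>::real. 16 * C * \<epsilon>) \<longlongrightarrow> 0) (at_right 0)"
        by real_asymp
      ultimately have "((\<lambda>\<epsilon>::real. 2 * exp (- (k * (ln \<epsilon>)\<^sup>2 / (- ln \<epsilon> + V))) + C' * \<epsilon> powr \<delta> + 16 * C * \<epsilon>) \<longlongrightarrow> 0 + 0 + 0) (at_right 0)"
        by (intro tendsto_add)
      then show ?thesis by (simp add: k_def C'_def power_mult_distrib)
    qed
  qed simp
qed

text \<open>A supremum of reals carries information only for a nonempty set bounded above. Downward
  closure then makes every exponent below the supremum admissible.\<close>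

lemma distance_exponent_set:
  assumes \<xi>: "0 < \<xi>"
  defines "S \<equiv> {\<alpha> :: real. Liminf (at_right 0) (\<lambda>\<epsilon>. ereal (distance_prob \<xi> \<epsilon> (\<epsilon> powr \<alpha>))) = 1}"
  shows "bdd_above S" "0 < \<eta> \<Longrightarrow> - 1 - \<eta> \<in> S"
    "\<alpha> \<in> S \<Longrightarrow> \<beta> \<le> \<alpha> \<Longrightarrow> ((\<lambda>\<epsilon>. distance_prob \<xi> \<epsilon> (\<epsilon> powr \<beta>)) \<longlongrightarrow> 1) (at_right 0)"
proof -
  have S: "\<alpha> \<in> S \<longleftrightarrow> ((\<lambda>\<epsilon>. distance_prob \<xi> \<epsilon> (\<epsilon> powr \<alpha>)) \<longlongrightarrow> 1) (at_right 0)" for \<alpha>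
    unfolding S_def mem_Collect_eq by (rule Liminf_eq_1_iff) simp
  show "- 1 - \<eta> \<in> S" if "0 < \<eta>" for \<eta>
    unfolding S by (rule crossing_distance_tendsto_1[OF \<xi> that])
  have mono: "((\<lambda>\<epsilon>. distance_prob \<xi> \<epsilon> (\<epsilon> powr \<beta>)) \<longlongrightarrow> 1) (at_right 0)"
    if "\<alpha> \<in> S" "\<beta> \<le> \<alpha>" for \<alpha> \<beta>
  proof (rule tendsto_sandwich)
    show "((\<lambda>\<epsilon>. distance_prob \<xi> \<epsilon> (\<epsilon> powr \<alpha>)) \<longlongrightarrow> 1) (at_right 0)"
      using that(1) S by simp
    show "\<forall>\<^sub>F \<epsilon> in at_right 0. distance_prob \<xi> \<epsilon> (\<epsilon> powr \<alpha>) \<le> distance_prob \<xi> \<epsilon> (\<epsilon> powr \<beta>)"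
      using eventually_small[of 1]
    proof (rule eventually_mono)
      fix \<epsilon> :: real assume e: "0 < \<epsilon> \<and> \<epsilon> < 1"
      then have "\<epsilon> powr \<alpha> \<le> \<epsilon> powr \<beta>" using that by (intro powr_mono') auto
      then show "distance_prob \<xi> \<epsilon> (\<epsilon> powr \<alpha>) \<le> distance_prob \<xi> \<epsilon> (\<epsilon> powr \<beta>)"
        using e by (intro finite_measure_mono crossing_distance_sets) auto
    qed simp
  qed auto
  then show "\<alpha> \<in> S \<Longrightarrow> \<beta> \<le> \<alpha> \<Longrightarrow> ((\<lambda>\<epsilon>. distance_prob \<xi> \<epsilon> (\<epsilon> powr \<beta>)) \<longlongrightarrow> 1) (at_right 0)"
    by blast
  show "bdd_above S"
  proof (rule bdd_aboveI)
    fix \<alpha> assume \<alpha>: "\<alpha> \<in> S"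
    show "\<alpha> \<le> 1 + 3 * \<xi>"
    proof (rule ccontr)
      assume "\<not> \<alpha> \<le> 1 + 3 * \<xi>"
      then have "((\<lambda>\<epsilon>. distance_prob \<xi> \<epsilon> (\<epsilon> powr (1 + 3 * \<xi>))) \<longlongrightarrow> 1) (at_right 0)"
        using mono[OF \<alpha>] by simp
      moreover have "((\<lambda>\<epsilon>. 4 * exp (variance_const / 2) * \<epsilon> powr (1 / 2)) \<longlongrightarrow> 0) (at_right 0)"
        by real_asymp
      moreover have "\<forall>\<^sub>F \<epsilon> in at_right 0. distance_prob \<xi> \<epsilon> (\<epsilon> powr (1 + 3 * \<xi>)) \<le> 4 * exp (variance_const / 2) * \<epsilon> powr (1 / 2)"
        using eventually_small[of 1] by (rule eventually_mono) (use crossing_distance_small_prob[OF _ _ \<xi>] in auto)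
      ultimately have "1 \<le> (0::real)" by (intro tendsto_le[of "at_right (0::real)"]) auto
      then show False by simp
    qed
  qed
qed

lemma
  assumes \<xi>: "0 < \<xi>"
  shows distance_exponent_ge: "- 1 \<le> lfpp_distance_exponent M h \<xi>"
    and crossing_distance_below_exponent: "0 < \<zeta> \<Longrightarrow>
      ((\<lambda>\<epsilon>. distance_prob \<xi> \<epsilon> (\<epsilon> powr (lfpp_distance_exponent M h \<xi> - \<zeta>))) \<longlongrightarrow> 1) (at_right 0)"
proof -
  define S where "S = {\<alpha> :: real. Liminf (at_right 0) (\<lambda>\<epsilon>. ereal (distance_prob \<xi> \<epsilon> (\<epsilon> powr \<alpha>))) = 1}"
  note S = distance_exponent_set[OF \<xi>, folded S_def]
  have lam: "lfpp_distance_exponent M h \<xi> = Sup S" by (simp add: lfpp_distance_exponent_def S_def)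
  show "- 1 \<le> lfpp_distance_exponent M h \<xi>"
  proof (rule field_le_epsilon)
    fix \<eta> :: real assume "0 < \<eta>"
    from cSup_upper[OF S(2)[OF this] S(1)] show "- 1 \<le> lfpp_distance_exponent M h \<xi> + \<eta>" by (simp add: lam)
  qed
  show "((\<lambda>\<epsilon>. distance_prob \<xi> \<epsilon> (\<epsilon> powr (lfpp_distance_exponent M h \<xi> - \<zeta>))) \<longlongrightarrow> 1) (at_right 0)" if \<zeta>: "0 < \<zeta>"
  proof -
    have "S \<noteq> {}" using S(2)[of 1] by auto
    then obtain \<alpha> where "\<alpha> \<in> S" "Sup S - \<zeta> < \<alpha>" using less_cSup_iff[of S "Sup S - \<zeta>"] S(1) \<zeta> by auto
    then show ?thesis using S(3)[of \<alpha>] by (simp add: lam)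
  qed
qed

lemma simple_paths_length_sets:
  assumes e: "0 < \<epsilon>"
  shows "{\<omega> \<in> space M. \<forall>P. simple_lattice_path \<epsilon> P \<and> lfpp_length h \<xi> \<epsilon> \<omega> P \<le> c \<longrightarrow> Q P} \<in> events"
proof -
  have [measurable]: "(\<lambda>\<omega>. lfpp_length h \<xi> \<epsilon> \<omega> P) \<in> borel_measurable M" for P
    by (rule lfpp_length_measurable) (rule measurable_circle[OF e])
  have "{\<omega> \<in> space M. \<forall>P. simple_lattice_path \<epsilon> P \<and> lfpp_length h \<xi> \<epsilon> \<omega> P \<le> c \<longrightarrow> Q P} =
      {\<omega> \<in> space M. \<forall>P\<in>{P. simple_lattice_path \<epsilon> P}. lfpp_length h \<xi> \<epsilon> \<omega> P \<le> c \<longrightarrow> Q P}" by auto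
  also have "\<dots> \<in> events"
    by (rule sets.sets_Collect_finite_All[OF _ finite_simple_paths[OF e]]) measurable
  finally show ?thesis .
qed

text \<open>If a path has more than \<epsilon>^E vertices, its mean weight over \<epsilon> is at
  most \<epsilon>^(\<xi> a), so the negative moment is at least \<epsilon>^(E - a^2). Markov's
  inequality compares this with its expectation of order \<epsilon>^(-2 - a^2/2), and the quadratic
  equation for \<open>a\<close> turns the quotient into \<epsilon>^\<zeta>.\<close>

lemma simple_paths_length_prob:
  fixes \<xi> lam \<zeta> \<epsilon> a :: real
  assumes e: "0 < \<epsilon>" "\<epsilon> < 1" and \<xi>: "0 < \<xi>" and a: "0 \<le> a" "a\<^sup>2 + 2 * \<xi> * a = 2 + 2 * lam"
  shows "1 - 4 * exp (a\<^sup>2 * variance_const / 2) * \<epsilon> powr \<zeta> \<le>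
    prob {\<omega> \<in> space M. \<forall>P. simple_lattice_path \<epsilon> P \<and> lfpp_length h \<xi> \<epsilon> \<omega> P \<le> \<epsilon> powr (lam - \<zeta>) \<longrightarrow>
      real (length P) \<le> \<epsilon> powr (lam - \<xi> * a - 1 - \<zeta>)}"
proof -
  note [measurable] = measurable_circle[OF e(1)]
  define E where "E = lam - \<xi> * a - 1 - \<zeta>"
  define B where "B = {\<omega> \<in> space M. \<epsilon> powr (E - a\<^sup>2) \<le> negative_moment h a \<epsilon> \<omega>}"
  have [measurable]: "B \<in> events" unfolding B_def by measurable
  have "prob B \<le> 4 * exp (a\<^sup>2 * variance_const / 2) * \<epsilon> powr (- 2 - a\<^sup>2 / 2) / \<epsilon> powr (E - a\<^sup>2)"
    unfolding B_def using e by (intro negative_moment_tail) auto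
  also have "\<dots> = 4 * exp (a\<^sup>2 * variance_const / 2) * (\<epsilon> powr (- 2 - a\<^sup>2 / 2) / \<epsilon> powr (E - a\<^sup>2))" by simp
  also have "\<epsilon> powr (- 2 - a\<^sup>2 / 2) / \<epsilon> powr (E - a\<^sup>2) = \<epsilon> powr \<zeta>"
  proof -
    have "- 2 - a\<^sup>2 / 2 - (E - a\<^sup>2) = \<zeta>" using a(2) unfolding E_def by (simp add: field_simps)
    then show ?thesis by (subst powr_diff[symmetric]) simp
  qed
  finally have B: "prob B \<le> 4 * exp (a\<^sup>2 * variance_const / 2) * \<epsilon> powr \<zeta>" .
  have "space M - B \<subseteq> {\<omega> \<in> space M. \<forall>P. simple_lattice_path \<epsilon> P \<and> lfpp_length h \<xi> \<epsilon> \<omega> P \<le> \<epsilon> powr (lam - \<zeta>) \<longrightarrow> real (length P) \<le> \<epsilon> powr E}"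
  proof (intro subsetI CollectI conjI allI impI)
    fix \<omega> assume "\<omega> \<in> space M - B"
    then show "\<omega> \<in> space M" by simp
  next
    fix \<omega> P assume \<omega>: "\<omega> \<in> space M - B" and P: "simple_lattice_path \<epsilon> P \<and> lfpp_length h \<xi> \<epsilon> \<omega> P \<le> \<epsilon> powr (lam - \<zeta>)"
    have "P \<noteq> []" using P by (simp add: simple_lattice_path_def lattice_path_def)
    then have Lpos: "0 < lfpp_length h \<xi> \<epsilon> \<omega> P" by (rule lfpp_length_pos[OF e(1)])
    show "real (length P) \<le> \<epsilon> powr E"
    proof (rule ccontr)
      assume "\<not> ?thesis"
      then have n: "\<epsilon> powr E < real (length P)" by simp
      then have n0: "0 < real (length P)" using \<open>P \<noteq> []\<close> by simp
      define m where "m = lfpp_length h \<xi> \<epsilon> \<omega> P / (\<epsilon> * real (length P))"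
      have m: "0 < m" using Lpos e n0 by (simp add: m_def)
      have "m \<le> \<epsilon> powr (lam - \<zeta>) / (\<epsilon> * \<epsilon> powr E)"
        unfolding m_def using P n e by (intro frac_le) (auto intro!: mult_left_mono)
      also have "\<dots> = \<epsilon> powr (lam - \<zeta>) / (\<epsilon> powr 1 * \<epsilon> powr E)" using e by simp
      also have "\<dots> = \<epsilon> powr (lam - \<zeta> - (1 + E))" by (simp only: powr_add[symmetric] powr_diff[symmetric])
      \<comment> \<open>\<zeta> cancels here: the slack allowed in the length of the path equals the
        slack in the number of vertices.\<close>
      also have "lam - \<zeta> - (1 + E) = \<xi> * a" by (simp add: E_def)
      finally have "(\<epsilon> powr (\<xi> * a)) powr (- a / \<xi>) \<le> m powr (- a / \<xi>)"
        using m a \<xi> e by (intro powr_mono2') (auto simp: divide_nonneg_pos)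
      also have "(\<epsilon> powr (\<xi> * a)) powr (- a / \<xi>) = \<epsilon> powr (- a\<^sup>2)"
        using \<xi> by (simp add: powr_powr power2_eq_square)
      finally have "\<epsilon> powr E * \<epsilon> powr (- a\<^sup>2) \<le> real (length P) * m powr (- a / \<xi>)"
        using n by (intro mult_mono) auto
      also have "\<dots> \<le> negative_moment h a \<epsilon> \<omega>"
        unfolding m_def using P by (intro simple_path_negative_moment e \<xi> a) simp
      finally have "\<epsilon> powr (E - a\<^sup>2) \<le> negative_moment h a \<epsilon> \<omega>"
        by (simp add: powr_add[symmetric])
      then show False using \<omega> by (simp add: B_def)
    qed
  qed
  then have "prob (space M - B) \<le> prob {\<omega> \<in> space M. \<forall>P. simple_lattice_path \<epsilon> P \<and> lfpp_length h \<xi> \<epsilon> \<omega> P \<le> \<epsilon> powr (lam - \<zeta>) \<longrightarrow> real (length P) \<le> \<epsilon> powr E}"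
    by (rule finite_measure_mono[OF _ simple_paths_length_sets[OF e(1)]])
  moreover have "prob (space M - B) = 1 - prob B" by (rule prob_compl) measurable
  ultimately show ?thesis using B unfolding E_def by linarith
qed

lemma simple_paths_length_tendsto_1:
  fixes \<xi> \<zeta> :: real
  assumes \<xi>: "0 < \<xi>" and \<zeta>: "0 < \<zeta>"
  defines "lam \<equiv> lfpp_distance_exponent M h \<xi>"
  shows "((\<lambda>\<epsilon>. prob {\<omega> \<in> space M. \<forall>P. simple_lattice_path \<epsilon> P \<and> lfpp_length h \<xi> \<epsilon> \<omega> P \<le> \<epsilon> powr (lam - \<zeta>) \<longrightarrow>
      real (length P) \<le> \<epsilon> powr (lam - \<xi> * (sqrt (2 + 2 * lam + \<xi>\<^sup>2) - \<xi>) - 1 - \<zeta>)}) \<longlongrightarrow> 1) (at_right 0)"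
proof -
  define s where "s = sqrt (2 + 2 * lam + \<xi>\<^sup>2)"
  have lam: "- 1 \<le> lam" unfolding lam_def by (rule distance_exponent_ge[OF \<xi>])
  then have s: "\<xi> \<le> s" "s\<^sup>2 = 2 + 2 * lam + \<xi>\<^sup>2"
    using \<xi> unfolding s_def by (auto intro: real_le_rsqrt)
  \<comment> \<open>The quadratic equation is (a + \<xi>)^2 = 2 + 2 lam + \<xi>^2, solved by a = s -
    \<xi>; this is nonnegative because lam >= -1.\<close>
  have a: "0 \<le> s - \<xi>" "(s - \<xi>)\<^sup>2 + 2 * \<xi> * (s - \<xi>) = 2 + 2 * lam"
    using s by (auto simp: power2_eq_square algebra_simps)
  define C where "C = 4 * exp ((s - \<xi>)\<^sup>2 * variance_const / 2)"
  show ?thesis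
    unfolding s_def[symmetric]
  proof (rule tendsto_1_squeeze[where g="\<lambda>\<epsilon>. C * \<epsilon> powr \<zeta>"])
    show "\<forall>\<^sub>F \<epsilon> in at_right 0. 1 - C * \<epsilon> powr \<zeta> \<le> prob {\<omega> \<in> space M. \<forall>P. simple_lattice_path \<epsilon> P \<and> lfpp_length h \<xi> \<epsilon> \<omega> P \<le> \<epsilon> powr (lam - \<zeta>) \<longrightarrow>
      real (length P) \<le> \<epsilon> powr (lam - \<xi> * (s - \<xi>) - 1 - \<zeta>)}"
      using eventually_small[of 1] by (rule eventually_mono) (use simple_paths_length_prob[OF _ _ \<xi> a] in \<open>auto simp: C_def\<close>)
    show "((\<lambda>\<epsilon>. C * \<epsilon> powr \<zeta>) \<longlongrightarrow> 0) (at_right 0)" using \<zeta> by real_asymp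
  qed simp
qed

text \<open>The geodesic is simple and realises the crossing distance, which is likely at most
  \<epsilon>^(lam - \<zeta>); the bound for all such simple paths then applies to it. The two
  failure probabilities add up.\<close>

lemma geodesic_length_tendsto_1:
  fixes \<xi> \<zeta> :: real
  assumes \<xi>: "0 < \<xi>" and \<zeta>: "0 < \<zeta>"
  defines "lam \<equiv> lfpp_distance_exponent M h \<xi>"
  shows "((\<lambda>\<epsilon>. prob {\<omega> \<in> space M. real (length (lfpp_geodesic h \<xi> \<epsilon> \<omega>)) \<le>
      \<epsilon> powr (lam - \<xi> * (sqrt (2 + 2 * lam + \<xi>\<^sup>2) - \<xi>) - 1 - \<zeta>)}) \<longlongrightarrow> 1) (at_right 0)"
proof -
  define E where "E = lam - \<xi> * (sqrt (2 + 2 * lam + \<xi>\<^sup>2) - \<xi>) - 1 - \<zeta>"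
  define p where "p \<epsilon> = prob {\<omega> \<in> space M. \<forall>P. simple_lattice_path \<epsilon> P \<and> lfpp_length h \<xi> \<epsilon> \<omega> P \<le> \<epsilon> powr (lam - \<zeta>) \<longrightarrow> real (length P) \<le> \<epsilon> powr E}" for \<epsilon>
  define q where "q \<epsilon> = distance_prob \<xi> \<epsilon> (\<epsilon> powr (lam - \<zeta>))" for \<epsilon>
  have p: "(p \<longlongrightarrow> 1) (at_right 0)"
    using simple_paths_length_tendsto_1[OF \<xi> \<zeta>] unfolding p_def[abs_def] E_def lam_def .
  have q: "(q \<longlongrightarrow> 1) (at_right 0)"
    using crossing_distance_below_exponent[OF \<xi> \<zeta>] unfolding q_def[abs_def] lam_def .
  show ?thesis
    unfolding E_def[symmetric]
  proof (rule tendsto_1_squeeze[where g="\<lambda>\<epsilon>. (1 - p \<epsilon>) + (1 - q \<epsilon>)"])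
    show "\<forall>\<^sub>F \<epsilon> in at_right 0. 1 - ((1 - p \<epsilon>) + (1 - q \<epsilon>)) \<le> prob {\<omega> \<in> space M. real (length (lfpp_geodesic h \<xi> \<epsilon> \<omega>)) \<le> \<epsilon> powr E}"
      using eventually_small[of 1]
    proof (rule eventually_mono)
      fix \<epsilon> :: real assume e: "0 < \<epsilon> \<and> \<epsilon> < 1"
      define A where "A = {\<omega> \<in> space M. \<forall>P. simple_lattice_path \<epsilon> P \<and> lfpp_length h \<xi> \<epsilon> \<omega> P \<le> \<epsilon> powr (lam - \<zeta>) \<longrightarrow> real (length P) \<le> \<epsilon> powr E}"
      define B where "B = {\<omega> \<in> space M. crossing_distance \<xi> \<epsilon> \<omega> \<le> \<epsilon> powr (lam - \<zeta>)}"
      define G where "G = {\<omega> \<in> space M. real (length (lfpp_geodesic h \<xi> \<epsilon> \<omega>)) \<le> \<epsilon> powr E}"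
      have ev: "A \<in> events" "B \<in> events" "G \<in> events"
      proof -
        show "A \<in> events" unfolding A_def using e by (intro simple_paths_length_sets) simp
        show "B \<in> events" unfolding B_def using e by (intro crossing_distance_sets) simp
        show "G \<in> events" unfolding G_def
          by (rule lfpp_geodesic_length_measurable[where C="\<lambda>P. real (length P) \<le> \<epsilon> powr E"]) (use e measurable_circle in auto)
      qed
      have "A \<inter> B \<subseteq> G"
      proof
        fix \<omega> assume \<omega>: "\<omega> \<in> A \<inter> B"
        have "lfpp_geodesic h \<xi> \<epsilon> \<omega> \<in> simple_crossings \<epsilon>"
          using lfpp_geodesic_minimizer[of \<epsilon> h \<xi> \<omega>] lfpp_minimizers_eq[of \<epsilon> h \<xi> \<omega>] e by auto
        then have "simple_lattice_path \<epsilon> (lfpp_geodesic h \<xi> \<epsilon> \<omega>)"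
          by (auto simp: simple_crossings_def crossing_def simple_lattice_path_def)
        then show "\<omega> \<in> G" using \<omega> e by (auto simp: A_def B_def G_def lfpp_set_dist_eq)
      qed
      then have "1 - prob G \<le> 1 - prob (A \<inter> B)" using ev by (simp add: finite_measure_mono)
      also have "\<dots> = prob (space M - A \<inter> B)" using ev by (subst prob_compl) auto
      also have "space M - A \<inter> B = (space M - A) \<union> (space M - B)" by auto
      also have "prob \<dots> \<le> prob (space M - A) + prob (space M - B)" using ev by (intro measure_Un_le) auto
      also have "\<dots> = (1 - p \<epsilon>) + (1 - q \<epsilon>)" unfolding p_def q_def A_def[symmetric] B_def[symmetric] using ev by (simp add: prob_compl)
      finally show "1 - ((1 - p \<epsilon>) + (1 - q \<epsilon>)) \<le> prob {\<omega> \<in> space M. real (length (lfpp_geodesic h \<xi> \<epsilon> \<omega>)) \<le> \<epsilon> powr E}"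
        by (simp add: G_def)
    qed simp
    show "((\<lambda>\<epsilon>. (1 - p \<epsilon>) + (1 - q \<epsilon>)) \<longlongrightarrow> 0) (at_right 0)"
      using tendsto_add[OF tendsto_diff[OF tendsto_const[of 1] p] tendsto_diff[OF tendsto_const[of 1] q]] by simp
  qed simp
qed

text \<open>The infimum runs over positive exponents only, so the bound \<open>b\<close> must be
  shown to be nonnegative. If it were negative, the geodesic would with high probability have fewer
  than one vertex.\<close>

lemma geodesic_dimension_le:
  fixes \<xi> :: real
  assumes \<xi>: "0 < \<xi>"
  defines "lam \<equiv> lfpp_distance_exponent M h \<xi>"
  shows "lfpp_geodesic_dimension M h \<xi> \<le> 1 - lam + \<xi> * (sqrt (2 + 2 * lam + \<xi>\<^sup>2) - \<xi>)"
proof -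
  define b where "b = 1 - lam + \<xi> * (sqrt (2 + 2 * lam + \<xi>\<^sup>2) - \<xi>)"
  define p where "p \<alpha> \<epsilon> = prob {\<omega> \<in> space M. real (length (lfpp_geodesic h \<xi> \<epsilon> \<omega>)) \<le> \<epsilon> powr (- \<alpha>)}" for \<alpha> \<epsilon>
  have lim: "(p (b + \<zeta>) \<longlongrightarrow> 1) (at_right 0)" if "0 < \<zeta>" for \<zeta>
  proof -
    have eq: "- (b + \<zeta>) = lam - \<xi> * (sqrt (2 + 2 * lam + \<xi>\<^sup>2) - \<xi>) - 1 - \<zeta>" by (simp add: b_def)
    show ?thesis
      using geodesic_length_tendsto_1[OF \<xi> that] unfolding p_def[abs_def] eq lam_def .
  qed
  have b0: "0 \<le> b"
  proof (rule ccontr)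
    assume "\<not> 0 \<le> b"
    then have b: "b < 0" by simp
    have "\<forall>\<^sub>F \<epsilon> in at_right 0. p (b + - b / 2) \<epsilon> \<le> 0"
      using eventually_small[of 1]
    proof (rule eventually_mono)
      fix \<epsilon> :: real assume e: "0 < \<epsilon> \<and> \<epsilon> < 1"
      have lt: "\<epsilon> powr (- (b + - b / 2)) < 1" using powr_less_mono2[of "- (b + - b / 2)" \<epsilon> 1] e b by simp
      have len: "1 \<le> real (length (lfpp_geodesic h \<xi> \<epsilon> \<omega>))" for \<omega>
        using lfpp_geodesic_minimizer[of \<epsilon> h \<xi> \<omega>] e
        by (cases "lfpp_geodesic h \<xi> \<epsilon> \<omega>") (auto simp: lfpp_minimizers_def crossing_def lattice_path_def)
      have "\<not> real (length (lfpp_geodesic h \<xi> \<epsilon> \<omega>)) \<le> \<epsilon> powr (- (b + - b / 2))" for \<omega>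
        using less_le_trans[OF lt len, of \<omega>] by linarith
      then have "{\<omega> \<in> space M. real (length (lfpp_geodesic h \<xi> \<epsilon> \<omega>)) \<le> \<epsilon> powr (- (b + - b / 2))} = {}" by blast
      then show "p (b + - b / 2) \<epsilon> \<le> 0" unfolding p_def by (simp only: measure_empty order_refl)
    qed simp
    from tendsto_upperbound[OF lim this] b show False by simp
  qed
  show ?thesis
    unfolding b_def[symmetric]
  proof (rule field_le_epsilon)
    fix \<zeta> :: real assume \<zeta>: "0 < \<zeta>"
    have "Liminf (at_right 0) (\<lambda>\<epsilon>. ereal (p (b + \<zeta>) \<epsilon>)) = 1"
      using lim[OF \<zeta>] by (subst Liminf_eq_1_iff) (auto simp: p_def)
    then show "lfpp_geodesic_dimension M h \<xi> \<le> b + \<zeta>"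
      unfolding lfpp_geodesic_dimension_def using b0 \<zeta>
      by (intro cInf_lower bdd_belowI[of _ 0]) (auto simp: p_def)
  qed
qed

end

theorem corollary2p7:
  fixes M :: "'a measure" and h :: "complex measure \<Rightarrow> 'a \<Rightarrow> real" and \<xi> :: real
  assumes "whole_plane_gff M h" and "\<xi> > 0"
  defines "lam \<equiv> lfpp_distance_exponent M h \<xi>"
  shows "(\<forall>\<zeta>>0. ((\<lambda>\<epsilon>. measure M {\<omega> \<in> space M. \<forall>P.
            simple_lattice_path \<epsilon> P \<and> lfpp_length h \<xi> \<epsilon> \<omega> P \<le> \<epsilon> powr (lam - \<zeta>) \<longrightarrow>
            real (length P) \<le> \<epsilon> powr (lam - \<xi> * (sqrt (2 + 2 * lam + \<xi>\<^sup>2) - \<xi>) - 1 - \<zeta>)})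
          \<longlongrightarrow> 1) (at_right 0)) \<and>
         lfpp_geodesic_dimension M h \<xi> \<le> 1 - lam + \<xi> * (sqrt (2 + 2 * lam + \<xi>\<^sup>2) - \<xi>)"
proof -
  interpret whole_plane_gff M h by fact
  show ?thesis
    unfolding lam_def using simple_paths_length_tendsto_1[OF assms(2)] geodesic_dimension_le[OF assms(2)] by blast
qed

end
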